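(* Let $A\in 2^\omega$. The following are equivalent: (i) $A\in\mathrm{Low}(\mathrm{MLR},\mathrm{SR})$, i.e., $\mathrm{MLR}\subseteq\mathrm{SR}^A$. (ii) For every $A$-computable measure machine $M$, we have $\mathrm{K}\leq\mathrm{K}_M+O(1)$, i.e., there is a constant $c$ such that $\mathrm{K}(\sigma)\leq\mathrm{K}_M(\sigma)+c$ for all $\sigma\in 2^{<\omega}$.
   Context: $2^{<\omega}$ is the set of finite binary strings and $2^\omega$ is Cantor space with uniform measure $\mu$. A prefix-free machine (relative to $A$) is a partial computable (resp. partial $A$-computable) function $M:2^{<\omega}\to 2^{<\omega}$ whose domain is prefix-free; $\mathrm{K}_M(\sigma)=\min\{|p|:M(p)=\sigma\}$ (with value $+\infty$ if there is no such $p$). $\mathrm{K}$ is $\mathrm{K}_{M_{opt}}$ for a fixed (unrelativized) optimal prefix-free machine $M_{opt}$. An $A$-computable measure machine is a prefix-free machine relative to $A$ whose domain has $A$-computable measure $\sum_{p\in\mathrm{dom}(M)}2^{-|p|}$. A Martin-Löf test is a non-increasing sequence $(\mathcal{U}_n)_{n\in\mathbb{N}}$ of uniformly c.e. open subsets of $2^\omega$ with $\mu(\mathcal{U}_n)\leq 2^{-n}$ for all $n$; $\mathrm{MLR}$ is the set of $X$ with $X\notin\bigcap_n\mathcal{U}_n$ for every Martin-Löf test. An $A$-Schnorr test is a non-increasing sequence $(\mathcal{U}_n)_{n\in\mathbb{N}}$ of uniformly $A$-c.e. open sets with $\mu(\mathcal{U}_n)=2^{-n}$ for all $n$; $\mathrm{SR}^A$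 is the set of $X$ with $X\notin\bigcap_n\mathcal{U}_n$ for every $A$-Schnorr test. *)

theory Defs
  imports "HOL-Probability.Probability" "HOL-Library.Sublist"
begin

section \<open>Partial recursive functions relative to a set of total functions\<close>

definition mu_search :: "(nat \<Rightarrow> nat option) \<Rightarrow> nat option" where
  "mu_search h =
     (if \<exists>n. h n = Some 0 \<and> (\<forall>m<n. h m \<noteq> None)
      then Some (LEAST n. h n = Some 0) else None)"

text \<open>
  Kleene's partial recursive functions with the members of \<open>F\<close> added to the initial functions.
  In \<open>partrec_in F k f\<close> the number \<open>k\<close> is the arity: only the values of \<open>f\<close> on lists of length
  \<open>k\<close> are meaningful. All notions below are parametrized by \<open>F\<close>; the unrelativized ones are
  obtained for \<open>F = {}\<close>, those relative to \<open>A\<close> for \<open>F = oracle_of A\<close>.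
\<close>

inductive partrec_in :: "(nat \<Rightarrow> nat) set \<Rightarrow> nat \<Rightarrow> (nat list \<Rightarrow> nat option) \<Rightarrow> bool"
  for F :: "(nat \<Rightarrow> nat) set" where
  zero: "partrec_in F k (\<lambda>xs. Some 0)"
| succ: "partrec_in F 1 (\<lambda>xs. Some (Suc (xs ! 0)))"
| proj: "i < k \<Longrightarrow> partrec_in F k (\<lambda>xs. Some (xs ! i))"
| initial: "h \<in> F \<Longrightarrow> partrec_in F 1 (\<lambda>xs. Some (h (xs ! 0)))"
| comp: "partrec_in F (length gs) f \<Longrightarrow> (\<forall>g\<in>set gs. partrec_in F k g) \<Longrightarrow>
    partrec_in F k (\<lambda>xs. if \<exists>g\<in>set gs. g xs = None then None
                         else f (map (\<lambda>g. the (g xs)) gs))"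
| prim_rec: "partrec_in F k f \<Longrightarrow> partrec_in F (k + 2) g \<Longrightarrow>
    partrec_in F (Suc k) (\<lambda>xs. rec_nat (f (tl xs))
       (\<lambda>n r. Option.bind r (\<lambda>y. g (n # y # tl xs))) (hd xs))"
| mu: "partrec_in F (Suc k) f \<Longrightarrow>
    partrec_in F k (\<lambda>xs. mu_search (\<lambda>n. f (n # xs)))"

definition oracle_of :: "(nat \<Rightarrow> bool) \<Rightarrow> (nat \<Rightarrow> nat) set" where
  "oracle_of A = {\<lambda>n. of_bool (A n)}"

definition computable_fun :: "(nat \<Rightarrow> nat) set \<Rightarrow> (nat \<Rightarrow> nat) \<Rightarrow> bool" where
  "computable_fun F f \<longleftrightarrow> (\<exists>g. partrec_in F 1 g \<and> (\<forall>n. g [n] = Some (f n)))"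

text \<open>
  The sequence \<open>(a n - b n) / (d n + 1)\<close> is the general form of a computable sequence of rationals.
\<close>

definition computable_real :: "(nat \<Rightarrow> nat) set \<Rightarrow> real \<Rightarrow> bool" where
  "computable_real F x \<longleftrightarrow>
     (\<exists>a b d. computable_fun F a \<and> computable_fun F b \<and> computable_fun F d \<and>
        (\<forall>n. \<bar>x - (real (a n) - real (b n)) / (real (d n) + 1)\<bar> \<le> (1 / 2) ^ n))"

section \<open>Strings and prefix-free machines\<close>

text \<open>Bijective base-2 numeration, least significant digit first.\<close>

fun str_code :: "bool list \<Rightarrow> nat" where
  "str_code [] = 0"
| "str_code (b # s) = 2 * str_code s + (if b then 2 else 1)"

lemma bij_str_code: "bij str_code"
proof (rule bijI)
  show "inj str_code"
  proof (rule injI)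
    fix s t show "str_code s = str_code t \<Longrightarrow> s = t"
    proof (induction s arbitrary: t)
      case Nil
      then show ?case by (cases t) (auto split: if_splits)
    next
      case (Cons b s)
      then obtain b' t' where t: "t = b' # t'" by (cases t) (auto split: if_splits)
      have "b = b' \<and> str_code s = str_code t'"
        using Cons.prems unfolding t by (cases b; cases b'; simp; presburger)
      then show ?case using Cons.IH t by blast
    qed
  qed
  have "\<exists>s. str_code s = n" for n
  proof (induction n rule: less_induct)
    case (less n)
    have "n = 0 \<or> (\<exists>m. n = 2 * m + 1) \<or> (\<exists>m. n = 2 * m + 2)"
      by presburger
    then consider "n = 0" | m where "n = 2 * m + 1" | m where "n = 2 * m + 2"
      by blast
    then show ?case
    proof cases
      case 1
      then show ?thesis by (intro exI[of _ "[]"]) simp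
    next
      case (2 m)
      then obtain s where "str_code s = m" using less[of m] by auto
      then show ?thesis using 2 by (intro exI[of _ "False # s"]) simp
    next
      case (3 m)
      then obtain s where "str_code s = m" using less[of m] by auto
      then show ?thesis using 3 by (intro exI[of _ "True # s"]) simp
    qed
  qed
  then show "surj str_code" unfolding surj_def by metis
qed

definition partial_computable ::
    "(nat \<Rightarrow> nat) set \<Rightarrow> (bool list \<Rightarrow> bool list option) \<Rightarrow> bool" where
  "partial_computable F M \<longleftrightarrow>
     (\<exists>g. partrec_in F 1 g \<and> (\<forall>p. g [str_code p] = map_option str_code (M p)))"

definition prefix_free :: "bool list set \<Rightarrow> bool" where
  "prefix_free S \<longleftrightarrow> (\<forall>p\<in>S. \<forall>q\<in>S. prefix p q \<longrightarrow> p = q)"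

definition prefix_free_machine ::
    "(nat \<Rightarrow> nat) set \<Rightarrow> (bool list \<Rightarrow> bool list option) \<Rightarrow> bool" where
  "prefix_free_machine F M \<longleftrightarrow> partial_computable F M \<and> prefix_free (dom M)"

text \<open>The infimum of the empty set in \<^typ>\<open>enat\<close> is \<open>\<infinity>\<close>.\<close>

definition K :: "(bool list \<Rightarrow> bool list option) \<Rightarrow> bool list \<Rightarrow> enat" where
  "K M \<sigma> = (INF p \<in> {p. M p = Some \<sigma>}. enat (length p))"

definition optimal_prefix_free_machine :: "(bool list \<Rightarrow> bool list option) \<Rightarrow> bool" where
  "optimal_prefix_free_machine U \<longleftrightarrow> prefix_free_machine {} U \<and>
     (\<forall>M. prefix_free_machine {} M \<longrightarrow> (\<exists>c::nat. \<forall>\<sigma>. K U \<sigma> \<le> K M \<sigma> + enat c))"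

text \<open>The sum converges for every prefix-free domain, by Kraft's inequality.\<close>

definition computable_measure_machine ::
    "(nat \<Rightarrow> nat) set \<Rightarrow> (bool list \<Rightarrow> bool list option) \<Rightarrow> bool" where
  "computable_measure_machine F M \<longleftrightarrow> prefix_free_machine F M \<and>
     computable_real F (\<Sum>\<^sub>\<infinity>p\<in>dom M. (1 / 2) ^ length p)"

section \<open>Cantor space, tests and randomness\<close>

definition cantor_measure :: "(nat \<Rightarrow> bool) measure" where
  "cantor_measure = (\<Pi>\<^sub>M i\<in>UNIV. measure_pmf (bernoulli_pmf (1 / 2)))"

definition cylinder :: "bool list \<Rightarrow> (nat \<Rightarrow> bool) set" where
  "cylinder \<sigma> = {X. \<forall>i<length \<sigma>. X i = \<sigma> ! i}"

text \<open>A c.e. set of pairs (index, string) is the domain of a binary partial recursive function.\<close>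

definition uniformly_ce_open ::
    "(nat \<Rightarrow> nat) set \<Rightarrow> (nat \<Rightarrow> (nat \<Rightarrow> bool) set) \<Rightarrow> bool" where
  "uniformly_ce_open F U \<longleftrightarrow>
     (\<exists>g. partrec_in F 2 g \<and>
        (\<forall>n. U n = (\<Union>\<sigma>\<in>{\<sigma>. g [n, str_code \<sigma>] \<noteq> None}. cylinder \<sigma>)))"

definition martin_lof_test :: "(nat \<Rightarrow> (nat \<Rightarrow> bool) set) \<Rightarrow> bool" where
  "martin_lof_test U \<longleftrightarrow> decseq U \<and> uniformly_ce_open {} U \<and>
     (\<forall>n. measure cantor_measure (U n) \<le> (1 / 2) ^ n)"

definition schnorr_test :: "(nat \<Rightarrow> bool) \<Rightarrow> (nat \<Rightarrow> (nat \<Rightarrow> bool) set) \<Rightarrow> bool" where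
  "schnorr_test A U \<longleftrightarrow> decseq U \<and> uniformly_ce_open (oracle_of A) U \<and>
     (\<forall>n. measure cantor_measure (U n) = (1 / 2) ^ n)"

definition MLR :: "(nat \<Rightarrow> bool) set" where
  "MLR = {X. \<forall>U. martin_lof_test U \<longrightarrow> X \<notin> (\<Inter>n. U n)}"

definition SR :: "(nat \<Rightarrow> bool) \<Rightarrow> (nat \<Rightarrow> bool) set" where
  "SR A = {X. \<forall>U. schnorr_test A U \<longrightarrow> X \<notin> (\<Inter>n. U n)}"

definition Low_MLR_SR :: "(nat \<Rightarrow> bool) set" where
  "Low_MLR_SR = {A. MLR \<subseteq> SR A}"

end

theory Submission
  imports Defs
begin

text \<open>
  Both directions trade small open sets for short descriptions.

  From the complexity bound to lowness. Let \<open>U\<close> be a Schnorr test relative to \<open>A\<close>. Generate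
  \<open>U (2n+2)\<close> by a prefix-free set of strings and request a description of length \<open>|s| - n\<close> for
  each generator \<open>s\<close>. The requests have total weight \<open>\<Sum>n. 2^n * 2^-(2n+2) = 1/2\<close>, which the
  machine existence theorem (\<open>kraft_chaitin\<close>) can serve, and since the measures of a Schnorr test
  are known exactly, so is the measure of the domain of the resulting machine
  (\<open>machine_of_test\<close>). If \<open>K\<close> is below the complexity of this machine up to a constant, then a
  member of all \<open>U n\<close> has, for every \<open>n\<close>, an initial segment with \<open>K \<le> length - n\<close>, and such
  sequences are captured by the Martin-Loef test of deficiency sets.

  From lowness to the complexity bound. Give each pair \<open>(s, k)\<close> its own set of \<open>k\<close> coordinates
  and let its block be the clopen set of measure \<open>2^-k\<close> on which these coordinates are all true;
  distinct blocks are independent. For a computable measure machine \<open>M\<close> relative to \<open>A\<close>, consider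
  the sequences lying in the blocks of \<open>(M p, |p|)\<close> for infinitely many \<open>p\<close>. The tails of this
  sequence of blocks are open sets whose measures are effectively small, because the measure of
  the domain of \<open>M\<close> is computable; padded to measure exactly \<open>2^-n\<close> they form a Schnorr test
  relative to \<open>A\<close> (\<open>schnorr_test_padding\<close>, \<open>schnorr_test_of_machine\<close>). Let \<open>W\<close> be the open set of
  sequences compressible by one bit, so that everything outside \<open>W\<close> is Martin-Loef random
  (\<open>incompressible_MLR\<close>). If, whenever \<open>cylinder t - W\<close> has positive measure, infinitely many of
  the blocks met it in positive measure, then repeated extension would lead to a sequence outside
  \<open>W\<close> in infinitely many blocks (\<open>generic_extension\<close>), against lowness. Hence some
  \<open>P = cylinder t - W\<close> of positive measure misses, up to null sets, all but finitely many of the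
  blocks. Now \<open>A\<close> can be forgotten: the condition that the block of \<open>(s, k)\<close> meets \<open>P\<close> in measure
  less than \<open>\<epsilon> * 2^-k\<close> is c.e. without an oracle, and for small \<open>\<epsilon>\<close> the weights \<open>2^-k\<close> of the
  pairs that satisfy it have a finite sum, by the second moment of the number of blocks that
  contain a given sequence (\<open>block_second_moment\<close>). The machine existence theorem turns these
  pairs into descriptions of \<open>s\<close> of length \<open>k + O(1)\<close> (\<open>complexity_bound_small_blocks\<close>).

  Partial recursive functions are run for a limited number of steps one function at a time: by
  induction on the schemes of \<^const>\<open>partrec_in\<close>, each of them is approximated by a total
  function with an additional stage argument (\<open>partrec_approximation\<close>).
\<close>


section \<open>Computability on coded types\<close>

text \<open>
  A type class instance cannot be declared for \<^typ>\<open>bool list\<close> alone. Restricting the elements of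
  lists to \<open>letter\<close>s, of which \<^typ>\<open>bool\<close> is the instance, has the same effect.
\<close>

class letter =
  fixes is_one :: "'a \<Rightarrow> bool"
  assumes bij_is_one: "bij is_one"

instantiation bool :: letter
begin
definition is_one_bool :: "bool \<Rightarrow> bool" where "is_one_bool b = b"
instance proof
  show "bij (is_one :: bool \<Rightarrow> bool)"
    by (intro bijI injI surjI[of _ id]) (auto simp: is_one_bool_def)
qed
end

text \<open>
  Codings are bijective, so that a search through any coded type is a search through \<^typ>\<open>nat\<close>,
  and coding and decoding are the identity on codes.
\<close>

class enc =
  fixes code :: "'a \<Rightarrow> nat"
  assumes bij_code: "bij code"
begin

definition decode :: "nat \<Rightarrow> 'a" where "decode = inv code"

lemma decode_code [simp]: "decode (code x) = x"
  unfolding decode_def using bij_code by (simp add: bij_is_inj)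

lemma code_decode [simp]: "code (decode n) = n"
  unfolding decode_def using bij_code by (simp add: bij_is_surj surj_f_inv_f)

lemma code_eq_iff [simp]: "code x = code y \<longleftrightarrow> x = y"
  using bij_code by (auto simp: bij_def inj_def)

end

instantiation nat :: enc
begin
definition code_nat :: "nat \<Rightarrow> nat" where [simp]: "code_nat n = n"
instance proof
  show "bij (code :: nat \<Rightarrow> nat)"
    by (intro bijI injI surjI[of _ id]) auto
qed
end

lemma decode_nat [simp]: "decode (n::nat) = n"
  using decode_code[of n] by (simp del: decode_code)

instantiation prod :: (enc, enc) enc
begin
definition code_prod :: "'a \<times> 'b \<Rightarrow> nat" where
  "code_prod x = prod_encode (code (fst x), code (snd x))"
instance proof
  have eq: "(code :: 'a \<times> 'b \<Rightarrow> nat) = prod_encode \<circ> map_prod (code :: 'a \<Rightarrow> nat) (code :: 'b \<Rightarrow> nat)"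
    by (auto simp: code_prod_def)
  have "bij (map_prod (code :: 'a \<Rightarrow> nat) (code :: 'b \<Rightarrow> nat))"
    by (rule bijI; rule prod.inj_map map_prod_surj) (simp_all add: bij_is_inj bij_is_surj bij_code)
  then show "bij (code :: 'a \<times> 'b \<Rightarrow> nat)"
    unfolding eq by (rule bij_comp) (rule bij_prod_encode)
qed
end

lemma decode_prod: "decode n = (decode (fst (prod_decode n)), decode (snd (prod_decode n)))"
proof -
  have "code (decode (fst (prod_decode n)) :: 'a, decode (snd (prod_decode n)) :: 'b) = n"
    by (simp add: code_prod_def)
  then show ?thesis by (metis decode_code)
qed

instantiation list :: (letter) enc
begin
definition code_list :: "'a list \<Rightarrow> nat" where "code_list s = str_code (map is_one s)"
instance proof
  have "bij (map (is_one :: 'a \<Rightarrow> bool))"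
    by (rule bijI, rule list.inj_map, simp add: bij_is_inj bij_is_one)
       (metis bij_is_one bij_is_surj lists_UNIV lists_image)
  then show "bij (code :: 'a list \<Rightarrow> nat)"
    unfolding code_list_def using bij_comp[OF _ bij_str_code, of "map is_one"] by (simp add: o_def)
qed
end

lemma code_string [simp]: "code (s :: bool list) = str_code s"
  by (simp add: code_list_def is_one_bool_def[abs_def])

text \<open>
  Equality of functions is too fine for \<^const>\<open>partrec_in\<close>, because values on lists of a
  length other than the arity are arbitrary.
\<close>

definition total_rec :: "(nat \<Rightarrow> nat) set \<Rightarrow> nat \<Rightarrow> (nat list \<Rightarrow> nat) \<Rightarrow> bool" where
  "total_rec F k f \<longleftrightarrow> (\<exists>g. partrec_in F k g \<and> (\<forall>xs. length xs = k \<longrightarrow> g xs = Some (f xs)))"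

lemma total_rec_zero: "total_rec F k (\<lambda>xs. 0)"
  unfolding total_rec_def using partrec_in.zero by blast

lemma total_rec_suc0: "total_rec F 1 (\<lambda>xs. Suc (xs ! 0))"
  unfolding total_rec_def using partrec_in.succ by blast

lemma total_rec_proj: "i < k \<Longrightarrow> total_rec F k (\<lambda>xs. xs ! i)"
  unfolding total_rec_def using partrec_in.proj by blast

lemma total_rec_cong: "total_rec F k f \<Longrightarrow> (\<And>xs. length xs = k \<Longrightarrow> f xs = f' xs) \<Longrightarrow> total_rec F k f'"
  unfolding total_rec_def by fastforce

lemma partrec_comp_total_rec:
  assumes h: "partrec_in F (length gs) h" and gs: "\<forall>g\<in>set gs. total_rec F k g"
  shows "\<exists>u. partrec_in F k u \<and> (\<forall>xs. length xs = k \<longrightarrow> u xs = h (map (\<lambda>g. g xs) gs))"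
proof -
  from gs have "\<forall>g\<in>set gs. \<exists>u. partrec_in F k u \<and> (\<forall>xs. length xs = k \<longrightarrow> u xs = Some (g xs))"
    by (simp add: total_rec_def)
  then obtain U where U: "\<And>g. g \<in> set gs \<Longrightarrow> partrec_in F k (U g)"
    "\<And>g xs. g \<in> set gs \<Longrightarrow> length xs = k \<Longrightarrow> U g xs = Some (g xs)" by metis
  have "partrec_in F k (\<lambda>xs. if \<exists>g\<in>set (map U gs). g xs = None then None
                         else h (map (\<lambda>g. the (g xs)) (map U gs)))"
    by (rule partrec_in.comp) (use h U in auto)
  moreover have "map (\<lambda>g. the (g xs)) (map U gs) = map (\<lambda>g. g xs) gs" if "length xs = k" for xs
    using U that by simp
  ultimately show ?thesis
    by (intro exI[of _ "\<lambda>xs. if \<exists>g\<in>set (map U gs). g xs = None then None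
                         else h (map (\<lambda>g. the (g xs)) (map U gs))"]) (auto simp: U intro!: arg_cong[of _ _ h])
qed

lemma total_rec_comp:
  assumes "total_rec F (length gs) h" "\<forall>g\<in>set gs. total_rec F k g"
  shows "total_rec F k (\<lambda>xs. h (map (\<lambda>g. g xs) gs))"
  using partrec_comp_total_rec[of F gs _ k] assms unfolding total_rec_def by (metis length_map)

lemma total_rec_comp1: "total_rec F 1 h \<Longrightarrow> total_rec F k f \<Longrightarrow> total_rec F k (\<lambda>xs. h [f xs])"
  using total_rec_comp[of F "[f]" h k] by simp

lemma total_rec_comp2: "total_rec F 2 h \<Longrightarrow> total_rec F k f \<Longrightarrow> total_rec F k g \<Longrightarrow> total_rec F k (\<lambda>xs. h [f xs, g xs])"
  using total_rec_comp[of F "[f, g]" h k] by (simp add: numeral_2_eq_2)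

lemma total_rec_rec:
  assumes f: "total_rec F k f" and g: "total_rec F (k + 2) g"
  shows "total_rec F (Suc k) (\<lambda>xs. rec_nat (f (tl xs)) (\<lambda>n r. g (n # r # tl xs)) (hd xs))"
proof -
  obtain f' where f': "partrec_in F k f'" "\<And>xs. length xs = k \<Longrightarrow> f' xs = Some (f xs)"
    using f by (auto simp: total_rec_def)
  obtain g' where g': "partrec_in F (k+2) g'" "\<And>xs. length xs = k+2 \<Longrightarrow> g' xs = Some (g xs)"
    using g by (auto simp: total_rec_def)
  have "rec_nat (f' (tl xs)) (\<lambda>n r. Option.bind r (\<lambda>y. g' (n # y # tl xs))) m
      = Some (rec_nat (f (tl xs)) (\<lambda>n r. g (n # r # tl xs)) m)" if "length xs = Suc k" for xs m
    using that by (induction m) (auto simp: f' g')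
  then show ?thesis
    unfolding total_rec_def using partrec_in.prim_rec[OF f'(1) g'(1)] by blast
qed

lemma total_rec_Suc: "total_rec F k f \<Longrightarrow> total_rec F k (\<lambda>xs. Suc (f xs))"
  using total_rec_comp1[OF total_rec_suc0] by simp

lemma total_rec_const: "total_rec F k (\<lambda>xs. c)"
  by (induction c) (auto intro: total_rec_zero total_rec_Suc)

text \<open>
  Primitive recursion with the recursion argument computed from the parameters, which is the form
  in which it is applied to concrete functions.
\<close>

lemma total_rec_recursion:
  assumes "total_rec F k f" "total_rec F (k + 2) (\<lambda>ys. g (ys ! 0) (ys ! 1) (drop 2 ys))" "total_rec F k b"
  shows "total_rec F k (\<lambda>xs. rec_nat (f xs) (\<lambda>n r. g n r xs) (b xs))"
proof -
  have 1: "total_rec F (Suc k) (\<lambda>xs. rec_nat (f (tl xs)) (\<lambda>n r. g n r (tl xs)) (hd xs))"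
    using total_rec_rec[OF assms(1,2)] by (simp add: numeral_2_eq_2)
  define gs where "gs = b # map (\<lambda>i xs. xs ! i) [0..<k]"
  have len: "length gs = Suc k" by (simp add: gs_def)
  have "\<forall>g\<in>set gs. total_rec F k g" using assms(3) by (auto simp: gs_def intro: total_rec_proj)
  from total_rec_comp[OF _ this, unfolded len, OF 1]
  show ?thesis
  proof (rule total_rec_cong)
    fix xs :: "nat list" assume "length xs = k"
    then have "map (\<lambda>g. g xs) gs = b xs # xs"
      by (auto simp: gs_def o_def intro: nth_equalityI)
    then show "rec_nat (f (tl (map (\<lambda>g. g xs) gs))) (\<lambda>n r. g n r (tl (map (\<lambda>g. g xs) gs))) (hd (map (\<lambda>g. g xs) gs)) =
         rec_nat (f xs) (\<lambda>n r. g n r xs) (b xs)" by simp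
  qed
qed

lemma total_rec_add: assumes "total_rec F k f" "total_rec F k g" shows "total_rec F k (\<lambda>xs. f xs + g xs)"
proof -
  have "total_rec F 2 (\<lambda>xs. rec_nat (xs ! 0) (\<lambda>n r. Suc r) (xs ! 1))"
    by (rule total_rec_recursion) (auto intro!: total_rec_proj total_rec_Suc)
  moreover have "rec_nat a (\<lambda>n r. Suc r) b = a + b" for a b by (induction b) auto
  ultimately have "total_rec F 2 (\<lambda>xs. xs ! 0 + xs ! 1)" by simp
  from total_rec_comp2[OF this assms] show ?thesis by simp
qed

lemma total_rec_pred: assumes "total_rec F k f" shows "total_rec F k (\<lambda>xs. f xs - 1)"
proof -
  have "total_rec F 1 (\<lambda>xs. rec_nat 0 (\<lambda>n r. n) (xs ! 0))"
    by (rule total_rec_recursion) (auto intro!: total_rec_proj total_rec_zero)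
  moreover have "rec_nat 0 (\<lambda>n r. n) b = b - 1" for b by (induction b) auto
  ultimately have "total_rec F 1 (\<lambda>xs. xs ! 0 - 1)" by simp
  from total_rec_comp1[OF this assms] show ?thesis by simp
qed

lemma total_rec_diff: assumes "total_rec F k f" "total_rec F k g" shows "total_rec F k (\<lambda>xs. f xs - g xs)"
proof -
  have "total_rec F 2 (\<lambda>xs. rec_nat (xs ! 0) (\<lambda>n r. r - 1) (xs ! 1))"
    by (rule total_rec_recursion) (auto intro!: total_rec_proj total_rec_pred[simplified])
  moreover have "rec_nat a (\<lambda>n r. r - 1) b = a - b" for a b by (induction b) auto
  ultimately have "total_rec F 2 (\<lambda>xs. xs ! 0 - xs ! 1)" by simp
  from total_rec_comp2[OF this assms] show ?thesis by simp
qed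

lemma total_rec_triangle: assumes "total_rec F k f" shows "total_rec F k (\<lambda>xs. triangle (f xs))"
proof -
  have "total_rec F 1 (\<lambda>xs. rec_nat 0 (\<lambda>n r. r + Suc n) (xs ! 0))"
    by (rule total_rec_recursion) (auto intro!: total_rec_proj total_rec_zero total_rec_Suc total_rec_add)
  moreover have "rec_nat 0 (\<lambda>n r. r + Suc n) b = triangle b" for b by (induction b) auto
  ultimately have "total_rec F 1 (\<lambda>xs. triangle (xs ! 0))" by simp
  from total_rec_comp1[OF this assms] show ?thesis by simp
qed

lemma total_rec_prod_encode: "total_rec F k f \<Longrightarrow> total_rec F k g \<Longrightarrow> total_rec F k (\<lambda>xs. prod_encode (f xs, g xs))"
  unfolding prod_encode_def by (auto intro!: total_rec_add total_rec_triangle)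

lemma partrec_mu_total_rec:
  assumes "total_rec F (Suc k) f"
  shows "\<exists>u. partrec_in F k u \<and> (\<forall>xs. length xs = k \<longrightarrow>
     u xs = (if \<exists>n. f (n # xs) = 0 then Some (LEAST n. f (n # xs) = 0) else None))"
proof -
  obtain f' where f': "partrec_in F (Suc k) f'" "\<And>xs. length xs = Suc k \<Longrightarrow> f' xs = Some (f xs)"
    using assms by (auto simp: total_rec_def)
  show ?thesis
    by (intro exI[of _ "\<lambda>xs. mu_search (\<lambda>n. f' (n # xs))"] conjI partrec_in.mu f'(1))
       (auto simp: mu_search_def f' simp del: neq0_conv)
qed

lemma total_rec_mu:
  assumes "total_rec F (Suc k) f" "\<And>xs. length xs = k \<Longrightarrow> \<exists>n. f (n # xs) = 0"
  shows "total_rec F k (\<lambda>xs. LEAST n. f (n # xs) = 0)"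
  using partrec_mu_total_rec[OF assms(1)] assms(2) unfolding total_rec_def by auto

text \<open>
  Unpairing by search: the pairs with sum \<open>s\<close> are the codes from \<open>triangle s\<close> to below
  \<open>triangle (Suc s)\<close>.
\<close>

lemma prod_decode_eq:
  assumes "s = (LEAST s. n < triangle (Suc s))"
  shows "prod_decode n = (n - triangle s, s - (n - triangle s))"
proof -
  obtain a b where n: "n = prod_encode (a, b)" by (metis prod_decode_inverse surj_pair)
  have "s = a + b" unfolding assms
  proof (rule Least_equality)
    show "n < triangle (Suc (a + b))" by (simp add: n prod_encode_def)
    fix y assume "n < triangle (Suc y)"
    then have "triangle (a + b) < triangle (Suc y)" by (simp add: n prod_encode_def)
    moreover have "mono triangle" by (rule mono_iff_le_Suc[THEN iffD2]) simp
    ultimately have "\<not> Suc y \<le> a + b" by (meson leD monoD)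
    then show "a + b \<le> y" by simp
  qed
  then show ?thesis by (simp add: n) (simp add: prod_encode_def)
qed

lemma total_rec_tri_root: "total_rec F 1 (\<lambda>xs. LEAST s. xs ! 0 < triangle (Suc s))"
proof -
  have 1: "total_rec F (Suc 1) (\<lambda>ys. Suc (ys ! 1) - triangle (Suc (ys ! 0)))"
    by (intro total_rec_diff total_rec_Suc total_rec_triangle total_rec_proj) auto
  have "n < triangle (Suc n)" for n by simp
  then have 2: "\<exists>s. Suc ((s # xs) ! 1) - triangle (Suc ((s # xs) ! 0)) = 0" for xs
    by (intro exI[of _ "xs ! 0"]) (simp del: triangle_Suc add: Suc_leI)
  from total_rec_mu[OF 1 2] show ?thesis
    by (simp del: triangle_Suc add: Suc_le_eq)
qed

lemma total_rec_decode:
  assumes "total_rec F k f"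
  shows total_rec_fst: "total_rec F k (\<lambda>xs. fst (prod_decode (f xs)))"
    and total_rec_snd: "total_rec F k (\<lambda>xs. snd (prod_decode (f xs)))"
proof -
  have p: "total_rec F 1 (\<lambda>xs. xs ! 0)" by (rule total_rec_proj) simp
  have a: "total_rec F 1 (\<lambda>xs. fst (prod_decode (xs ! 0)))"
    unfolding prod_decode_eq[OF refl] fst_conv by (intro total_rec_diff p total_rec_triangle total_rec_tri_root)
  have b: "total_rec F 1 (\<lambda>xs. snd (prod_decode (xs ! 0)))"
    unfolding prod_decode_eq[OF refl] snd_conv by (intro total_rec_diff p total_rec_triangle total_rec_tri_root)
  show "total_rec F k (\<lambda>xs. fst (prod_decode (f xs)))" "total_rec F k (\<lambda>xs. snd (prod_decode (f xs)))"
    using total_rec_comp1[OF a assms] total_rec_comp1[OF b assms] by simp_all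
qed

text \<open>
  For functions of one variable between coded types; several variables are paired. In the closure
  rules below, variables are projections of a single argument \<open>x\<close>, and binding a further variable
  \<open>i\<close> turns \<open>x\<close> into \<open>(x, i)\<close>. This makes the rules higher-order patterns, so that \<open>intro\<close>
  decomposes a term along its syntax.
\<close>

definition computable :: "(nat \<Rightarrow> nat) set \<Rightarrow> ('a::enc \<Rightarrow> 'b::enc) \<Rightarrow> bool" where
  "computable F f \<longleftrightarrow> total_rec F 1 (\<lambda>xs. code (f (decode (xs ! 0))))"

definition decidable :: "(nat \<Rightarrow> nat) set \<Rightarrow> ('a::enc \<Rightarrow> bool) \<Rightarrow> bool" where
  "decidable F P \<longleftrightarrow> computable F (\<lambda>x. of_bool (P x) :: nat)"

definition pcomputable :: "(nat \<Rightarrow> nat) set \<Rightarrow> ('a::enc \<Rightarrow> 'b::enc option) \<Rightarrow> bool" where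
  "pcomputable F f \<longleftrightarrow> (\<exists>g. partrec_in F 1 g \<and> (\<forall>x. g [code x] = map_option code (f x)))"

named_theorems computable_intros

lemma computable_id [computable_intros]: "computable F (\<lambda>x. x)"
  unfolding computable_def by (auto intro: total_rec_cong[OF total_rec_proj])

lemma computable_comp: assumes "computable F h" "computable F f" shows "computable F (\<lambda>x. h (f x))"
  using total_rec_comp1[OF assms[unfolded computable_def]] unfolding computable_def by simp

lemma computable_code [computable_intros]: "computable F f \<Longrightarrow> computable F (\<lambda>x. code (f x))"
  unfolding computable_def by simp

lemma computable_decode [computable_intros]: "computable F f \<Longrightarrow> computable F (\<lambda>x. decode (f x))"
  unfolding computable_def by simp

lemma computable_const [computable_intros]: "computable F (\<lambda>x. c)"
  unfolding computable_def by (rule total_rec_const)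

lemma computable_Pair [computable_intros]: "computable F f \<Longrightarrow> computable F g \<Longrightarrow> computable F (\<lambda>x. (f x, g x))"
  unfolding computable_def code_prod_def fst_conv snd_conv by (rule total_rec_prod_encode)

lemma computable_fst [computable_intros]: "computable F f \<Longrightarrow> computable F (\<lambda>x. fst (f x))"
  unfolding computable_def code_prod_def using total_rec_fst by force

lemma computable_snd [computable_intros]: "computable F f \<Longrightarrow> computable F (\<lambda>x. snd (f x))"
  unfolding computable_def code_prod_def using total_rec_snd by force

lemma computable_Suc [computable_intros]: "computable F f \<Longrightarrow> computable F (\<lambda>x. Suc (f x))"
  unfolding computable_def by (simp add: total_rec_Suc)

lemma computable_add [computable_intros]: "computable F f \<Longrightarrow> computable F g \<Longrightarrow> computable F (\<lambda>x. f x + g x :: nat)"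
  unfolding computable_def by (simp add: total_rec_add)

lemma computable_diff [computable_intros]: "computable F f \<Longrightarrow> computable F g \<Longrightarrow> computable F (\<lambda>x. f x - g x :: nat)"
  unfolding computable_def by (simp add: total_rec_diff)

lemma computable_rec:
  fixes f :: "'a::enc \<Rightarrow> 'b::enc"
  assumes f: "computable F f" and g: "computable F (\<lambda>p. g (fst p) (fst (snd p)) (snd (snd p)))" and b: "computable F b"
  shows "computable F (\<lambda>x. rec_nat (f x) (\<lambda>n r. g n r x) (b x))"
proof -
  have 1: "total_rec F 3 (\<lambda>ys. code (g (ys!0) (decode (ys!1)) (decode (ys!2))))"
    using total_rec_comp1[OF g[unfolded computable_def] total_rec_prod_encode[OF total_rec_proj[of 0] total_rec_prod_encode[OF total_rec_proj[of 1] total_rec_proj[of 2]]], of 3]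
    by (simp add: decode_prod)
  have 2: "total_rec F 1 (\<lambda>xs. rec_nat (code (f (decode (xs ! 0)))) (\<lambda>n r. code (g n (decode r) (decode (xs ! 0)))) (b (decode (xs ! 0))))"
    by (rule total_rec_recursion)
       (use f b 1 in \<open>auto simp: computable_def numeral_3_eq_3 intro!: total_rec_cong[OF 1[unfolded numeral_3_eq_3]]\<close>)
  have "rec_nat (code (f x)) (\<lambda>n r. code (g n (decode r) x)) m = code (rec_nat (f x) (\<lambda>n r. g n r x) m)" for x m
    by (induction m) auto
  with 2 show ?thesis unfolding computable_def by simp
qed

lemma computable_compose2:
  assumes "computable F (\<lambda>p. h (fst p) (snd p))" "computable F f" "computable F g" shows "computable F (\<lambda>x. h (f x) (g x))"
  using computable_comp[OF assms(1) computable_Pair[OF assms(2,3)]] by simp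

lemma computable_mult [computable_intros]:
  assumes "computable F f" "computable F g" shows "computable F (\<lambda>x. f x * g x :: nat)"
proof -
  have "rec_nat 0 (\<lambda>n r. r + a) b = a * b" for a b :: nat by (induction b) auto
  moreover have "computable F (\<lambda>x. rec_nat (0::nat) (\<lambda>n r. r + f x) (g x))"
    by (rule computable_rec) (intro computable_intros assms computable_comp[OF assms(1)])+
  ultimately show ?thesis by simp
qed

lemma computable_power [computable_intros]:
  assumes "computable F f" "computable F g" shows "computable F (\<lambda>x. f x ^ g x :: nat)"
proof -
  have "rec_nat 1 (\<lambda>n r. r * a) b = a ^ b" for a b :: nat by (induction b) auto
  moreover have "computable F (\<lambda>x. rec_nat (1::nat) (\<lambda>n r. r * f x) (g x))"
    by (rule computable_rec) (intro computable_intros assms computable_comp[OF assms(1)])+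
  ultimately show ?thesis by simp
qed

lemma computable_sum [computable_intros]:
  fixes f :: "'a::enc \<Rightarrow> nat \<Rightarrow> nat"
  assumes "computable F (\<lambda>p. f (fst p) (snd p))" "computable F b"
  shows "computable F (\<lambda>x. \<Sum>i<b x. f x i)"
proof -
  have "rec_nat 0 (\<lambda>n r. r + h n) b = (\<Sum>i<b. h i)" for h :: "nat \<Rightarrow> nat" and b by (induction b) auto
  moreover have "computable F (\<lambda>x. rec_nat (0::nat) (\<lambda>n r. r + f x n) (b x))"
    by (rule computable_rec) (intro computable_intros assms(2) computable_compose2[OF assms(1)])+
  ultimately show ?thesis by simp
qed

lemma of_bool_decidable [computable_intros]: "decidable F P \<Longrightarrow> computable F (\<lambda>x. of_bool (P x) :: nat)"
  by (simp add: decidable_def)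

lemma decidable_comp: "decidable F P \<Longrightarrow> computable F f \<Longrightarrow> decidable F (\<lambda>x. P (f x))"
  unfolding decidable_def by (rule computable_comp)

lemma decidable_not [computable_intros]: assumes "decidable F P" shows "decidable F (\<lambda>x. \<not> P x)"
proof -
  have "computable F (\<lambda>x. 1 - (of_bool (P x) :: nat))" by (intro computable_intros assms)
  moreover have "1 - of_bool (P x) = (of_bool (\<not> P x) :: nat)" for x by simp
  ultimately show ?thesis unfolding decidable_def by (simp only:)
qed

lemma decidable_conj [computable_intros]: assumes "decidable F P" "decidable F Q" shows "decidable F (\<lambda>x. P x \<and> Q x)"
proof -
  have "computable F (\<lambda>x. of_bool (P x) * of_bool (Q x) :: nat)" by (intro computable_intros assms)
  then show ?thesis unfolding decidable_def by (simp add: of_bool_conj)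
qed

lemma decidable_disj [computable_intros]: assumes "decidable F P" "decidable F Q" shows "decidable F (\<lambda>x. P x \<or> Q x)"
proof -
  have "decidable F (\<lambda>x. \<not> (\<not> P x \<and> \<not> Q x))" by (intro computable_intros assms)
  then show ?thesis by simp
qed

lemma decidable_imp [computable_intros]: assumes "decidable F P" "decidable F Q" shows "decidable F (\<lambda>x. P x \<longrightarrow> Q x)"
proof -
  have "decidable F (\<lambda>x. \<not> P x \<or> Q x)" by (intro computable_intros assms)
  then show ?thesis by simp
qed

lemma decidable_const [computable_intros]: "decidable F (\<lambda>x. c)"
  unfolding decidable_def by (rule computable_const)

lemma decidable_less [computable_intros]:
  assumes "computable F f" "computable F g" shows "decidable F (\<lambda>x. f x < (g x :: nat))"
proof -
  have "computable F (\<lambda>x. 1 - (1 - (g x - f x)))" by (intro computable_intros assms)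
  moreover have "1 - (1 - (g x - f x)) = of_bool (f x < g x)" for x by auto
  ultimately show ?thesis unfolding decidable_def by simp
qed

lemma decidable_le [computable_intros]:
  assumes "computable F f" "computable F g" shows "decidable F (\<lambda>x. f x \<le> (g x :: nat))"
proof -
  have "decidable F (\<lambda>x. \<not> g x < f x)" by (intro computable_intros assms)
  then show ?thesis by (simp add: not_less)
qed

lemma decidable_eq [computable_intros]:
  assumes "computable F f" "computable F g" shows "decidable F (\<lambda>x. f x = g x)"
proof -
  have "decidable F (\<lambda>x. code (f x) \<le> code (g x) \<and> code (g x) \<le> code (f x))" by (intro computable_intros assms)
  moreover have "(code (f x) \<le> code (g x) \<and> code (g x) \<le> code (f x)) = (f x = g x)" for x
    using code_eq_iff by (metis order_antisym order_refl)
  ultimately show ?thesis by simp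
qed

lemma computable_if [computable_intros]:
  fixes f :: "'a::enc \<Rightarrow> 'b::enc"
  assumes "decidable F P" "computable F f" "computable F g" shows "computable F (\<lambda>x. if P x then f x else g x)"
proof -
  have "computable F (\<lambda>x. decode (of_bool (P x) * code (f x) + of_bool (\<not> P x) * code (g x)) :: 'b)"
    by (intro computable_intros assms)
  moreover have "decode (of_bool (P x) * code (f x) + of_bool (\<not> P x) * code (g x))
      = (if P x then f x else g x)" for x by simp
  ultimately show ?thesis by (simp only:)
qed

lemma decidable_bex [computable_intros]:
  fixes P :: "'a::enc \<Rightarrow> nat \<Rightarrow> bool"
  assumes "decidable F (\<lambda>p. P (fst p) (snd p))" "computable F b"
  shows "decidable F (\<lambda>x. \<exists>i<b x. P x i)"
proof -
  have "decidable F (\<lambda>x. 0 < (\<Sum>i<b x. of_bool (P x i) :: nat))" by (intro computable_intros assms)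
  moreover have "0 < (\<Sum>i<b x. of_bool (P x i) :: nat) \<longleftrightarrow> (\<exists>i<b x. P x i)" for x
    by (auto simp: zero_less_iff_neq_zero)
  ultimately show ?thesis by simp
qed

lemma decidable_ball [computable_intros]:
  fixes P :: "'a::enc \<Rightarrow> nat \<Rightarrow> bool"
  assumes "decidable F (\<lambda>p. P (fst p) (snd p))" "computable F b"
  shows "decidable F (\<lambda>x. \<forall>i<b x. P x i)"
proof -
  have "decidable F (\<lambda>x. \<not> (\<exists>i<b x. \<not> P x i))" by (intro computable_intros assms)
  then show ?thesis by simp
qed

lemma computable_Least:
  fixes P :: "'a::enc \<Rightarrow> nat \<Rightarrow> bool"
  assumes "decidable F (\<lambda>p. P (fst p) (snd p))" "\<And>x. \<exists>n. P x n"
  shows "computable F (\<lambda>x. LEAST n. P x n)"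
proof -
  have "total_rec F 2 (\<lambda>ys. 1 - of_bool (P (decode (ys!1)) (ys!0)))"
    using total_rec_comp1[OF assms(1)[unfolded decidable_def computable_def] total_rec_prod_encode[OF total_rec_proj[of 1] total_rec_proj[of 0]], of 2]
    by (intro total_rec_diff total_rec_const) (simp add: decode_prod)
  then have "total_rec F (Suc 1) (\<lambda>ys. 1 - of_bool (P (decode (ys!1)) (ys!0)))" by (simp add: numeral_2_eq_2)
  moreover have "1 - of_bool b = (0::nat) \<longleftrightarrow> b" for b by simp
  ultimately have "total_rec F 1 (\<lambda>xs. LEAST n. P (decode (xs!0)) n)"
    using total_rec_mu[of F 1 "\<lambda>ys. 1 - of_bool (P (decode (ys!1)) (ys!0))"] assms(2) by simp
  then show ?thesis by (simp add: computable_def)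
qed

text \<open>
  All partial functions constructed below arise by such a search.
\<close>

lemma pcomputable_search:
  fixes P :: "'a::enc \<Rightarrow> nat \<Rightarrow> bool"
  assumes P: "decidable F (\<lambda>p. P (fst p) (snd p))" and o: "computable F (\<lambda>p. h (fst p) (snd p))"
  shows "pcomputable F (\<lambda>x. if \<exists>n. P x n then Some (h x (LEAST n. P x n)) else None)"
proof -
  have 1: "total_rec F (Suc 1) (\<lambda>ys. 1 - of_bool (P (decode (ys!1)) (ys!0)))"
    using total_rec_comp1[OF P[unfolded decidable_def computable_def] total_rec_prod_encode[OF total_rec_proj[of 1] total_rec_proj[of 0]], of 2]
    by (intro total_rec_diff total_rec_const) (simp add: decode_prod numeral_2_eq_2)
  have b: "1 - of_bool b = (0::nat) \<longleftrightarrow> b" for b by simp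
  obtain u where u: "partrec_in F 1 u" "\<And>n. u [n] = (if \<exists>m. P (decode n) m then Some (LEAST m. P (decode n) m) else None)"
    using partrec_mu_total_rec[OF 1] by (auto simp: b)
  have "total_rec F 2 (\<lambda>ys. code (h (decode (ys!0)) (ys!1)))"
    using total_rec_comp1[OF o[unfolded computable_def] total_rec_prod_encode[OF total_rec_proj[of 0] total_rec_proj[of 1]], of 2]
    by (simp add: decode_prod)
  then obtain v where v: "partrec_in F 2 v" "\<And>a b. v [a, b] = Some (code (h (decode a) b))"
    by (auto simp: total_rec_def)
  define w where "w xs = (if \<exists>g\<in>set [\<lambda>xs. Some (xs ! 0), u]. g xs = None then None
                         else v (map (\<lambda>g. the (g xs)) [\<lambda>xs. Some (xs ! 0), u]))" for xs
  have "partrec_in F 1 w" unfolding w_def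
    by (rule partrec_in.comp) (use u v partrec_in.proj[of 0 1 F] in \<open>auto simp: numeral_2_eq_2\<close>)
  moreover have "w [code x] = map_option code (if \<exists>n. P x n then Some (h x (LEAST n. P x n)) else None)" for x
    by (simp add: w_def u v)
  ultimately show ?thesis unfolding pcomputable_def by blast
qed


lemma computable_div [computable_intros]:
  assumes "computable F f" "computable F g" shows "computable F (\<lambda>x. f x div g x :: nat)"
proof -
  have "computable F (\<lambda>x. LEAST q. g x = 0 \<or> f x < Suc q * g x)"
  proof (rule computable_Least)
    show "decidable F (\<lambda>p. g (fst p) = 0 \<or> f (fst p) < Suc (snd p) * g (fst p))"
      by (intro computable_intros computable_comp[OF assms(1)] computable_comp[OF assms(2)])
    show "\<exists>q. g x = 0 \<or> f x < Suc q * g x" for x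
      by (rule exI[of _ "f x"]) (cases "g x", auto)
  qed
  moreover have "(LEAST q. b = 0 \<or> a < Suc q * b) = a div b" for a b :: nat
  proof (cases "b = 0")
    case False
    then have "b = 0 \<or> a < Suc q * b \<longleftrightarrow> a div b \<le> q" for q
      by (simp add: less_Suc_eq_le[symmetric] div_less_iff_less_mult del: mult_Suc)
    then show ?thesis by (simp add: Least_equality)
  qed auto
  ultimately show ?thesis by simp
qed

lemma computable_mod [computable_intros]:
  assumes "computable F f" "computable F g" shows "computable F (\<lambda>x. f x mod g x :: nat)"
proof -
  have "computable F (\<lambda>x. f x - f x div g x * g x)" by (intro computable_intros assms)
  then show ?thesis by (simp add: minus_div_mult_eq_mod)
qed

lemma decidable_odd [computable_intros]: assumes "computable F f" shows "decidable F (\<lambda>x. odd (f x :: nat))"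
proof -
  have "decidable F (\<lambda>x. f x mod 2 = 1)" by (intro computable_intros assms)
  then show ?thesis by (simp add: odd_iff_mod_2_eq_one)
qed

section \<open>Stagewise approximation of partial computable functions\<close>

text \<open>
  Argument lists of any length become a single argument, so that the closure rules for coded types
  apply to functions of all arities.
\<close>

fun list_code :: "nat list \<Rightarrow> nat" where
  "list_code [] = 0"
| "list_code (x # xs) = code (x, list_code xs)"

text \<open>
  The value \<open>0\<close> says that the computation has not halted by stage \<open>s\<close>, and \<open>Suc y\<close> that it has
  halted with result \<open>y\<close>.
\<close>

definition approximates :: "(nat \<times> nat \<Rightarrow> nat) \<Rightarrow> nat \<Rightarrow> (nat list \<Rightarrow> nat option) \<Rightarrow> bool" where
  "approximates T k g \<longleftrightarrow>
     (\<forall>s s' c y. s \<le> s' \<longrightarrow> T (s, c) = Suc y \<longrightarrow> T (s', c) = Suc y) \<and>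
     (\<forall>xs y. length xs = k \<longrightarrow> (g xs = Some y \<longleftrightarrow> (\<exists>s. T (s, list_code xs) = Suc y)))"

lemma approximatesD:
  assumes "approximates T k g"
  shows "s \<le> s' \<Longrightarrow> T (s, c) = Suc y \<Longrightarrow> T (s', c) = Suc y"
    and "length xs = k \<Longrightarrow> g xs = Some y \<longleftrightarrow> (\<exists>s. T (s, list_code xs) = Suc y)"
    and "length xs = k \<Longrightarrow> g xs = None \<longleftrightarrow> (\<forall>s. T (s, list_code xs) = 0)"
proof -
  show "s \<le> s' \<Longrightarrow> T (s, c) = Suc y \<Longrightarrow> T (s', c) = Suc y"
    "length xs = k \<Longrightarrow> g xs = Some y \<longleftrightarrow> (\<exists>s. T (s, list_code xs) = Suc y)"
    using assms unfolding approximates_def by blast+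
  assume "length xs = k"
  then have "\<And>y. g xs = Some y \<longleftrightarrow> (\<exists>s. T (s, list_code xs) = Suc y)"
    using assms unfolding approximates_def by blast
  then show "g xs = None \<longleftrightarrow> (\<forall>s. T (s, list_code xs) = 0)"
    by (metis not0_implies_Suc option.exhaust option.distinct(1) nat.distinct(1))
qed

lemma approximates_total:
  assumes "computable F h" "\<And>xs. length xs = k \<Longrightarrow> g xs = Some (h (list_code xs))"
  shows "\<exists>T. computable F T \<and> approximates T k g"
proof (intro exI conjI)
  show "computable F (\<lambda>p::nat\<times>nat. Suc (h (snd p)))" by (intro computable_intros computable_comp[OF assms(1)])
  show "approximates (\<lambda>p. Suc (h (snd p))) k g"
    using assms(2) by (auto simp: approximates_def)
qed

lemma computable_list_code_nth: "\<exists>h. computable F h \<and> (\<forall>xs. i < length xs \<longrightarrow> h (list_code xs) = xs ! i)"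
proof (induction i)
  case 0
  have "computable F (\<lambda>c. fst (decode c :: nat \<times> nat))" by (intro computable_intros)
  moreover have "fst (decode (list_code xs) :: nat \<times> nat) = xs ! 0" if "0 < length xs" for xs
    using that by (cases xs) (auto simp del: code_nat_def)
  ultimately show ?case by blast
next
  case (Suc i)
  then obtain h where h: "computable F h" "\<And>xs. i < length xs \<Longrightarrow> h (list_code xs) = xs ! i" by blast
  have "computable F (\<lambda>c. h (snd (decode c :: nat \<times> nat)))" by (intro computable_intros computable_comp[OF h(1)])
  moreover have "h (snd (decode (list_code xs) :: nat \<times> nat)) = xs ! Suc i" if "Suc i < length xs" for xs
    using that h(2) by (cases xs) auto
  ultimately show ?case by blast
qed

text \<open>
  The arguments that a composition passes to the outer function: \<open>V\<close> says that all of them have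
  been found by stage \<open>s\<close>, and then \<open>R\<close> is the code of their list.
\<close>

definition tuple_approximates ::
    "(nat \<times> nat \<Rightarrow> bool) \<Rightarrow> (nat \<times> nat \<Rightarrow> nat) \<Rightarrow> nat \<Rightarrow> (nat list \<Rightarrow> nat option) list \<Rightarrow> bool" where
  "tuple_approximates V R k gs \<longleftrightarrow>
    (\<forall>s s' c. s \<le> s' \<longrightarrow> V (s, c) \<longrightarrow> V (s', c) \<and> R (s', c) = R (s, c)) \<and>
    (\<forall>xs. length xs = k \<longrightarrow>
       ((\<forall>g\<in>set gs. g xs \<noteq> None) \<longleftrightarrow> (\<exists>s. V (s, list_code xs))) \<and>
       (\<forall>s. V (s, list_code xs) \<longrightarrow> R (s, list_code xs) = list_code (map (\<lambda>g. the (g xs)) gs)))"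

lemma tuple_approximatesD:
  assumes "tuple_approximates V R k gs"
  shows "s \<le> s' \<Longrightarrow> V (s, c) \<Longrightarrow> V (s', c) \<and> R (s', c) = R (s, c)"
    and "length xs = k \<Longrightarrow> (\<forall>g\<in>set gs. g xs \<noteq> None) \<longleftrightarrow> (\<exists>s. V (s, list_code xs))"
    and "length xs = k \<Longrightarrow> V (s, list_code xs) \<Longrightarrow> R (s, list_code xs) = list_code (map (\<lambda>g. the (g xs)) gs)"
  using assms unfolding tuple_approximates_def by blast+

lemma ex_tuple_approximation:
  assumes "\<forall>g\<in>set gs. \<exists>T. computable F T \<and> approximates T k g"
  shows "\<exists>V R. decidable F V \<and> computable F R \<and> tuple_approximates V R k gs"
  using assms
proof (induction gs)
  case Nil
  show ?case
    by (rule exI[of _ "\<lambda>_. True"], rule exI[of _ "\<lambda>_. 0"]) (auto intro: computable_intros simp: tuple_approximates_def)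
next
  case (Cons g gs)
  then obtain V R where V: "decidable F V" and R: "computable F R" and VR: "tuple_approximates V R k gs"
    by auto
  note mono = tuple_approximatesD(1)[OF VR] and ex = tuple_approximatesD(2)[OF VR]
    and eq = tuple_approximatesD(3)[OF VR]
  obtain T where T: "computable F T" "approximates T k g" using Cons.prems by auto
  note TD = approximatesD[OF T(2)]
  define V' where "V' p \<longleftrightarrow> V p \<and> 0 < T p" for p
  define R' where "R' p = code (T p - 1, R p)" for p
  have decidable: "decidable F V'" unfolding V'_def by (intro computable_intros V T)
  have computable: "computable F R'" unfolding R'_def by (intro computable_intros R T)
  have mono': "V' (s', c) \<and> R' (s', c) = R' (s, c)" if "s \<le> s'" "V' (s, c)" for s s' c
  proof -
    from that(2) obtain y where "T (s, c) = Suc y" by (auto simp: V'_def gr0_conv_Suc)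
    then show ?thesis using that mono[OF that(1), of c] TD(1)[OF that(1), of c y]
      by (auto simp: V'_def R'_def)
  qed
  have ex': "(\<forall>h\<in>set (g # gs). h xs \<noteq> None) \<longleftrightarrow> (\<exists>s. V' (s, list_code xs))" if len: "length xs = k" for xs
  proof
    assume *: "\<forall>h\<in>set (g # gs). h xs \<noteq> None"
    then have "\<forall>h\<in>set gs. h xs \<noteq> None" by simp
    then obtain s where s: "V (s, list_code xs)" using ex[OF len] by blast
    from * obtain y where "g xs = Some y" by auto
    then obtain s' where s': "T (s', list_code xs) = Suc y" using TD(2)[OF len] by blast
    have "V (max s s', list_code xs)" using mono[of s "max s s'"] s by simp
    moreover have "T (max s s', list_code xs) = Suc y" using TD(1)[of s' "max s s'"] s' by simp
    ultimately show "\<exists>s. V' (s, list_code xs)" unfolding V'_def by (intro exI[of _ "max s s'"]) simp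
  next
    assume "\<exists>s. V' (s, list_code xs)"
    then obtain s where s: "V (s, list_code xs)" "T (s, list_code xs) \<noteq> 0" by (auto simp: V'_def)
    have "\<forall>h\<in>set gs. h xs \<noteq> None" using s(1) ex[OF len] by blast
    moreover have "g xs \<noteq> None" using s(2) by (simp add: TD(3)[OF len]) blast
    ultimately show "\<forall>h\<in>set (g # gs). h xs \<noteq> None" by simp
  qed
  have eq': "R' (s, list_code xs) = list_code (map (\<lambda>g. the (g xs)) (g # gs))"
    if len: "length xs = k" and v': "V' (s, list_code xs)" for xs s
  proof -
    from v' obtain y where y: "T (s, list_code xs) = Suc y" and v: "V (s, list_code xs)"
      by (auto simp: V'_def gr0_conv_Suc)
    have "g xs = Some y" using TD(2)[OF len] y by blast
    then show ?thesis using eq[OF len v] y by (simp add: R'_def)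
  qed
  have "tuple_approximates V' R' k (g # gs)"
    unfolding tuple_approximates_def
  proof (intro conjI allI impI)
    show "V' (s', c)" "R' (s', c) = R' (s, c)" if "s \<le> s'" "V' (s, c)" for s s' c
      using mono'[OF that] by simp_all
    show "(\<forall>g\<in>set (g # gs). g xs \<noteq> None) \<longleftrightarrow> (\<exists>s. V' (s, list_code xs))" if "length xs = k" for xs
      by (rule ex'[OF that])
    show "R' (s, list_code xs) = list_code (map (\<lambda>g. the (g xs)) (g # gs))" if "length xs = k" "V' (s, list_code xs)" for xs s
      by (rule eq'[OF that])
  qed
  then show ?case using decidable computable by blast
qed

lemma mu_search_Some:
  "mu_search h = Some n \<longleftrightarrow> h n = Some 0 \<and> (\<forall>m<n. \<exists>v. h m = Some (Suc v))"
proof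
  assume l: "mu_search h = Some n"
  then have ex: "\<exists>n. h n = Some 0 \<and> (\<forall>m<n. h m \<noteq> None)" and n: "n = (LEAST n. h n = Some 0)"
    unfolding mu_search_def by (metis option.distinct(1), metis option.distinct(1) option.inject)
  then obtain n' where n': "h n' = Some 0" "\<forall>m<n'. h m \<noteq> None" by blast
  have 1: "h n = Some 0" unfolding n using n'(1) by (rule LeastI)
  have 2: "n \<le> n'" unfolding n using n'(1) by (rule Least_le)
  have "\<exists>v. h m = Some (Suc v)" if m: "m < n" for m
  proof -
    have "h m \<noteq> Some 0" using not_less_Least[OF m[unfolded n]] .
    moreover obtain v where "h m = Some v" using n'(2)[rule_format, of m] m 2 by auto
    ultimately show ?thesis by (cases v) auto
  qed
  with 1 show "h n = Some 0 \<and> (\<forall>m<n. \<exists>v. h m = Some (Suc v))" by blast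
next
  assume r: "h n = Some 0 \<and> (\<forall>m<n. \<exists>v. h m = Some (Suc v))"
  have "(LEAST n. h n = Some 0) = n"
  proof (rule Least_equality)
    show "h n = Some 0" using r by blast
    show "n \<le> m" if "h m = Some 0" for m
      using r that by (metis leI nat.distinct(1) option.inject)
  qed
  moreover have "\<exists>n. h n = Some 0 \<and> (\<forall>m<n. h m \<noteq> None)" using r by (intro exI[of _ n]) auto
  ultimately show "mu_search h = Some n" unfolding mu_search_def by presburger
qed

text \<open>
  A sum over a predicate with at most one solution serves as a bounded search that returns \<open>0\<close>
  when it fails.
\<close>

lemma sum_if_unique:
  assumes "\<And>m n. P m \<Longrightarrow> P n \<Longrightarrow> m = n"
  shows "(\<Sum>n<s. if P n then Suc n else 0) = Suc y \<longleftrightarrow> y < s \<and> P y"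
proof (cases "\<exists>n<s. P n")
  case True
  then obtain n where n: "n < s" "P n" by blast
  have "(\<Sum>m<s. if P m then Suc m else 0) = (\<Sum>m<s. if m = n then Suc n else 0)"
    using assms n by (intro sum.cong) auto
  also have "\<dots> = Suc n" using n by simp
  finally show ?thesis using n assms by auto
next
  case False
  then have "(\<Sum>m<s. if P m then Suc m else 0) = 0" by (intro sum.neutral) auto
  then show ?thesis using False by auto
qed

text \<open>
  By induction on the schemes. At stage \<open>s\<close> every subcomputation is given \<open>s\<close> steps, and a
  minimization looks only at candidates below \<open>s\<close>. Monotonicity in \<open>s\<close> allows the stages of finitely
  many subcomputations to be replaced by a common one.
\<close>

lemma partrec_approximation:
  assumes "partrec_in F k g" shows "\<exists>T. computable F T \<and> approximates T k g"
  using assms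
proof (induction rule: partrec_in.induct)
  case (zero k)
  show ?case by (rule approximates_total) (auto intro: computable_intros)
next
  case succ
  obtain h where h: "computable F h" "\<And>xs. 0 < length xs \<Longrightarrow> h (list_code xs) = xs ! 0" using computable_list_code_nth by blast
  show ?case by (rule approximates_total[OF computable_Suc[OF h(1)]]) (simp add: h(2))
next
  case (proj i k)
  obtain h where h: "computable F h" "\<And>xs. i < length xs \<Longrightarrow> h (list_code xs) = xs ! i" using computable_list_code_nth by blast
  show ?case by (rule approximates_total[OF h(1)]) (use proj in \<open>simp add: h(2)\<close>)
next
  case (initial q)
  obtain h where h: "computable F h" "\<And>xs. 0 < length xs \<Longrightarrow> h (list_code xs) = xs ! 0" using computable_list_code_nth by blast
  have "computable F q" unfolding computable_def total_rec_def using partrec_in.initial[OF initial] by auto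
  from computable_comp[OF this h(1)] show ?case by (rule approximates_total) (simp add: h(2))
next
  case (comp gs f k)
  then obtain V R where V: "decidable F V" and R: "computable F R" and VR: "tuple_approximates V R k gs"
    using ex_tuple_approximation[of gs F k] by auto
  note mono = tuple_approximatesD(1)[OF VR] and ex = tuple_approximatesD(2)[OF VR]
    and eq = tuple_approximatesD(3)[OF VR]
  obtain T where T: "computable F T" "approximates T (length gs) f" using comp by auto
  note TD = approximatesD[OF T(2)]
  define U where "U p = (if V p then T (fst p, R p) else 0)" for p
  have "computable F U" unfolding U_def by (intro computable_intros V R computable_comp[OF T(1)])
  moreover have "approximates U k (\<lambda>xs. if \<exists>g\<in>set gs. g xs = None then None
                         else f (map (\<lambda>g. the (g xs)) gs))"
    unfolding approximates_def
  proof (intro conjI allI impI)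
    fix s s' c y assume "s \<le> s'" "U (s, c) = Suc y"
    then show "U (s', c) = Suc y" using mono[of s s' c] TD(1)[of s s' "R (s, c)" y]
      by (auto simp: U_def split: if_splits)
  next
    fix xs :: "nat list" and y assume len: "length xs = k"
    let ?ys = "map (\<lambda>g. the (g xs)) gs"
    have *: "f ?ys = Some y \<longleftrightarrow> (\<exists>s. T (s, list_code ?ys) = Suc y)" by (rule TD(2)) simp
    show "(if \<exists>g\<in>set gs. g xs = None then None else f ?ys) = Some y \<longleftrightarrow> (\<exists>s. U (s, list_code xs) = Suc y)"
    proof (cases "\<exists>s. V (s, list_code xs)")
      case True
      then obtain s where s: "V (s, list_code xs)" ..
      then have c: "\<not> (\<exists>g\<in>set gs. g xs = None)" using ex[OF len] by auto
      show ?thesis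
      proof
        assume "(if \<exists>g\<in>set gs. g xs = None then None else f ?ys) = Some y"
        then obtain s' where "T (s', list_code ?ys) = Suc y" using * c by auto
        then have "T (max s s', list_code ?ys) = Suc y" using TD(1)[of s' "max s s'"] by auto
        moreover have "V (max s s', list_code xs)" using mono[of s "max s s'"] s by auto
        ultimately show "\<exists>s. U (s, list_code xs) = Suc y" using eq[OF len] by (auto simp: U_def)
      next
        assume "\<exists>s. U (s, list_code xs) = Suc y"
        then show "(if \<exists>g\<in>set gs. g xs = None then None else f ?ys) = Some y"
          using c * eq[OF len] by (auto simp: U_def split: if_splits)
      qed
    next
      case False
      then show ?thesis using ex[OF len] by (auto simp: U_def)
    qed
  qed
  ultimately show ?case by blast
next
  case (prim_rec k f g)
  then obtain S T where S: "computable F S" "approximates S k f" and T: "computable F T" "approximates T (k + 2) g"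
    by blast
  note SD = approximatesD[OF S(2)] and TD = approximatesD[OF T(2)]
  define W where "W s c n = rec_nat (S (s, c)) (\<lambda>n r. if r = 0 then 0 else T (s, code (n, code (r - 1, c)))) n"
    for s c n :: nat
  define U where "U p = W (fst p) (snd (decode (snd p) :: nat \<times> nat)) (fst (decode (snd p) :: nat \<times> nat))" for p :: "nat \<times> nat"
  have "computable F U" unfolding U_def W_def
    by (rule computable_rec) (intro computable_intros computable_comp[OF S(1)] computable_comp[OF T(1)])+
  moreover have Wmono: "W s' c n = Suc y" if "s \<le> s'" "W s c n = Suc y" for s s' c n y
    using that(2)
  proof (induction n arbitrary: y)
    case 0
    then show ?case using SD(1)[OF that(1)] by (simp add: W_def)
  next
    case (Suc n)
    then obtain r where r: "W s c n = Suc r" by (cases "W s c n") (auto simp: W_def)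
    from Suc.IH[OF r] Suc.prems r show ?case
      using TD(1)[OF that(1)] by (simp add: W_def del: code_nat_def)
  qed
  moreover have Wcor: "rec_nat (f xs) (\<lambda>n r. Option.bind r (\<lambda>y. g (n # y # xs))) n = Some y
      \<longleftrightarrow> (\<exists>s. W s (list_code xs) n = Suc y)" (is "?R n = _ \<longleftrightarrow> _") if len: "length xs = k" for xs n y
  proof (induction n arbitrary: y)
    case 0
    then show ?case using SD(2)[OF len] by (simp add: W_def)
  next
    case (Suc n)
    have step: "W s (list_code xs) (Suc n) = (if W s (list_code xs) n = 0 then 0 else T (s, list_code (n # (W s (list_code xs) n - 1) # xs)))" for s
      by (simp add: W_def)
    have gT: "g (n # r # xs) = Some y \<longleftrightarrow> (\<exists>s. T (s, list_code (n # r # xs)) = Suc y)" for r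
      by (rule TD(2)) (simp add: len)
    show ?case
    proof
      assume "?R (Suc n) = Some y"
      then obtain r where r: "?R n = Some r" "g (n # r # xs) = Some y" by (auto simp: Option.bind_eq_Some_conv)
      then obtain s s' where s: "W s (list_code xs) n = Suc r" and s': "T (s', list_code (n # r # xs)) = Suc y"
        using Suc.IH gT by blast
      have "W (max s s') (list_code xs) n = Suc r" using Wmono[OF _ s] by simp
      moreover have "T (max s s', list_code (n # r # xs)) = Suc y" using TD(1)[OF _ s'] by simp
      ultimately show "\<exists>s. W s (list_code xs) (Suc n) = Suc y" unfolding step by (intro exI[of _ "max s s'"]) simp
    next
      assume "\<exists>s. W s (list_code xs) (Suc n) = Suc y"
      then obtain s where s: "W s (list_code xs) (Suc n) = Suc y" ..
      then obtain r where r: "W s (list_code xs) n = Suc r" unfolding step by (cases "W s (list_code xs) n") auto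
      then have "?R n = Some r" using Suc.IH by blast
      moreover have "g (n # r # xs) = Some y" using s r gT unfolding step by auto
      ultimately show "?R (Suc n) = Some y" by simp
    qed
  qed
  have "approximates U (Suc k) (\<lambda>xs. rec_nat (f (tl xs))
       (\<lambda>n r. Option.bind r (\<lambda>y. g (n # y # tl xs))) (hd xs))"
    unfolding approximates_def
  proof (intro conjI allI impI)
    fix s s' c y assume "s \<le> s'" "U (s, c) = Suc y"
    then show "U (s', c) = Suc y" using Wmono[of s s'] by (simp add: U_def)
  next
    fix xs :: "nat list" and y assume "length xs = Suc k"
    then obtain n zs where xs: "xs = n # zs" "length zs = k" by (cases xs) auto
    show "rec_nat (f (tl xs)) (\<lambda>n r. Option.bind r (\<lambda>y. g (n # y # tl xs))) (hd xs) = Some y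
       \<longleftrightarrow> (\<exists>s. U (s, list_code xs) = Suc y)"
      using Wcor[OF xs(2), of n y] by (simp add: xs U_def del: code_nat_def)
  qed
  ultimately show ?case by blast
next
  case (mu k f)
  then obtain T where T: "computable F T" "approximates T (Suc k) f" by blast
  note TD = approximatesD[OF T(2)]
  define P where "P s c n \<longleftrightarrow> T (s, code (n, c)) = 1 \<and> (\<forall>m<n. 1 < T (s, code (m, c)))" for s c n :: nat
  define U where "U p = (\<Sum>n<fst p. if P (fst p) (snd p) n then Suc n else 0)" for p
  have "computable F U" unfolding U_def P_def by (intro computable_intros computable_comp[OF T(1)])
  have uniq: "m = n" if "P s c m" "P s c n" for s c m n
    using that unfolding P_def by (metis linorder_neqE_nat less_irrefl)
  have U: "U (s, c) = Suc y \<longleftrightarrow> y < s \<and> P s c y" for s c y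
    unfolding U_def fst_conv snd_conv by (rule sum_if_unique) (rule uniq)
  have Pmono: "P s' c n" if "s \<le> s'" "P s c n" for s s' c n
    unfolding P_def
  proof (intro conjI allI impI)
    show "T (s', code (n, c)) = 1" using TD(1)[OF that(1)] that(2) by (simp add: P_def)
    fix m assume "m < n"
    then have "1 < T (s, code (m, c))" using that(2) by (simp add: P_def)
    then obtain v where "T (s, code (m, c)) = Suc (Suc v)" by (metis One_nat_def less_imp_Suc_add add_Suc_shift plus_1_eq_Suc add_Suc)
    from TD(1)[OF that(1) this] show "1 < T (s', code (m, c))" by simp
  qed
  have "approximates U k (\<lambda>xs. mu_search (\<lambda>n. f (n # xs)))"
    unfolding approximates_def
  proof (intro conjI allI impI)
    fix s s' c y assume "s \<le> s'" "U (s, c) = Suc y"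
    then show "U (s', c) = Suc y" using Pmono[of s s'] U by auto
  next
    fix xs :: "nat list" and y assume len: "length xs = k"
    have fT: "f (n # xs) = Some v \<longleftrightarrow> (\<exists>s. T (s, code (n, list_code xs)) = Suc v)" for n v
      using TD(2)[of "n # xs"] len by simp
    show "mu_search (\<lambda>n. f (n # xs)) = Some y \<longleftrightarrow> (\<exists>s. U (s, list_code xs) = Suc y)"
      unfolding mu_search_Some U
    proof
      assume *: "f (y # xs) = Some 0 \<and> (\<forall>m<y. \<exists>v. f (m # xs) = Some (Suc v))"
      then obtain s0 where s0: "T (s0, code (y, list_code xs)) = 1" using fT by auto
      have "\<forall>m<y. \<exists>s v. T (s, code (m, list_code xs)) = Suc (Suc v)" using * fT by blast
      then obtain S where S: "\<And>m. m < y \<Longrightarrow> \<exists>v. T (S m, code (m, list_code xs)) = Suc (Suc v)" by metis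
      define s where "s = Suc y + s0 + sum S {..<y}"
      have "P s (list_code xs) y" unfolding P_def
      proof (intro conjI allI impI)
        show "T (s, code (y, list_code xs)) = 1" using TD(1)[of s0 s _ 0] s0 by (simp add: s_def)
        fix m assume m: "m < y"
        then obtain v where "T (S m, code (m, list_code xs)) = Suc (Suc v)" using S by blast
        moreover have "S m \<le> s" unfolding s_def using member_le_sum[of m "{..<y}" S] m by simp
        ultimately show "1 < T (s, code (m, list_code xs))" using TD(1)[of "S m" s] by simp
      qed
      moreover have "y < s" by (simp add: s_def)
      ultimately show "\<exists>s. y < s \<and> P s (list_code xs) y" by blast
    next
      assume "\<exists>s. y < s \<and> P s (list_code xs) y"
      then obtain s where s: "P s (list_code xs) y" by blast
      have "f (y # xs) = Some 0" using s fT by (auto simp: P_def)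
      moreover have "\<exists>v. f (m # xs) = Some (Suc v)" if "m < y" for m
      proof -
        have "1 < T (s, code (m, list_code xs))" using s that by (simp add: P_def)
        then obtain v where "T (s, code (m, list_code xs)) = Suc (Suc v)" by (metis One_nat_def less_imp_Suc_add add_Suc_shift plus_1_eq_Suc add_Suc)
        then show ?thesis using fT by blast
      qed
      ultimately show "f (y # xs) = Some 0 \<and> (\<forall>m<y. \<exists>v. f (m # xs) = Some (Suc v))" by blast
    qed
  qed
  with \<open>computable F U\<close> show ?case by blast
qed

definition stages :: "(nat \<times> 'a::enc \<Rightarrow> nat) \<Rightarrow> ('a \<Rightarrow> 'b::enc option) \<Rightarrow> bool" where
  "stages G f \<longleftrightarrow> (\<forall>s s' x y. s \<le> s' \<longrightarrow> G (s, x) = Suc y \<longrightarrow> G (s', x) = Suc y) \<and>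
     (\<forall>x y. f x = Some y \<longleftrightarrow> (\<exists>s. G (s, x) = Suc (code y)))"

lemma stagesD:
  assumes "stages G f"
  shows "s \<le> s' \<Longrightarrow> G (s, x) = Suc y \<Longrightarrow> G (s', x) = Suc y"
    and "f x = Some z \<longleftrightarrow> (\<exists>s. G (s, x) = Suc (code z))"
  using assms unfolding stages_def by blast+

lemma ex_stages:
  fixes f :: "'a::enc \<Rightarrow> 'b::enc option"
  assumes "pcomputable F f"
  shows "\<exists>G. computable F G \<and> stages G f"
proof -
  obtain g where g: "partrec_in F 1 g" "\<And>x. g [code x] = map_option code (f x)"
    using assms unfolding pcomputable_def by blast
  obtain T where T: "computable F T" "approximates T 1 g" using partrec_approximation[OF g(1)] by blast
  note TD = approximatesD[OF T(2)]
  define G where "G p = T (fst p, code (code (snd p), 0::nat))" for p :: "nat \<times> 'a"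
  have "computable F G" unfolding G_def by (intro computable_intros computable_comp[OF T(1)])
  moreover have "stages G f" unfolding stages_def
  proof (intro conjI allI impI)
    fix s s' y :: nat and x :: 'a assume "s \<le> s'" "G (s, x) = Suc y"
    then show "G (s', x) = Suc y" unfolding G_def fst_conv snd_conv by (rule TD(1))
  next
    fix x :: 'a and y :: 'b
    have "f x = Some y \<longleftrightarrow> g [code x] = Some (code y)" unfolding g(2) by (cases "f x") auto
    also have "\<dots> \<longleftrightarrow> (\<exists>s. T (s, list_code [code x]) = Suc (code y))" by (rule TD(2)) simp
    finally show "f x = Some y \<longleftrightarrow> (\<exists>s. G (s, x) = Suc (code y))" by (simp add: G_def)
  qed
  ultimately show ?thesis by blast
qed

text \<open>
  Lists the domain of \<open>f\<close> without repetition: \<open>x\<close> has the index \<open>code (s, x)\<close>, where \<open>s\<close> is the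
  first stage at least \<open>bound (x, f x)\<close> at which \<open>f x\<close> has been found. As \<open>code (s, x) \<ge> s\<close>, the
  bound delays an element until the index is large enough for the caller.
\<close>

lemma pcomputable_enumeration:
  fixes f :: "'a::enc \<Rightarrow> 'b::enc option" and bound :: "'a \<times> 'b \<Rightarrow> nat"
  assumes "pcomputable F f" "computable F bound"
  obtains act e h where "decidable F act" "computable F e" "computable F h" "bij_betw e {i::nat. act i} (dom f)"
    "\<And>i. act i \<Longrightarrow> f (e i) = Some (h i)" "\<And>i. act i \<Longrightarrow> bound (e i, h i) \<le> i"
proof -
  obtain G :: "nat \<times> 'a \<Rightarrow> nat" where G1: "computable F G" and st: "stages G f"
    using ex_stages[OF assms(1)] by blast
  note G = G1 stagesD[OF st]
  define Q where "Q p \<longleftrightarrow> 0 < G p \<and> bound (snd p, decode (G p - 1)) \<le> fst p" for p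
  define act where "act i \<longleftrightarrow> Q (decode i) \<and> (\<forall>s<fst (decode i :: nat \<times> 'a). \<not> Q (s, snd (decode i :: nat \<times> 'a)))" for i
  define e where "e i = snd (decode i :: nat \<times> 'a)" for i
  define h where "h i = (decode (G (decode i) - 1) :: 'b)" for i
  have Q: "decidable F Q" unfolding Q_def by (intro computable_intros G(1) computable_comp[OF assms(2)])
  have out: "f x = Some (decode (G (s, x) - 1))" if "0 < G (s, x)" for s x
    unfolding G(3) using that by (intro exI[of _ s]) simp
  show thesis
  proof
    show "decidable F act" unfolding act_def by (intro computable_intros decidable_comp[OF Q])
    show "computable F e" unfolding e_def by (intro computable_intros)
    show "computable F h" unfolding h_def by (intro computable_intros computable_comp[OF G(1)])
    show fh: "f (e i) = Some (h i)" if "act i" for i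
    proof -
      obtain s x where "(decode i :: nat \<times> 'a) = (s, x)" by (cases "decode i :: nat \<times> 'a")
      then show ?thesis using that out[of s x] by (simp add: act_def Q_def e_def h_def)
    qed
    show "bound (e i, h i) \<le> i" if "act i" for i
    proof -
      have "bound (e i, h i) \<le> fst (decode i :: nat \<times> 'a)" using that by (simp add: act_def Q_def e_def h_def)
      also have "\<dots> \<le> i" unfolding decode_prod fst_conv decode_nat
        by (metis le_prod_encode_1 prod.collapse prod_decode_inverse)
      finally show ?thesis .
    qed
    show "bij_betw e {i. act i} (dom f)"
    proof (intro bij_betw_imageI inj_onI)
      fix i j assume i: "i \<in> {i. act i}" and j: "j \<in> {i. act i}" and "e i = e j"
      obtain s x where di: "(decode i :: nat \<times> 'a) = (s, x)" by (cases "decode i :: nat \<times> 'a")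
      obtain s' x' where dj: "(decode j :: nat \<times> 'a) = (s', x')" by (cases "decode j :: nat \<times> 'a")
      have "x = x'" using \<open>e i = e j\<close> by (simp add: e_def di dj)
      moreover have "s = s'"
        using i j \<open>x = x'\<close> by (simp add: act_def di dj) (metis linorder_neqE_nat)
      ultimately have "(decode i :: nat \<times> 'a) = decode j" by (simp add: di dj)
      then show "i = j" by (metis code_decode)
    next
      show "e ` {i. act i} = dom f"
      proof (intro set_eqI iffI)
        fix x assume "x \<in> e ` {i. act i}" then show "x \<in> dom f" using fh by auto
      next
        fix x assume "x \<in> dom f"
        then obtain y where "f x = Some y" by auto
        then obtain s where s: "G (s, x) = Suc (code y)" using G(3) by blast
        define s' where "s' = max s (bound (x, y))"
        have "G (s', x) = Suc (code y)" using G(2)[OF _ s] by (simp add: s'_def)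
        then have "Q (s', x)" by (simp add: Q_def s'_def)
        define s0 where "s0 = (LEAST s. Q (s, x))"
        have "Q (s0, x)" unfolding s0_def using \<open>Q (s', x)\<close> by (rule LeastI)
        moreover have "\<forall>s<s0. \<not> Q (s, x)" unfolding s0_def using not_less_Least by blast
        ultimately have "act (code (s0, x))" by (simp add: act_def)
        then show "x \<in> e ` {i. act i}" by (intro image_eqI[of _ _ "code (s0, x)"]) (auto simp: e_def)
      qed
    qed
  qed
qed


section \<open>Computability on strings\<close>

lemma partial_computable_iff_pcomputable: "partial_computable F M \<longleftrightarrow> pcomputable F M"
proof -
  have "(code :: bool list \<Rightarrow> nat) = str_code" by (rule ext) simp
  then show ?thesis by (simp add: partial_computable_def pcomputable_def)
qed

text \<open>
  Unlike \<open>s ! i\<close>, this has a known value also for \<open>i \<ge> length s\<close>, so it is decidable without a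
  side condition.
\<close>

definition bit_at :: "bool list \<Rightarrow> nat \<Rightarrow> bool" where
  "bit_at s i \<longleftrightarrow> i < length s \<and> s ! i"

lemma str_code_tl: "str_code (tl s) = (str_code s - 1) div 2"
  by (cases s) auto

lemma computable_drop [computable_intros]:
  fixes s :: "'a::enc \<Rightarrow> bool list"
  assumes "computable F s" "computable F i" shows "computable F (\<lambda>x. drop (i x) (s x))"
proof -
  have "computable F (\<lambda>x. decode (rec_nat (code (s x)) (\<lambda>n r. (r - 1) div 2) (i x)) :: bool list)"
    by (intro computable_intros computable_rec assms)
  moreover have "rec_nat (code t) (\<lambda>n r. (r - 1) div 2) n = code (drop n t)" for t :: "bool list" and n
    by (induction n) (simp_all add: str_code_tl[unfolded One_nat_def, symmetric] drop_Suc tl_drop)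
  ultimately show ?thesis by (simp only: decode_code)
qed

lemma computable_length [computable_intros]:
  fixes s :: "'a::enc \<Rightarrow> bool list"
  assumes "computable F s" shows "computable F (\<lambda>x. length (s x))"
proof -
  have "computable F (\<lambda>x. LEAST n. drop n (s x) = [])"
  proof (rule computable_Least)
    show "decidable F (\<lambda>p. drop (snd p) (s (fst p)) = [])" by (intro computable_intros computable_comp[OF assms])
    show "\<exists>n. drop n (s x) = []" for x by (rule exI[of _ "length (s x)"]) simp
  qed
  moreover have "(LEAST n. drop n (s x) = []) = length (s x)" for x
    by (rule Least_equality) auto
  ultimately show ?thesis by simp
qed

lemma decidable_bit_at [computable_intros]:
  assumes "computable F s" "computable F i" shows "decidable F (\<lambda>x. bit_at (s x) (i x))"
proof -
  have "decidable F (\<lambda>x. i x < length (s x) \<and> \<not> odd (code (drop (i x) (s x))))"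
    by (intro computable_intros assms)
  moreover have "even (str_code (drop n t)) \<longleftrightarrow> t ! n" if "n < length t" for n t
    using Cons_nth_drop_Suc[OF that, symmetric] by (simp only:) simp
  then have "(n < length t \<and> \<not> odd (code (drop n t))) = bit_at t n" for n t
    by (auto simp: bit_at_def)
  ultimately show ?thesis by simp
qed

lemma str_code_map: "str_code (map f [0..<n]) = (\<Sum>i<n. 2 ^ i * (1 + of_bool (f i)))"
proof -
  have "str_code (s @ [b]) = str_code s + 2 ^ length s * (1 + of_bool b)" for s b
    by (induction s) auto
  then show ?thesis by (induction n) auto
qed

lemma computable_map_upt [computable_intros]:
  fixes f :: "'a::enc \<Rightarrow> nat \<Rightarrow> bool"
  assumes "decidable F (\<lambda>p. f (fst p) (snd p))" "computable F n"
  shows "computable F (\<lambda>x. map (f x) [0..<n x])"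
proof -
  have "computable F (\<lambda>x. decode (\<Sum>i<n x. 2 ^ i * (1 + of_bool (f x i))) :: bool list)"
    by (intro computable_intros assms)
  then show ?thesis by (simp only: str_code_map[symmetric] code_string[symmetric] decode_code)
qed

lemma computable_take [computable_intros]:
  fixes s :: "'a::enc \<Rightarrow> bool list"
  assumes "computable F s" "computable F i" shows "computable F (\<lambda>x. take (i x) (s x))"
proof -
  have "computable F (\<lambda>x. map (\<lambda>j. bit_at (s x) j) [0..<if i x < length (s x) then i x else length (s x)])"
    by (intro computable_intros assms computable_comp[OF assms(1)])
  moreover have "map (\<lambda>j. bit_at t j) [0..<if n < length t then n else length t] = take n t" for n t
    by (auto simp: bit_at_def intro: nth_equalityI)
  ultimately show ?thesis by simp
qed

text \<open>
  The most significant digit comes first. Thus a string \<open>s\<close> of length \<open>n\<close> corresponds to the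
  interval from \<open>val s / 2^n\<close> to \<open>(val s + 1) / 2^n\<close>, and extending \<open>s\<close> subdivides the interval.
\<close>

fun val :: "bool list \<Rightarrow> nat" where
  "val [] = 0"
| "val (b # s) = of_bool b * 2 ^ length s + val s"

definition string_of_val :: "nat \<Rightarrow> nat \<Rightarrow> bool list" where
  "string_of_val n v = map (\<lambda>j. odd (v div 2 ^ (n - 1 - j))) [0..<n]"

lemma length_string_of_val [simp]: "length (string_of_val n v) = n"
  by (simp add: string_of_val_def)

lemma string_of_val_Suc: "string_of_val (Suc n) v = odd (v div 2 ^ n) # string_of_val n v"
  unfolding string_of_val_def upt_conv_Cons[OF zero_less_Suc] map_Suc_upt[symmetric] by simp

lemma val_string_of_val: "val (string_of_val n v) = v mod 2 ^ n"
proof (induction n)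
  case 0 then show ?case by (simp add: string_of_val_def)
next
  case (Suc n)
  have "v mod 2 ^ Suc n = 2 ^ n * (v div 2 ^ n mod 2) + v mod 2 ^ n"
    unfolding power_Suc2 by (rule mod_mult2_eq)
  with Suc show ?case by (simp add: string_of_val_Suc mod2_eq_if)
qed

lemma val_append: "val (s @ t) = val s * 2 ^ length t + val t"
  by (induction s) (auto simp: algebra_simps power_add)

lemma val_less: "val s < 2 ^ length s"
  by (induction s) auto

lemma string_of_val_val: "string_of_val (length s) (val s) = s"
proof (induction s)
  case Nil then show ?case by (simp add: string_of_val_def)
next
  case (Cons b s)
  have "string_of_val n (2 ^ n * k + v) = string_of_val n v" for n k v :: nat
  proof -
    have "odd ((2 ^ n * k + v) div 2 ^ (n - 1 - j)) = odd (v div 2 ^ (n - 1 - j))" if "j < n" for j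
    proof -
      have "(2::nat) ^ n = 2 ^ (n - 1 - j) * (2 * 2 ^ j)"
        using that by (simp flip: power_Suc power_add)
      then have "(2 ^ n * k + v) div 2 ^ (n - 1 - j) = 2 * 2 ^ j * k + v div 2 ^ (n - 1 - j)"
        by (simp add: mult.assoc)
      then show ?thesis by simp
    qed
    then show ?thesis by (simp add: string_of_val_def)
  qed
  from this[of "length s" 1 "val s"] show ?case using Cons val_less[of s]
    by (cases b) (simp_all add: string_of_val_Suc)
qed

lemma val_inj: "length s = length t \<Longrightarrow> val s = val t \<Longrightarrow> s = t"
  by (metis string_of_val_val)

lemma computable_string_of_val [computable_intros]:
  assumes "computable F n" "computable F v" shows "computable F (\<lambda>x. string_of_val (n x) (v x))"
  unfolding string_of_val_def by (intro computable_intros assms computable_comp[OF assms(1)] computable_comp[OF assms(2)])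

lemma computable_val [computable_intros]:
  assumes "computable F s" shows "computable F (\<lambda>x. val (s x))"
proof -
  have "computable F (\<lambda>x. LEAST v. string_of_val (length (s x)) v = s x)"
  proof (rule computable_Least)
    show "decidable F (\<lambda>p. string_of_val (length (s (fst p))) (snd p) = s (fst p))"
      by (intro computable_intros computable_comp[OF assms])
    show "\<exists>v. string_of_val (length (s x)) v = s x" for x using string_of_val_val by blast
  qed
  moreover have "(LEAST v. string_of_val (length t) v = t) = val t" for t
  proof (rule Least_equality)
    show "val t \<le> v" if "string_of_val (length t) v = t" for v
      using val_string_of_val[of "length t" v] that by simp
  qed (rule string_of_val_val)
  ultimately show ?thesis by simp
qed

section \<open>Computable rational-valued functions\<close>

text \<open>
  The general form of a computable sequence of rationals, as in \<^const>\<open>computable_real\<close>.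
\<close>

definition rat_computable :: "(nat \<Rightarrow> nat) set \<Rightarrow> ('a::enc \<Rightarrow> real) \<Rightarrow> bool" where
  "rat_computable F q \<longleftrightarrow> (\<exists>a b d. computable F a \<and> computable F b \<and> computable F d \<and>
      (\<forall>x. q x = (real (a x) - real (b x)) / (real (d x) + 1)))"

lemma rat_computableI:
  assumes "computable F a" "computable F b" "computable F d" "\<And>x. q x = (real (a x) - real (b x)) / (real (d x) + 1)"
  shows "rat_computable F q"
  unfolding rat_computable_def using assms by blast

lemma rat_computable_comp:
  assumes "rat_computable F q" "computable F f" shows "rat_computable F (\<lambda>x. q (f x))"
proof -
  obtain a b d where q: "computable F a" "computable F b" "computable F d" "\<And>x. q x = (real (a x) - real (b x)) / (real (d x) + 1)"
    using assms(1) unfolding rat_computable_def by blast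
  show ?thesis by (rule rat_computableI[OF computable_comp[OF q(1) assms(2)] computable_comp[OF q(2) assms(2)] computable_comp[OF q(3) assms(2)] q(4)])
qed

lemma rat_computable_nat [computable_intros]: "computable F f \<Longrightarrow> rat_computable F (\<lambda>x. real (f x))"
  by (rule rat_computableI[of F f "\<lambda>_. 0" "\<lambda>_. 0"]) (auto intro: computable_intros)

lemma rat_computable_half_power [computable_intros]: "computable F f \<Longrightarrow> rat_computable F (\<lambda>x. (1/2) ^ f x)"
  by (rule rat_computableI[of F "\<lambda>_. 1" "\<lambda>_. 0" "\<lambda>x. 2 ^ f x - 1"])
     (auto intro!: computable_intros simp: of_nat_diff power_one_over)

lemma rat_computable_0 [computable_intros]: "rat_computable F (\<lambda>x. 0)"
  using rat_computable_nat[OF computable_const[of F 0]] by simp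

lemma rat_computable_numeral [computable_intros]: "rat_computable F (\<lambda>x. numeral n)"
  using rat_computable_nat[OF computable_const[of F "numeral n"]] by simp

lemma frac_add:
  "(a - b) / (d + 1) + (a' - b') / (d' + 1)
    = ((a * (d' + 1) + a' * (d + 1)) - (b * (d' + 1) + b' * (d + 1))) / (d * d' + d + d' + 1)"
  if "0 \<le> d" "0 \<le> d'" for a b d a' b' d' :: real
proof -
  have "d * d' + d + d' + 1 = (d + 1) * (d' + 1)" by (simp add: algebra_simps)
  then show ?thesis using that by (simp add: add_frac_eq algebra_simps)
qed

lemma rat_computable_add [computable_intros]:
  assumes "rat_computable F q" "rat_computable F r" shows "rat_computable F (\<lambda>x. q x + r x)"
proof -
  obtain a b d where q: "computable F a" "computable F b" "computable F d" "\<And>x. q x = (real (a x) - real (b x)) / (real (d x) + 1)"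
    using assms(1) unfolding rat_computable_def by blast
  obtain a' b' d' where r: "computable F a'" "computable F b'" "computable F d'" "\<And>x. r x = (real (a' x) - real (b' x)) / (real (d' x) + 1)"
    using assms(2) unfolding rat_computable_def by blast
  show ?thesis
  proof (rule rat_computableI)
    show "computable F (\<lambda>x. a x * (d' x + 1) + a' x * (d x + 1))" "computable F (\<lambda>x. b x * (d' x + 1) + b' x * (d x + 1))"
      "computable F (\<lambda>x. d x * d' x + d x + d' x)" by (intro computable_intros q r)+
    show "q x + r x = (real (a x * (d' x + 1) + a' x * (d x + 1)) - real (b x * (d' x + 1) + b' x * (d x + 1)))
        / (real (d x * d' x + d x + d' x) + 1)" for x
      unfolding q(4) r(4) by (subst frac_add) (simp_all add: algebra_simps)
  qed
qed

lemma rat_computable_minus [computable_intros]: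
  assumes "rat_computable F q" shows "rat_computable F (\<lambda>x. - q x)"
proof -
  obtain a b d where q: "computable F a" "computable F b" "computable F d" "\<And>x. q x = (real (a x) - real (b x)) / (real (d x) + 1)"
    using assms(1) unfolding rat_computable_def by blast
  show ?thesis by (rule rat_computableI[OF q(2,1,3)]) (simp add: q(4) minus_divide_left)
qed

lemma rat_computable_diff [computable_intros]:
  assumes "rat_computable F q" "rat_computable F r" shows "rat_computable F (\<lambda>x. q x - r x)"
  using rat_computable_add[OF assms(1) rat_computable_minus[OF assms(2)]] by simp

lemma rat_computable_mult [computable_intros]:
  assumes "rat_computable F q" "rat_computable F r" shows "rat_computable F (\<lambda>x. q x * r x)"
proof -
  obtain a b d where q: "computable F a" "computable F b" "computable F d" "\<And>x. q x = (real (a x) - real (b x)) / (real (d x) + 1)"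
    using assms(1) unfolding rat_computable_def by blast
  obtain a' b' d' where r: "computable F a'" "computable F b'" "computable F d'" "\<And>x. r x = (real (a' x) - real (b' x)) / (real (d' x) + 1)"
    using assms(2) unfolding rat_computable_def by blast
  show ?thesis
  proof (rule rat_computableI)
    show "computable F (\<lambda>x. a x * a' x + b x * b' x)" "computable F (\<lambda>x. a x * b' x + b x * a' x)"
      "computable F (\<lambda>x. d x * d' x + d x + d' x)" by (intro computable_intros q r)+
  qed (simp add: q(4) r(4) algebra_simps)
qed

lemma rat_computable_if [computable_intros]:
  assumes "decidable F P" "rat_computable F q" "rat_computable F r" shows "rat_computable F (\<lambda>x. if P x then q x else r x)"
proof -
  have "rat_computable F (\<lambda>x. real (of_bool (P x)) * q x + real (of_bool (\<not> P x)) * r x)"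
    by (intro computable_intros assms)
  moreover have "real (of_bool (P x)) * q x + real (of_bool (\<not> P x)) * r x = (if P x then q x else r x)" for x
    by simp
  ultimately show ?thesis by simp
qed

lemma rat_computable_sum [computable_intros]:
  fixes q :: "'a::enc \<Rightarrow> nat \<Rightarrow> real"
  assumes "rat_computable F (\<lambda>p. q (fst p) (snd p))" "computable F n" shows "rat_computable F (\<lambda>x. \<Sum>i<n x. q x i)"
proof -
  obtain a b d :: "'a \<times> nat \<Rightarrow> nat" where q: "computable F a" "computable F b" "computable F d"
    "\<And>p. q (fst p) (snd p) = (real (a p) - real (b p)) / (real (d p) + 1)"
    using assms(1) unfolding rat_computable_def by blast
  define step where "step x i r = (fst r * (d (x, i) + 1) + a (x, i) * (snd (snd r) + 1),
    fst (snd r) * (d (x, i) + 1) + b (x, i) * (snd (snd r) + 1),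
    snd (snd r) * d (x, i) + snd (snd r) + d (x, i))" for x i and r :: "nat \<times> nat \<times> nat"
  define R where "R x m = rec_nat (0, 0, 0) (step x) m" for x m
  have R: "computable F (\<lambda>x. R x (n x))" unfolding R_def step_def
    by (rule computable_rec) (intro computable_intros assms(2) computable_comp[OF q(1)] computable_comp[OF q(2)] computable_comp[OF q(3)])+
  have eq: "(\<Sum>i<m. q x i) = (real (fst (R x m)) - real (fst (snd (R x m)))) / (real (snd (snd (R x m))) + 1)" for x m
  proof (induction m)
    case 0 then show ?case by (simp add: R_def)
  next
    case (Suc m)
    have "R x (Suc m) = step x m (R x m)" by (simp add: R_def)
    moreover have "(\<Sum>i<Suc m. q x i) = (real (fst (R x m)) - real (fst (snd (R x m)))) / (real (snd (snd (R x m))) + 1)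
        + (real (a (x, m)) - real (b (x, m))) / (real (d (x, m)) + 1)"
      using Suc q(4)[of "(x, m)"] by simp
    ultimately show ?case by (simp only:) (subst frac_add, simp_all add: step_def algebra_simps)
  qed
  show ?thesis
    by (rule rat_computableI[OF _ _ _ eq]; intro computable_intros R)
qed

lemma decidable_rat_less [computable_intros]:
  assumes "rat_computable F q" "rat_computable F r" shows "decidable F (\<lambda>x. q x < r x)"
proof -
  obtain a b d where q: "computable F a" "computable F b" "computable F d" "\<And>x. q x = (real (a x) - real (b x)) / (real (d x) + 1)"
    using assms(1) unfolding rat_computable_def by blast
  obtain a' b' d' where r: "computable F a'" "computable F b'" "computable F d'" "\<And>x. r x = (real (a' x) - real (b' x)) / (real (d' x) + 1)"
    using assms(2) unfolding rat_computable_def by blast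
  have "decidable F (\<lambda>x. a x * (d' x + 1) + b' x * (d x + 1) < a' x * (d x + 1) + b x * (d' x + 1))"
    by (intro computable_intros q r)
  moreover have "a x * (d' x + 1) + b' x * (d x + 1) < a' x * (d x + 1) + b x * (d' x + 1) \<longleftrightarrow> q x < r x" for x
  proof -
    have "q x < r x \<longleftrightarrow> (real (a x) - real (b x)) * (real (d' x) + 1) < (real (a' x) - real (b' x)) * (real (d x) + 1)"
      unfolding q(4) r(4) by (simp add: divide_simps)
    also have "\<dots> \<longleftrightarrow> real (a x * (d' x + 1) + b' x * (d x + 1)) < real (a' x * (d x + 1) + b x * (d' x + 1))"
      by (simp add: algebra_simps)
    finally show ?thesis by (simp only: of_nat_less_iff)
  qed
  ultimately show ?thesis by simp
qed

lemma decidable_rat_le [computable_intros]: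
  assumes "rat_computable F q" "rat_computable F r" shows "decidable F (\<lambda>x. q x \<le> r x)"
proof -
  have "decidable F (\<lambda>x. \<not> r x < q x)" by (intro computable_intros assms)
  then show ?thesis by (simp add: not_less)
qed

section \<open>The machine existence theorem\<close>

lemma val_prefix_interval:
  assumes "prefix s t"
  shows "real (val s) / 2 ^ length s \<le> real (val t) / 2 ^ length t"
    and "real (val t) / 2 ^ length t < (real (val s) + 1) / 2 ^ length s"
proof -
  obtain u where u: "t = s @ u" using assms by (auto simp: prefix_def)
  have "real (val u) < 2 ^ length u" using val_less[of u] by (metis of_nat_less_iff of_nat_numeral of_nat_power)
  then show "real (val s) / 2 ^ length s \<le> real (val t) / 2 ^ length t"
    "real (val t) / 2 ^ length t < (real (val s) + 1) / 2 ^ length s"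
    by (auto simp: u val_append power_add field_simps)
qed

text \<open>
  The online form of Shannon-Fano coding. The requests are listed as they are discovered, and the
  \<open>i\<close>-th one owns the slot from \<open>S i\<close> to \<open>S i + 2 * 2^-len\<close>, where \<open>S i\<close> is the total length of
  the earlier slots. A slot is twice as long as the dyadic interval it has to contain, so rounding
  its left end up to a multiple of \<open>2^-len\<close> yields a dyadic interval inside it. Slots are disjoint,
  hence the strings of these intervals are pairwise incomparable. The factor \<open>2\<close> in the hypothesis
  costs one bit of description length, and in return the place of a request depends on the earlier
  ones only through the single number \<open>S i\<close>.
\<close>

lemma kraft_chaitin:
  fixes f :: "'a::enc \<Rightarrow> bool list option" and len :: "'a \<Rightarrow> nat"
  assumes f: "pcomputable F f" and len: "computable F len"
    and kraft: "\<And>X. finite X \<Longrightarrow> X \<subseteq> dom f \<Longrightarrow> (\<Sum>x\<in>X. 2 * (1/2) ^ len x) \<le> (1::real)"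
  shows "\<exists>M h. prefix_free_machine F M \<and> bij_betw h (dom f) (dom M) \<and>
    (\<forall>x\<in>dom f. length (h x) = len x \<and> M (h x) = f x)"
proof -
  obtain act e out where act: "decidable F act" and e: "computable F e" and out: "computable F out"
    and bij: "bij_betw e {i::nat. act i} (dom f)" and fe: "\<And>i. act i \<Longrightarrow> f (e i) = Some (out i)"
    by (rule pcomputable_enumeration[OF f computable_const[of F 0]]) blast
  define w where "w i = (if act i then 2 * (1/2) ^ len (e i) else 0 :: real)" for i
  define S where "S i = (\<Sum>j<i. w j)" for i
  define v where "v i = (LEAST v. S i * real (2 ^ len (e i)) \<le> real v)" for i
  define p where "p i = string_of_val (len (e i)) (v i)" for i
  have w: "rat_computable F w" unfolding w_def by (intro computable_intros act computable_comp[OF len] e)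
  have S: "rat_computable F S" unfolding S_def by (intro computable_intros rat_computable_comp[OF w])
  have v: "computable F v" unfolding v_def
    by (rule computable_Least) (intro computable_intros rat_computable_comp[OF S] computable_comp[OF len] computable_comp[OF e], rule real_arch_simple)
  have p: "computable F p" unfolding p_def by (intro computable_intros computable_comp[OF len] e v)
  have S_le: "S i \<le> 1" for i
  proof -
    have "S i = (\<Sum>j\<in>{j. j < i \<and> act j}. 2 * (1/2) ^ len (e j))"
      unfolding S_def w_def by (rule sum.mono_neutral_cong_right) auto
    also have "\<dots> = (\<Sum>x\<in>e ` {j. j < i \<and> act j}. 2 * (1/2) ^ len x)"
      by (rule sum.reindex_cong[symmetric, of e]) (use bij in \<open>auto simp: bij_betw_def inj_on_def\<close>)
    also have "\<dots> \<le> 1" by (rule kraft) (use fe in auto)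
    finally show ?thesis .
  qed
  have S_Suc: "S (Suc i) = S i + 2 * (1/2) ^ len (e i)" if "act i" for i
    using that by (simp add: S_def w_def)
  have S_mono: "S i \<le> S j" if "i \<le> j" for i j
    unfolding S_def by (rule sum_mono2) (use that in \<open>auto simp: w_def\<close>)
  have S_nonneg: "0 \<le> S i" for i unfolding S_def w_def by (intro sum_nonneg) auto
  \<comment> \<open>The chosen dyadic interval lies in the slot.\<close>
  have lower: "S i \<le> real (v i) / 2 ^ len (e i)" and upper: "(real (v i) + 1) / 2 ^ len (e i) \<le> S i + 2 * (1/2) ^ len (e i)" for i
  proof -
    have ex: "\<exists>v. S i * real (2 ^ len (e i)) \<le> real v" by (rule real_arch_simple)
    have 1: "S i * real (2 ^ len (e i)) \<le> real (v i)" unfolding v_def using ex by (rule LeastI_ex)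
    then show "S i \<le> real (v i) / 2 ^ len (e i)" by (simp add: field_simps)
    have "real (v i) \<le> S i * 2 ^ len (e i) + 1"
    proof (cases "v i")
      case (Suc u)
      then have "\<not> S i * real (2 ^ len (e i)) \<le> real u" unfolding v_def using not_less_Least
        by (metis lessI)
      then show ?thesis using Suc by simp
    qed (simp add: S_nonneg)
    then have "(real (v i) + 1) / 2 ^ len (e i) \<le> (S i * 2 ^ len (e i) + 2) / 2 ^ len (e i)"
      by (intro divide_right_mono) auto
    also have "\<dots> = S i + 2 * (1/2) ^ len (e i)" by (simp add: add_divide_distrib power_one_over)
    finally show "(real (v i) + 1) / 2 ^ len (e i) \<le> S i + 2 * (1/2) ^ len (e i)" .
  qed
  have val_p: "val (p i) = v i" if "act i" for i
  proof -
    have "(real (v i) + 1) / 2 ^ len (e i) \<le> 1"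
      using upper[of i] S_Suc[OF that] S_le[of "Suc i"] by linarith
    then have "real (Suc (v i)) \<le> real (2 ^ len (e i))" by (simp add: field_simps)
    then have "v i < 2 ^ len (e i)" by (simp only: of_nat_le_iff Suc_le_eq)
    then show ?thesis by (simp add: p_def val_string_of_val)
  qed
  have len_p: "length (p i) = len (e i)" for i by (simp add: p_def)
  have disj: "\<not> prefix (p i) (p j)" "\<not> prefix (p j) (p i)" if "i < j" "act i" "act j" for i j
  proof -
    have le: "(real (v i) + 1) / 2 ^ len (e i) \<le> real (v j) / 2 ^ len (e j)"
      using upper[of i] S_Suc[OF that(2)] S_mono[of "Suc i" j] that(1) lower[of j] by linarith
    show "\<not> prefix (p i) (p j)"
      using val_prefix_interval(2)[of "p i" "p j"] le val_p that by (auto simp: len_p)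
    show "\<not> prefix (p j) (p i)"
    proof
      assume "prefix (p j) (p i)"
      then have "real (v j) / 2 ^ len (e j) \<le> real (v i) / 2 ^ len (e i)"
        using val_prefix_interval(1) val_p that by (metis len_p)
      with le have "(real (v i) + 1) / 2 ^ len (e i) \<le> real (v i) / 2 ^ len (e i)" by linarith
      then show False by (simp add: divide_le_cancel)
    qed
  qed
  have eqI: "i = j" if "prefix (p i) (p j)" "act i" "act j" for i j
    using that disj by (metis linorder_neqE_nat)
  define M where "M s = (if \<exists>i. act i \<and> p i = s then Some (out (LEAST i. act i \<and> p i = s)) else None)" for s
  have Mp: "M (p i) = Some (out i)" if "act i" for i
  proof -
    have "(LEAST j. act j \<and> p j = p i) = i"
    proof (rule Least_equality)
      show "i \<le> j" if "act j \<and> p j = p i" for j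
        using eqI[of j i] that \<open>act i\<close> by simp
    qed (simp add: that)
    then show ?thesis using that by (auto simp: M_def)
  qed
  have domM: "dom M = p ` {i. act i}"
    by (auto simp: M_def split: if_splits)
  have "decidable F (\<lambda>q. act (snd q) \<and> p (snd q) = fst q)"
    by (intro computable_intros decidable_comp[OF act] computable_comp[OF p])
  moreover have "computable F (\<lambda>q::bool list \<times> nat. out (snd q))"
    by (intro computable_intros computable_comp[OF out])
  ultimately have "pcomputable F M" unfolding M_def by (rule pcomputable_search)
  moreover have "prefix_free (dom M)"
    unfolding prefix_free_def domM using eqI by blast
  ultimately have "prefix_free_machine F M"
    by (simp add: prefix_free_machine_def partial_computable_iff_pcomputable)
  moreover define g where "g = the_inv_into {i. act i} e"
  have g: "act (g x)" "e (g x) = x" if "x \<in> dom f" for x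
    using bij_betw_apply[OF bij_betw_the_inv_into[OF bij] that]
      f_the_inv_into_f_bij_betw[OF bij that] by (simp_all add: g_def)
  have bij_g: "bij_betw g (dom f) {i. act i}" unfolding g_def by (rule bij_betw_the_inv_into[OF bij])
  have "bij_betw p {i. act i} (dom M)"
    unfolding bij_betw_def domM using eqI by (auto simp: inj_on_def)
  with bij_g have "bij_betw (p \<circ> g) (dom f) (dom M)" by (rule bij_betw_trans)
  moreover have "length ((p \<circ> g) x) = len x \<and> M ((p \<circ> g) x) = f x" if "x \<in> dom f" for x
    using g[OF that] Mp fe by (metis comp_apply len_p)
  ultimately show ?thesis by blast
qed


section \<open>Measure on Cantor space\<close>

abbreviation "\<mu> \<equiv> measure cantor_measure"

definition pre :: "(nat \<Rightarrow> bool) \<Rightarrow> nat \<Rightarrow> bool list" where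
  "pre X n = map X [0..<n]"

lemma length_pre [simp]: "length (pre X n) = n"
  by (simp add: pre_def)

lemma take_pre: "m \<le> n \<Longrightarrow> take m (pre X n) = pre X m"
  by (simp add: pre_def take_map)

lemma prefix_pre: "m \<le> n \<Longrightarrow> prefix (pre X m) (pre X n)"
  using take_is_prefix[of m "pre X n"] by (simp add: take_pre)

lemma cylinder_iff: "X \<in> cylinder s \<longleftrightarrow> pre X (length s) = s"
  unfolding cylinder_def pre_def list_eq_iff_nth_eq by simp

interpretation cantor: prob_space cantor_measure
  unfolding cantor_measure_def by (intro prob_space_PiM prob_space_measure_pmf)

lemma space_cantor [simp]: "space cantor_measure = UNIV"
  by (simp add: cantor_measure_def space_PiM)

lemma
  assumes "finite I"
  shows sets_coordinates [measurable]: "{X. \<forall>i\<in>I. X i = b i} \<in> sets cantor_measure"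
    and measure_coordinates: "\<mu> {X. \<forall>i\<in>I. X i = b i} = (1/2) ^ card I"
proof -
  interpret P: product_prob_space "\<lambda>i::nat. measure_pmf (bernoulli_pmf (1/2))" UNIV ..
  have eq: "{X. \<forall>i\<in>I. X i = b i} =
     prod_emb UNIV (\<lambda>i. measure_pmf (bernoulli_pmf (1/2))) I (\<Pi>\<^sub>E i\<in>I. {b i})"
    by (auto simp: prod_emb_def space_PiM PiE_iff restrict_def extensional_def)
  show "{X. \<forall>i\<in>I. X i = b i} \<in> sets cantor_measure"
    unfolding eq cantor_measure_def using assms by (intro sets_PiM_I) auto
  have "\<mu> {X. \<forall>i\<in>I. X i = b i} = (\<Prod>i\<in>I. measure (measure_pmf (bernoulli_pmf (1/2))) {b i})"
    unfolding eq cantor_measure_def using assms by (intro P.measure_PiM_emb) auto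
  also have "\<dots> = (\<Prod>i\<in>I. 1/2)"
    by (intro prod.cong refl) (simp add: measure_pmf_single pmf_bernoulli_True pmf_bernoulli_False split: bool.splits)
  finally show "\<mu> {X. \<forall>i\<in>I. X i = b i} = (1/2) ^ card I" by simp
qed

lemma cylinder_coordinates: "cylinder s = {X. \<forall>i\<in>{..<length s}. X i = s ! i}"
  by (auto simp: cylinder_def)

lemma sets_cylinder [measurable, simp]: "cylinder s \<in> sets cantor_measure"
  unfolding cylinder_coordinates by (rule sets_coordinates) simp

lemma measure_cylinder: "\<mu> (cylinder s) = (1/2) ^ length s"
  unfolding cylinder_coordinates by (subst measure_coordinates) auto

lemma sets_prefix_property: "{X. P (pre X m)} \<in> sets cantor_measure"
proof -
  have "{X. P (pre X m)} = (\<Union>s\<in>{s. length s = m \<and> P s}. cylinder s)"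
    by (auto simp: cylinder_iff)
  moreover have "(\<Union>s\<in>{s. length s = m \<and> P s}. cylinder s) \<in> sets cantor_measure"
    by (rule sets.countable_UN') (simp_all add: image_subset_iff)
  ultimately show ?thesis by simp
qed

lemma sets_ex_prefix: "{X. \<exists>m. P m (pre X m)} \<in> sets cantor_measure"
proof -
  have "(\<Union>m. {X. P m (pre X m)}) \<in> sets cantor_measure"
    by (intro sets.countable_UN image_subsetI sets_prefix_property)
  moreover have "{X. \<exists>m. P m (pre X m)} = (\<Union>m. {X. P m (pre X m)})" by blast
  ultimately show ?thesis by simp
qed

lemma cylinder_disjoint:
  assumes "\<not> prefix s t" "\<not> prefix t s" shows "cylinder s \<inter> cylinder t = {}"
proof -
  have False if "X \<in> cylinder s" "X \<in> cylinder t" for X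
  proof -
    have "pre X (length s) = s" "pre X (length t) = t" using that unfolding cylinder_iff by blast+
    then show False using prefix_pre[of "length s" "length t" X] prefix_pre[of "length t" "length s" X] assms
      by (cases "length s \<le> length t") auto
  qed
  then show ?thesis by auto
qed

lemma finite_strings: "finite {s :: bool list. length s = n \<and> P s}"
  by (rule finite_subset[OF _ finite_lists_length_eq[of "UNIV :: bool set" n]]) auto

lemma disjoint_cylinders:
  "prefix_free S \<Longrightarrow> disjoint_family_on cylinder S"
  unfolding disjoint_family_on_def
  by (intro ballI impI cylinder_disjoint) (auto simp: prefix_free_def)

lemma prefix_free_same_length: "prefix_free {s. length s = n \<and> P s}"
  unfolding prefix_free_def using not_equal_is_parallel by blast

lemma measure_finite_cylinders:
  assumes "finite S" "prefix_free S"
  shows "\<mu> (\<Union>s\<in>S. cylinder s) = (\<Sum>s\<in>S. (1/2) ^ length s)"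
  using cantor.finite_measure_finite_Union[OF assms(1) _ disjoint_cylinders[OF assms(2)]]
  by (simp add: measure_cylinder image_subset_iff)

lemma measure_prefix_property:
  "\<mu> {X. P (pre X n)} = real (card {s. length s = n \<and> P s}) / 2 ^ n"
proof -
  have "{X. P (pre X n)} = (\<Union>s\<in>{s. length s = n \<and> P s}. cylinder s)"
    by (auto simp: cylinder_iff)
  then have "\<mu> {X. P (pre X n)} = (\<Sum>s\<in>{s. length s = n \<and> P s}. (1/2) ^ length s)"
    using measure_finite_cylinders[OF finite_strings prefix_free_same_length] by simp
  also have "\<dots> = (\<Sum>s\<in>{s. length s = n \<and> P s}. (1/2) ^ n)" by (rule sum.cong) auto
  finally show ?thesis by (simp add: power_one_over)
qed

lemma prefix_free_subset: "prefix_free S \<Longrightarrow> T \<subseteq> S \<Longrightarrow> prefix_free T"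
  unfolding prefix_free_def by blast

lemma kraft_inequality:
  assumes "prefix_free S" "finite T" "T \<subseteq> S"
  shows "(\<Sum>s\<in>T. (1/2) ^ length s) \<le> (1::real)"
  unfolding measure_finite_cylinders[OF assms(2) prefix_free_subset[OF assms(1,3)], symmetric]
  by (rule cantor.prob_le_1)

text \<open>
  Continuity from below along the finite subsets \<open>J n\<close>, which increase to \<open>I\<close>.
\<close>

lemma measure_UN_le:
  fixes A :: "'i::countable \<Rightarrow> (nat \<Rightarrow> bool) set"
  assumes sets: "\<And>i. i \<in> I \<Longrightarrow> A i \<in> sets cantor_measure"
    and le: "\<And>J. finite J \<Longrightarrow> J \<subseteq> I \<Longrightarrow> \<mu> (\<Union>i\<in>J. A i) \<le> c"
  shows "\<mu> (\<Union>i\<in>I. A i) \<le> c"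
proof -
  define J where "J n = {i \<in> I. to_nat i < n}" for n
  have fin: "finite (J n)" for n
    by (rule finite_imageD[of to_nat]) (auto simp: J_def intro: finite_subset[of _ "{..<n}"])
  have sub: "J n \<subseteq> I" for n by (auto simp: J_def)
  have "(\<lambda>n. \<mu> (\<Union>i\<in>J n. A i)) \<longlonglongrightarrow> \<mu> (\<Union>n. \<Union>i\<in>J n. A i)"
  proof (rule cantor.finite_Lim_measure_incseq)
    show "range (\<lambda>n. \<Union>i\<in>J n. A i) \<subseteq> sets cantor_measure"
      using fin sub sets by (auto intro!: sets.finite_UN)
    show "incseq (\<lambda>n. \<Union>i\<in>J n. A i)" by (rule incseq_SucI) (auto simp: J_def)
  qed
  moreover have "(\<Union>n. \<Union>i\<in>J n. A i) = (\<Union>i\<in>I. A i)" by (auto simp: J_def)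
  ultimately have "(\<lambda>n. \<mu> (\<Union>i\<in>J n. A i)) \<longlonglongrightarrow> \<mu> (\<Union>i\<in>I. A i)" by simp
  then show ?thesis by (rule LIMSEQ_le_const2) (use le[OF fin sub] in auto)
qed

lemma measure_UN_le_infsum:
  fixes A :: "'i::countable \<Rightarrow> (nat \<Rightarrow> bool) set"
  assumes sets: "\<And>i. i \<in> I \<Longrightarrow> A i \<in> sets cantor_measure"
    and le: "\<And>J. finite J \<Longrightarrow> J \<subseteq> I \<Longrightarrow> (\<Sum>i\<in>J. \<mu> (A i)) \<le> c"
  shows "\<mu> (\<Union>i\<in>I. A i) \<le> c"
proof (rule measure_UN_le[OF sets])
  fix J assume J: "finite J" "J \<subseteq> I"
  then have "\<mu> (\<Union>i\<in>J. A i) \<le> (\<Sum>i\<in>J. \<mu> (A i))"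
    using sets by (intro cantor.finite_measure_subadditive_finite) auto
  also have "\<dots> \<le> c" by (rule le[OF J])
  finally show "\<mu> (\<Union>i\<in>J. A i) \<le> c" .
qed

text \<open>
  Kraft's inequality in exact form.
\<close>

lemma has_sum_cylinders:
  assumes "prefix_free S"
  shows "((\<lambda>s. (1/2) ^ length s) has_sum \<mu> (\<Union>s\<in>S. cylinder s)) S"
proof -
  let ?f = "\<lambda>s::bool list. (1/2 :: real) ^ length s"
  have sum: "?f summable_on S"
    by (rule nonneg_bdd_above_summable_on) (auto intro!: bdd_aboveI[of _ 1] kraft_inequality[OF assms])
  have "infsum ?f S \<le> \<mu> (\<Union>s\<in>S. cylinder s)"
  proof (rule infsum_le_finite_sums[OF sum])
    fix T assume T: "finite T" "T \<subseteq> S"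
    then show "sum ?f T \<le> \<mu> (\<Union>s\<in>S. cylinder s)"
      unfolding measure_finite_cylinders[OF T(1) prefix_free_subset[OF assms T(2)], symmetric]
      by (intro cantor.finite_measure_mono sets.countable_UN') auto
  qed
  moreover have "\<mu> (\<Union>s\<in>S. cylinder s) \<le> infsum ?f S"
  proof (rule measure_UN_le)
    fix T assume T: "finite T" "T \<subseteq> S"
    show "\<mu> (\<Union>s\<in>T. cylinder s) \<le> infsum ?f S"
      unfolding measure_finite_cylinders[OF T(1) prefix_free_subset[OF assms T(2)]]
      by (rule finite_sum_le_infsum[OF sum T]) auto
  qed auto
  ultimately have "infsum ?f S = \<mu> (\<Union>s\<in>S. cylinder s)" by linarith
  then show ?thesis using has_sum_infsum[OF sum] by simp
qed

section \<open>Computably enumerable open sets\<close>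

text \<open>
  The generators only have to be c.e.; \<open>s\<close> is the witness that is searched for.
\<close>

lemma uniformly_ce_openI:
  fixes Q :: "(nat \<times> bool list) \<times> nat \<Rightarrow> bool"
  assumes "decidable F Q" "\<And>n. U n = {X. \<exists>m s. Q ((n, pre X m), s)}"
  shows "uniformly_ce_open F U"
proof -
  have "pcomputable F (\<lambda>x. if \<exists>s. Q (x, s) then Some ((\<lambda>_ _. 0::nat) x (LEAST s. Q (x, s))) else None)"
    by (rule pcomputable_search) (simp_all add: assms computable_intros)
  then obtain g where g: "partrec_in F 1 g"
    "\<And>x :: nat \<times> bool list. g [code x] = map_option code (if \<exists>s. Q (x, s) then Some (0::nat) else None)"
    unfolding pcomputable_def by blast
  have "total_rec F 2 (\<lambda>xs. prod_encode (xs ! 0, xs ! 1))" by (intro total_rec_prod_encode total_rec_proj) auto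
  then obtain u where u: "partrec_in F 2 u" "\<And>xs. length xs = 2 \<Longrightarrow> u xs = g [prod_encode (xs ! 0, xs ! 1)]"
    using partrec_comp_total_rec[of F "[\<lambda>xs. prod_encode (xs ! 0, xs ! 1)]" g 2] g(1) by auto
  have "u [n, str_code s] = None \<longleftrightarrow> \<not> (\<exists>t. Q ((n, s), t))" for n s
    using g(2)[of "(n, s)"] by (simp add: u code_prod_def)
  then have "U n = (\<Union>s\<in>{s. u [n, str_code s] \<noteq> None}. cylinder s)" for n
    unfolding assms(2) by (auto simp: cylinder_iff) metis
  with u(1) show ?thesis unfolding uniformly_ce_open_def by blast
qed

text \<open>
  A c.e. open set is generated by a decidable set of strings that is closed under extension:
  \<open>s\<close> belongs to it when a prefix of \<open>s\<close> has been enumerated by stage \<open>length s\<close>. Every member of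
  the open set has such an initial segment, because initial segments that are long enough leave
  enough time for the enumeration.
\<close>

lemma uniformly_ce_openE:
  assumes "uniformly_ce_open F U"
  obtains C :: "nat \<times> bool list \<Rightarrow> bool" where "decidable F C"
    "\<And>n s t. C (n, s) \<Longrightarrow> prefix s t \<Longrightarrow> C (n, t)" "\<And>n. U n = {X. \<exists>m. C (n, pre X m)}"
proof -
  obtain g where g: "partrec_in F 2 g" "\<And>n. U n = (\<Union>s\<in>{s. g [n, str_code s] \<noteq> None}. cylinder s)"
    using assms unfolding uniformly_ce_open_def by blast
  obtain T where T: "computable F T" "approximates T 2 g" using partrec_approximation[OF g(1)] by blast
  define G where "G p = T (fst p, code (fst (snd p), code (code (snd (snd p)), 0::nat)))" for p :: "nat \<times> nat \<times> bool list"
  have G: "computable F G" unfolding G_def by (intro computable_intros computable_comp[OF T(1)])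
  have Gmono: "G (s', x) \<noteq> 0" if "s \<le> s'" "G (s, x) \<noteq> 0" for s s' x
    using approximatesD(1)[OF T(2) that(1)] that(2) unfolding G_def fst_conv snd_conv by (metis not0_implies_Suc nat.distinct(1))
  have Gg: "g [n, str_code s] \<noteq> None \<longleftrightarrow> (\<exists>t. G (t, n, s) \<noteq> 0)" for n s
    using approximatesD(3)[OF T(2), of "[n, str_code s]"] by (simp add: G_def)
  define C where "C p \<longleftrightarrow> (\<exists>i<Suc (length (snd p)). 0 < G (length (snd p), fst p, take i (snd p)))" for p :: "nat \<times> bool list"
  have "decidable F C" unfolding C_def by (intro computable_intros computable_comp[OF G])
  moreover have mono: "C (n, t)" if C: "C (n, s)" and pre: "prefix s t" for n s t
  proof -
    obtain i where i: "i \<le> length s" "G (length s, n, take i s) \<noteq> 0" using C by (auto simp: C_def less_Suc_eq_le)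
    have "take i t = take i s" using i(1) pre by (auto simp: prefix_def)
    moreover have "length s \<le> length t" using pre by (rule prefix_length_le)
    ultimately show ?thesis using i Gmono[of "length s" "length t"]
      by (auto simp: C_def less_Suc_eq_le intro!: exI[of _ i])
  qed
  moreover have "U n = {X. \<exists>m. C (n, pre X m)}" for n
  proof (intro set_eqI iffI)
    fix X assume "X \<in> U n"
    then obtain s t where s: "pre X (length s) = s" "G (t, n, s) \<noteq> 0"
      unfolding g(2) using Gg by (auto simp: cylinder_iff)
    define m where "m = max (length s) t"
    have "take (length s) (pre X m) = s" using s(1) by (simp add: m_def take_pre)
    moreover have "G (m, n, s) \<noteq> 0" using Gmono[OF _ s(2)] by (simp add: m_def)
    ultimately have "C (n, pre X m)"
      unfolding C_def by (intro exI[of _ "length s"]) (simp add: m_def)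
    then show "X \<in> {X. \<exists>m. C (n, pre X m)}" by blast
  next
    fix X assume "X \<in> {X. \<exists>m. C (n, pre X m)}"
    then obtain m i where "i \<le> m" "G (m, n, take i (pre X m)) \<noteq> 0" by (auto simp: C_def less_Suc_eq_le)
    then have "g [n, str_code (pre X i)] \<noteq> None" using Gg[of n "pre X i"] by (auto simp: take_pre)
    then show "X \<in> U n" unfolding g(2) by (auto simp: cylinder_iff intro!: exI[of _ "pre X i"])
  qed
  ultimately show thesis using that by blast
qed

text \<open>
  The minimal strings of the set from \<open>uniformly_ce_openE\<close>. Minimality is decidable, because only
  finitely many prefixes have to be inspected.
\<close>

lemma ce_open_prefix_free:
  assumes "uniformly_ce_open F U"
  obtains D :: "nat \<times> bool list \<Rightarrow> bool" where "decidable F D" "\<And>n. prefix_free {s. D (n, s)}"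
    "\<And>n. U n = (\<Union>s\<in>{s. D (n, s)}. cylinder s)"
proof -
  obtain C :: "nat \<times> bool list \<Rightarrow> bool" where C: "decidable F C"
    and mono: "\<And>n s t. C (n, s) \<Longrightarrow> prefix s t \<Longrightarrow> C (n, t)" and U: "\<And>n. U n = {X. \<exists>m. C (n, pre X m)}"
    using uniformly_ce_openE[OF assms] by blast
  define D where "D p \<longleftrightarrow> C p \<and> (\<forall>i<length (snd p). \<not> C (fst p, take i (snd p)))" for p
  have "decidable F D" unfolding D_def by (intro computable_intros C decidable_comp[OF C])
  moreover have "prefix_free {s. D (n, s)}" for n
  proof -
    have "s = t" if "D (n, s)" "D (n, t)" and st: "prefix s t" for s t
    proof (rule ccontr)
      assume "s \<noteq> t"
      then have "length s < length t" using st by (auto simp: prefix_def)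
      moreover have "take (length s) t = s" using st by (auto simp: prefix_def)
      ultimately show False using that(1,2) unfolding D_def by auto
    qed
    then show ?thesis by (simp add: prefix_free_def)
  qed
  moreover have "U n = (\<Union>s\<in>{s. D (n, s)}. cylinder s)" for n
  proof (intro set_eqI iffI)
    fix X assume "X \<in> U n"
    then have ex: "\<exists>m. C (n, pre X m)" using U by blast
    define m where "m = (LEAST m. C (n, pre X m))"
    have "C (n, pre X m)" unfolding m_def using ex by (rule LeastI_ex)
    moreover have "\<not> C (n, pre X i)" if "i < m" for i
      using that unfolding m_def by (rule not_less_Least)
    ultimately have "D (n, pre X m)" by (simp add: D_def take_pre)
    then show "X \<in> (\<Union>s\<in>{s. D (n, s)}. cylinder s)" by (auto simp: cylinder_iff intro!: exI[of _ "pre X m"])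
  next
    fix X assume "X \<in> (\<Union>s\<in>{s. D (n, s)}. cylinder s)"
    then obtain s where "C (n, s)" "pre X (length s) = s" by (auto simp: D_def cylinder_iff)
    then show "X \<in> U n" unfolding U mem_Collect_eq by metis
  qed
  ultimately show thesis using that by blast
qed

section \<open>Tests, machines and incompressibility\<close>

lemma K_le_iff: "K M s \<le> enat k \<longleftrightarrow> (\<exists>p. M p = Some s \<and> length p \<le> k)"
proof
  assume *: "K M s \<le> enat k"
  let ?A = "(\<lambda>p. enat (length p)) ` {p. M p = Some s}"
  have "?A \<noteq> {}"
  proof
    assume "?A = {}"
    then show False using * by (simp add: K_def top_enat_def)
  qed
  then have "Inf ?A \<in> ?A" unfolding Inf_enat_def by (metis LeastI_ex all_not_in_conv)
  then show "\<exists>p. M p = Some s \<and> length p \<le> k" using * by (auto simp: K_def)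
next
  assume "\<exists>p. M p = Some s \<and> length p \<le> k"
  then obtain p where "M p = Some s" "length p \<le> k" by blast
  then show "K M s \<le> enat k" unfolding K_def by (intro INF_lower2[of p]) auto
qed

text \<open>
  The index \<open>2 * n + 2\<close> makes the requests for \<open>n\<close> weigh \<open>2^n * 2^-(2n+2) = 2^-n / 4\<close>, in total at
  most \<open>1/2\<close>, which is just what \<open>kraft_chaitin\<close> admits. It also ensures that a generator has
  length at least \<open>n\<close>, so that the subtraction \<open>length s - n\<close> is not truncated.
\<close>

lemma machine_of_test:
  assumes ce: "uniformly_ce_open F U" and meas: "\<And>n. \<mu> (U n) \<le> (1/2) ^ n"
  shows "\<exists>M. prefix_free_machine F M \<and>
    (\<forall>n. \<forall>X\<in>U (2 * n + 2). \<exists>m p. M p = Some (pre X m) \<and> length p + n = m) \<and>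
    ((\<forall>n. \<mu> (U n) = (1/2) ^ n) \<longrightarrow> (\<Sum>\<^sub>\<infinity>p\<in>dom M. (1/2) ^ length p) = (1/2 :: real))"
proof -
  obtain D :: "nat \<times> bool list \<Rightarrow> bool" where D: "decidable F D" "\<And>n. prefix_free {s. D (n, s)}"
    "\<And>n. U n = (\<Union>s\<in>{s. D (n, s)}. cylinder s)"
    using ce_open_prefix_free[OF ce] by blast
  define f where "f x = (if D (2 * fst x + 2, snd x) then Some (snd x) else None)" for x
  define len where "len x = length (snd x) - fst x" for x :: "nat \<times> bool list"
  have sum_D: "((\<lambda>s. (1/2) ^ length s) has_sum \<mu> (U n)) {s. D (n, s)}" for n
    unfolding D(3) by (rule has_sum_cylinders[OF D(2)])
  have long: "n \<le> length s" if "D (2 * n + 2, s)" for n s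
  proof -
    have "(1/2 :: real) ^ length s = \<mu> (cylinder s)" by (simp add: measure_cylinder)
    also have "\<dots> \<le> \<mu> (U (2 * n + 2))"
      unfolding D(3) by (rule cantor.finite_measure_mono) (use that in \<open>auto intro!: sets.countable_UN'\<close>)
    also have "\<dots> \<le> (1/2) ^ (2 * n + 2)" by (rule meas)
    finally have "2 * n + 2 \<le> length s" by (subst (asm) power_decreasing_iff) auto
    then show ?thesis by simp
  qed
  have dom_f: "dom f = Sigma UNIV (\<lambda>n. {s. D (2 * n + 2, s)})"
    by (auto simp: f_def split: if_splits)
  have weight: "(1/2 :: real) ^ len (n, s) = 2 ^ n * (1/2) ^ length s" if "(n, s) \<in> dom f" for n s
    using long[of n s] that by (simp add: dom_f len_def power_diff field_simps power_one_over)
  have inner: "((\<lambda>s. (1/2) ^ len (n, s)) has_sum 2 ^ n * \<mu> (U (2 * n + 2))) {s. D (2 * n + 2, s)}" for n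
  proof -
    have "((\<lambda>s. 2 ^ n * (1/2) ^ length s) has_sum 2 ^ n * \<mu> (U (2 * n + 2))) {s. D (2 * n + 2, s)}"
      by (rule has_sum_cmult_right[OF sum_D])
    then show ?thesis by (rule has_sum_cong[THEN iffD1, rotated]) (simp add: weight dom_f)
  qed
  have geo: "((\<lambda>n. (1/4) * (1/2) ^ n) has_sum (1/2 :: real)) UNIV"
  proof -
    have "(\<lambda>n. (1/4) * (1/2) ^ n :: real) sums ((1/4) * (1 / (1 - 1/2)))"
      by (intro sums_mult geometric_sums) simp
    then show ?thesis by (intro sums_nonneg_imp_has_sum) auto
  qed
  have quarter: "2 ^ n * (1/2) ^ (2 * n + 2) = (1/4) * (1/2 :: real) ^ n" for n
    by (simp add: power_add power_mult power_one_over power2_eq_square field_simps flip: power_mult_distrib)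
  have outer_sum: "(\<lambda>n. 2 ^ n * \<mu> (U (2 * n + 2))) summable_on UNIV"
    and outer_le: "(\<Sum>\<^sub>\<infinity>n. 2 ^ n * \<mu> (U (2 * n + 2))) \<le> 1/2"
  proof -
    have le: "2 ^ n * \<mu> (U (2 * n + 2)) \<le> (1/4) * (1/2) ^ n" for n
      unfolding quarter[symmetric] by (rule mult_left_mono[OF meas]) simp
    show 1: "(\<lambda>n. 2 ^ n * \<mu> (U (2 * n + 2))) summable_on UNIV"
      by (rule summable_on_comparison_test[OF has_sum_imp_summable[OF geo]]) (use le in auto)
    have "(\<Sum>\<^sub>\<infinity>n. 2 ^ n * \<mu> (U (2 * n + 2))) \<le> (\<Sum>\<^sub>\<infinity>n. (1/4) * (1/2) ^ n)"
      by (rule infsum_mono[OF 1 has_sum_imp_summable[OF geo] le])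
    then show "(\<Sum>\<^sub>\<infinity>n. 2 ^ n * \<mu> (U (2 * n + 2))) \<le> 1/2"
      by (simp only: infsumI[OF geo])
  qed
  have total: "((\<lambda>x. (1/2) ^ len x) has_sum (\<Sum>\<^sub>\<infinity>n. 2 ^ n * \<mu> (U (2 * n + 2)))) (dom f)"
    unfolding dom_f
  proof (rule has_sum_SigmaI)
    show "((\<lambda>n. 2 ^ n * \<mu> (U (2 * n + 2))) has_sum (\<Sum>\<^sub>\<infinity>n. 2 ^ n * \<mu> (U (2 * n + 2)))) UNIV"
      using outer_sum by (rule has_sum_infsum)
    show "(\<lambda>x. (1/2 :: real) ^ len x) summable_on (SIGMA n:UNIV. {s. D (2 * n + 2, s)})"
      by (rule summable_on_SigmaI[OF inner outer_sum]) simp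
  qed (rule inner)
  have kraft: "(\<Sum>x\<in>X. 2 * (1/2) ^ len x) \<le> (1 :: real)" if "finite X" "X \<subseteq> dom f" for X
  proof -
    have "(\<Sum>x\<in>X. (1/2) ^ len x) \<le> (\<Sum>\<^sub>\<infinity>x\<in>dom f. (1/2 :: real) ^ len x)"
      by (rule finite_sum_le_infsum[OF has_sum_imp_summable[OF total] that]) simp
    also have "\<dots> \<le> 1/2" using infsumI[OF total] outer_le by simp
    finally show ?thesis by (simp flip: sum_distrib_left)
  qed
  have "pcomputable F f"
  proof -
    have "pcomputable F (\<lambda>x. if \<exists>n::nat. D (2 * fst x + 2, snd x) then Some ((\<lambda>x n. snd x) x (LEAST n::nat. D (2 * fst x + 2, snd x))) else None)"
      by (rule pcomputable_search) (intro computable_intros decidable_comp[OF D(1)])+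
    then show ?thesis by (simp add: f_def[abs_def])
  qed
  moreover have "computable F len" unfolding len_def by (intro computable_intros)
  ultimately obtain M h where M: "prefix_free_machine F M" and h: "bij_betw h (dom f) (dom M)"
    "\<And>x. x \<in> dom f \<Longrightarrow> length (h x) = len x" "\<And>x. x \<in> dom f \<Longrightarrow> M (h x) = f x"
    using kraft_chaitin[of F f len, OF _ _ kraft] by blast
  have "\<exists>m p. M p = Some (pre X m) \<and> length p + n = m" if X: "X \<in> U (2 * n + 2)" for n X
  proof -
    obtain s where s: "D (2 * n + 2, s)" "pre X (length s) = s" using X by (auto simp: D(3) cylinder_iff)
    then have "(n, s) \<in> dom f" by (simp add: dom_f)
    then show ?thesis using h(2,3)[of "(n, s)"] s long[OF s(1)]
      by (intro exI[of _ "length s"] exI[of _ "h (n, s)"]) (simp add: f_def len_def)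
  qed
  moreover have "(\<Sum>\<^sub>\<infinity>p\<in>dom M. (1/2) ^ length p) = (1/2 :: real)" if "\<And>n. \<mu> (U n) = (1/2) ^ n"
  proof -
    have "(\<Sum>\<^sub>\<infinity>p\<in>dom M. (1/2 :: real) ^ length p) = (\<Sum>\<^sub>\<infinity>x\<in>dom f. (1/2) ^ length (h x))"
      by (rule infsum_reindex_bij_betw[OF h(1), symmetric])
    also have "\<dots> = (\<Sum>\<^sub>\<infinity>x\<in>dom f. (1/2) ^ len x)" by (rule infsum_cong) (simp add: h(2))
    also have "\<dots> = (\<Sum>\<^sub>\<infinity>n. 2 ^ n * \<mu> (U (2 * n + 2)))" by (rule infsumI[OF total])
    also have "\<dots> = 1/2" using infsumI[OF geo] by (simp add: that quarter[simplified])
    finally show ?thesis .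
  qed
  ultimately show ?thesis using M by blast
qed

definition deficiency_set :: "(bool list \<Rightarrow> bool list option) \<Rightarrow> nat \<Rightarrow> (nat \<Rightarrow> bool) set" where
  "deficiency_set M n = {X. \<exists>m p. M p = Some (pre X m) \<and> length p + n \<le> m}"

text \<open>
  A description \<open>p\<close> contributes at most the measure \<open>2^-n * 2^-|p|\<close>, and the weights \<open>2^-|p|\<close> add up
  to at most \<open>1\<close>.
\<close>

lemma measure_deficiency_set:
  assumes "prefix_free (dom M)" shows "\<mu> (deficiency_set M n) \<le> (1/2) ^ n"
proof -
  define I where "I = {p \<in> dom M. length p + n \<le> length (the (M p))}"
  have "deficiency_set M n = (\<Union>p\<in>I. cylinder (the (M p)))"
    unfolding deficiency_set_def I_def by (force simp: cylinder_iff)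
  also have "\<mu> \<dots> \<le> (1/2) ^ n"
  proof (rule measure_UN_le_infsum)
    fix J assume J: "finite J" "J \<subseteq> I"
    have "(\<Sum>p\<in>J. \<mu> (cylinder (the (M p)))) \<le> (\<Sum>p\<in>J. (1/2) ^ n * (1/2) ^ length p)"
    proof (rule sum_mono)
      fix p assume "p \<in> J"
      then have "length p + n \<le> length (the (M p))" using J by (auto simp: I_def)
      then have "(1/2 :: real) ^ length (the (M p)) \<le> (1/2) ^ (length p + n)" by (intro power_decreasing) auto
      then show "\<mu> (cylinder (the (M p))) \<le> (1/2) ^ n * (1/2) ^ length p"
        by (simp add: measure_cylinder power_add mult.commute)
    qed
    also have "\<dots> = (1/2) ^ n * (\<Sum>p\<in>J. (1/2) ^ length p)" by (simp add: sum_distrib_left)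
    also have "\<dots> \<le> (1/2) ^ n * 1"
      by (intro mult_left_mono kraft_inequality[OF assms J(1)]) (use J in \<open>auto simp: I_def\<close>)
    finally show "(\<Sum>p\<in>J. \<mu> (cylinder (the (M p)))) \<le> (1/2) ^ n" by simp
  qed auto
  finally show ?thesis .
qed

lemma martin_lof_test_deficiency:
  assumes "prefix_free_machine {} M" shows "martin_lof_test (deficiency_set M)"
proof -
  have pf: "prefix_free (dom M)" and "pcomputable {} M"
    using assms by (auto simp: prefix_free_machine_def partial_computable_iff_pcomputable)
  then obtain G where G: "computable {} G" "stages G M" using ex_stages by blast
  define Q where "Q x \<longleftrightarrow> G (decode (snd x)) = Suc (code (snd (fst x))) \<and>
    length (snd (decode (snd x) :: nat \<times> bool list)) + fst (fst x) \<le> length (snd (fst x))"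
    for x :: "(nat \<times> bool list) \<times> nat"
  have "uniformly_ce_open {} (deficiency_set M)"
  proof (rule uniformly_ce_openI)
    show "decidable {} Q" unfolding Q_def by (intro computable_intros computable_comp[OF G(1)])
    show "deficiency_set M n = {X. \<exists>m s. Q ((n, pre X m), s)}" for n
    proof -
      have "(\<exists>s. Q ((n, t), s)) \<longleftrightarrow> (\<exists>p. M p = Some t \<and> length p + n \<le> length t)" for t
      proof
        assume "\<exists>s. Q ((n, t), s)"
        then obtain s where s: "Q ((n, t), s)" ..
        obtain u p where "(decode s :: nat \<times> bool list) = (u, p)" by (cases "decode s :: nat \<times> bool list")
        then show "\<exists>p. M p = Some t \<and> length p + n \<le> length t"
          using s stagesD(2)[OF G(2)] by (auto simp: Q_def)
      next
        assume "\<exists>p. M p = Some t \<and> length p + n \<le> length t"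
        then obtain p u where "length p + n \<le> length t" "G (u, p) = Suc (code t)"
          using stagesD(2)[OF G(2)] by blast
        then show "\<exists>s. Q ((n, t), s)" by (intro exI[of _ "code (u, p)"]) (simp add: Q_def)
      qed
      then show ?thesis by (simp add: deficiency_set_def)
    qed
  qed
  moreover have "decseq (deficiency_set M)"
    by (rule decseq_SucI) (auto simp: deficiency_set_def intro: Suc_leD)
  ultimately show ?thesis
    using measure_deficiency_set[OF pf] by (simp add: martin_lof_test_def)
qed

lemma compressible_not_MLR:
  assumes "prefix_free_machine {} M" "X \<in> (\<Inter>n. deficiency_set M n)" shows "X \<notin> MLR"
  using martin_lof_test_deficiency[OF assms(1)] assms(2) unfolding MLR_def by blast

text \<open>
  A Martin-Loef test that captures \<open>X\<close> yields a machine by \<open>machine_of_test\<close>. It compresses initial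
  segments of \<open>X\<close> by any number of bits, in particular by \<open>n\<close> more than the constant lost in passing
  to the optimal machine.
\<close>

lemma incompressible_MLR:
  assumes opt: "optimal_prefix_free_machine Mopt" and X: "X \<notin> deficiency_set Mopt n"
  shows "X \<in> MLR"
proof (rule ccontr)
  assume "X \<notin> MLR"
  then obtain U where U: "martin_lof_test U" "X \<in> (\<Inter>n. U n)" unfolding MLR_def by blast
  then obtain M where M: "prefix_free_machine {} M"
    "\<And>n X. X \<in> U (2 * n + 2) \<Longrightarrow> \<exists>m p. M p = Some (pre X m) \<and> length p + n = m"
    using machine_of_test[of "{}" U] unfolding martin_lof_test_def by blast
  obtain c :: nat where c: "\<And>s. K Mopt s \<le> K M s + enat c"
    using opt M(1) unfolding optimal_prefix_free_machine_def by blast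
  obtain m p where p: "M p = Some (pre X m)" "length p + (n + c) = m"
    using M(2)[of X "n + c"] U(2) by blast
  have "K M (pre X m) \<le> enat (length p)" unfolding K_le_iff using p(1) by blast
  then have "K Mopt (pre X m) \<le> enat (length p + c)"
    using c[of "pre X m"] by (metis add_right_mono order_trans plus_enat_simps(1))
  then obtain q where "Mopt q = Some (pre X m)" "length q \<le> length p + c" unfolding K_le_iff by blast
  then have "X \<in> deficiency_set Mopt n"
    using p(2) unfolding deficiency_set_def by (intro CollectI exI[of _ m] exI[of _ q]) auto
  with X show False by blast
qed

lemma computable_fun_iff_computable: "computable_fun F f \<longleftrightarrow> computable F f"
proof
  assume "computable_fun F f"
  then obtain g where g: "partrec_in F 1 g" "\<And>n. g [n] = Some (f n)" by (auto simp: computable_fun_def)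
  have "g xs = Some (f (xs ! 0))" if "length xs = 1" for xs using that g(2) by (cases xs) auto
  with g(1) show "computable F f" by (auto simp: computable_def total_rec_def)
next
  assume "computable F f"
  then obtain g where g: "partrec_in F 1 g" "\<And>xs. length xs = 1 \<Longrightarrow> g xs = Some (f (xs ! 0))"
    by (auto simp: computable_def total_rec_def)
  then have "g [n] = Some (f n)" for n by simp
  with g(1) show "computable_fun F f" unfolding computable_fun_def by blast
qed

text \<open>
  For a Schnorr test the machine from \<open>machine_of_test\<close> has the computable measure \<open>1/2\<close>, so the
  hypothesis applies to it.
\<close>

lemma Low_MLR_SR_if_complexity_bound:
  assumes opt: "optimal_prefix_free_machine Mopt"
    and bound: "\<And>M. computable_measure_machine (oracle_of A) M \<Longrightarrow> \<exists>c::nat. \<forall>s. K Mopt s \<le> K M s + enat c"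
  shows "A \<in> Low_MLR_SR"
proof -
  have "X \<in> SR A" if "X \<in> MLR" for X
  proof (rule ccontr)
    assume "X \<notin> SR A"
    then obtain U where U: "schnorr_test A U" "X \<in> (\<Inter>n. U n)" unfolding SR_def by blast
    then have ce: "uniformly_ce_open (oracle_of A) U" and meas: "\<And>n. \<mu> (U n) = (1/2) ^ n"
      by (auto simp: schnorr_test_def)
    obtain M where M: "prefix_free_machine (oracle_of A) M"
      "\<And>n X. X \<in> U (2 * n + 2) \<Longrightarrow> \<exists>m p. M p = Some (pre X m) \<and> length p + n = m"
      and half: "(\<Sum>\<^sub>\<infinity>p\<in>dom M. (1/2) ^ length p) = (1/2 :: real)"
      using machine_of_test[OF ce] meas by (metis order_refl)
    have "computable_real (oracle_of A) (1/2)"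
      unfolding computable_real_def computable_fun_iff_computable
      by (rule exI[of _ "\<lambda>_. 1"], rule exI[of _ "\<lambda>_. 0"], rule exI[of _ "\<lambda>_. 1"]) (simp add: computable_const)
    then have "computable_measure_machine (oracle_of A) M"
      using M(1) unfolding computable_measure_machine_def half by simp
    then obtain c :: nat where c: "\<And>s. K Mopt s \<le> K M s + enat c" using bound by blast
    have "X \<in> deficiency_set Mopt n" for n
    proof -
      obtain m p where p: "M p = Some (pre X m)" "length p + (n + c) = m"
        using M(2)[of X "n + c"] U(2) by blast
      have "K M (pre X m) \<le> enat (length p)" unfolding K_le_iff using p(1) by blast
      then have "K Mopt (pre X m) \<le> enat (length p + c)"
        using c[of "pre X m"] by (metis add_right_mono order_trans plus_enat_simps(1))
      then obtain q where "Mopt q = Some (pre X m)" "length q \<le> length p + c" unfolding K_le_iff by blast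
      then show ?thesis
        using p(2) unfolding deficiency_set_def by (intro CollectI exI[of _ m] exI[of _ q]) auto
    qed
    then have "X \<notin> MLR"
      using opt by (intro compressible_not_MLR) (auto simp: optimal_prefix_free_machine_def)
    with that show False by blast
  qed
  then show ?thesis by (auto simp: Low_MLR_SR_def)
qed


section \<open>Padding a test to exact measure\<close>

text \<open>
  By \<open>measure_prefix_property\<close>, counting strings of a fixed length computes the measures of clopen
  sets.
\<close>

lemma card_strings: "card {r. length r = n \<and> P r} = (\<Sum>w<2 ^ n. of_bool (P (string_of_val n w)))"
proof -
  have "bij_betw (string_of_val n) {w. w < 2 ^ n \<and> P (string_of_val n w)} {r. length r = n \<and> P r}"
    by (rule bij_betw_byWitness[where f' = val]) (auto simp: val_string_of_val string_of_val_val val_less)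
  then have "card {r. length r = n \<and> P r} = card {w. w < 2 ^ n \<and> P (string_of_val n w)}"
    by (simp add: bij_betw_same_card)
  also have "\<dots> = (\<Sum>w<2 ^ n. of_bool (P (string_of_val n w)))"
    by (simp add: of_bool_def sum.If_cases Collect_conj_eq lessThan_def)
  finally show ?thesis .
qed

lemma computable_card_strings [computable_intros]:
  fixes P :: "'a::enc \<Rightarrow> bool list \<Rightarrow> bool"
  assumes "decidable F (\<lambda>p. P (fst p) (snd p))" "computable F n"
  shows "computable F (\<lambda>x. card {r. length r = n x \<and> P x r})"
proof -
  have "computable F (\<lambda>p. string_of_val (n (fst p)) (snd p))" by (intro computable_intros computable_comp[OF assms(2)])
  from decidable_comp[OF assms(1) computable_Pair[OF computable_fst[OF computable_id] this]] have "decidable F (\<lambda>p. P (fst p) (string_of_val (n (fst p)) (snd p)))" by simp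
  then show ?thesis unfolding card_strings by (intro computable_intros assms)
qed

text \<open>
  Under binary expansion these are the intervals with left end \<open>0\<close> and right end
  \<open>(val t + 1) / 2^n\<close>, where \<open>n\<close> is the length of \<open>t\<close>. They form a chain that grows in steps of
  measure \<open>2^-n\<close>.
\<close>

definition left_of :: "bool list \<Rightarrow> (nat \<Rightarrow> bool) set" where
  "left_of t = {X. val (pre X (length t)) \<le> val t}"

text \<open>
  The intervals of two initial segments of \<open>X\<close> are nested, so the left end of one lies before the
  right end of the other.
\<close>

lemma val_pre_less: "real (val (pre X m)) / 2 ^ m < (real (val (pre X n)) + 1) / 2 ^ n"
proof (cases "m \<le> n")
  case True
  then have "real (val (pre X m)) / 2 ^ m \<le> real (val (pre X n)) / 2 ^ n"
    using val_prefix_interval(1)[OF prefix_pre] by (metis length_pre)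
  also have "\<dots> < (real (val (pre X n)) + 1) / 2 ^ n" by (simp add: divide_strict_right_mono)
  finally show ?thesis .
next
  case False
  then show ?thesis using val_prefix_interval(2)[OF prefix_pre, of n m X] by simp
qed

lemma left_of_mono:
  assumes "(real (val s) + 1) / 2 ^ length s \<le> (real (val t) + 1) / 2 ^ length t"
  shows "left_of s \<subseteq> left_of t"
proof
  fix X assume "X \<in> left_of s"
  then have "real (val (pre X (length s))) \<le> real (val s)" by (simp add: left_of_def)
  then have "(real (val (pre X (length s))) + 1) / 2 ^ length s \<le> (real (val t) + 1) / 2 ^ length t"
    by (intro order_trans[OF _ assms] divide_right_mono) auto
  with val_pre_less[of X "length t" "length s"]
  have "real (val (pre X (length t))) / 2 ^ length t < (real (val t) + 1) / 2 ^ length t" by linarith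
  then have "real (val (pre X (length t))) < real (val t) + 1" by (simp add: divide_less_cancel)
  then show "X \<in> left_of t" by (simp add: left_of_def)
qed

lemma left_of_chain: "left_of s \<subseteq> left_of t \<or> left_of t \<subseteq> left_of s"
  using left_of_mono[of s t] left_of_mono[of t s] by linarith

lemma left_of_prefix:
  assumes "prefix s t" shows "left_of t \<subseteq> left_of s"
proof (rule left_of_mono)
  obtain u where u: "t = s @ u" using assms by (auto simp: prefix_def)
  have "real (val u) + 1 \<le> 2 ^ length u" using val_less[of u]
    by (metis Suc_leI of_nat_Suc of_nat_le_iff of_nat_numeral of_nat_power add.commute)
  then have "2 ^ length s * (real (val u) + 1) \<le> 2 ^ length s * 2 ^ length u"
    by (intro mult_left_mono) auto
  then show "(real (val t) + 1) / 2 ^ length t \<le> (real (val s) + 1) / 2 ^ length s"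
    by (simp add: u val_append power_add field_simps)
qed

lemma sets_left_of [measurable, simp]: "left_of t \<in> sets cantor_measure"
  unfolding left_of_def by (rule sets_prefix_property)

lemma finite_chain_Union:
  assumes "finite J" "J \<noteq> {}" shows "\<exists>t\<in>J. (\<Union>s\<in>J. left_of s) = left_of t"
  using assms
proof (induction J rule: finite_ne_induct)
  case (insert s J)
  then obtain t where t: "t \<in> J" "(\<Union>s\<in>J. left_of s) = left_of t" by blast
  then show ?case using left_of_chain[of s t] by (auto simp: Un_absorb1 Un_absorb2)
qed simp

text \<open>
  The open set \<open>U n\<close> is enlarged by the sets \<open>left_of t\<close> for which an upper estimate of the measure
  of the union, namely the measure at stage \<open>length t\<close> plus the error bound, is below \<open>2^-n\<close>. Since
  these sets form a chain, the result still has measure at most \<open>2^-n\<close>. Since the chain grows in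
  small steps and the error tends to \<open>0\<close>, it has measure at least \<open>2^-n\<close>.
  
  The padded sets decrease: if \<open>left_of t\<close> is admitted at \<open>Suc n\<close>, then its union with \<open>U (Suc n)\<close>
  has measure less than half of \<open>2^-n\<close>, and \<open>U n\<close> has measure at most half of \<open>2^-n\<close>. So the union
  of \<open>left_of t\<close> and \<open>U n\<close> has measure less than \<open>2^-n\<close>, and every member of \<open>left_of t\<close> is
  admitted at \<open>n\<close> at a stage where the error is below the difference.
\<close>

lemma schnorr_test_padding:
  fixes C :: "nat \<times> bool list \<Rightarrow> bool" and err :: "nat \<Rightarrow> real"
  defines "U n \<equiv> {X. \<exists>m. C (n, pre X m)}"
  assumes C: "decidable (oracle_of A) C" and mono: "\<And>n s t. C (n, s) \<Longrightarrow> prefix s t \<Longrightarrow> C (n, t)"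
    and err: "rat_computable (oracle_of A) err" and lim: "err \<longlonglongrightarrow> 0"
    and approx: "\<And>n s. \<mu> (U n) \<le> \<mu> {X. C (n, pre X s)} + err s"
    and decr: "\<And>n. U (Suc n) \<subseteq> U n" and small: "\<And>n. \<mu> (U n) \<le> (1/2) ^ Suc n"
  shows "\<exists>U'. schnorr_test A U' \<and> (\<forall>n. U n \<subseteq> U' n)"
proof -
  define E where "E n t = {X. C (n, pre X (length t)) \<or> X \<in> left_of t}" for n t
  define Q where "Q p \<longleftrightarrow> real (card {r. length r = length (snd p) \<and> (C (fst p, r) \<or> val r \<le> val (snd p))}) * (1/2) ^ length (snd p)
      + err (length (snd p)) < (1/2) ^ fst p" for p
  define U' where "U' n = {X. \<exists>m. C (n, pre X m) \<or> Q (n, pre X m)}" for n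
  have card: "real (card {r. length r = length t \<and> (C (n, r) \<or> val r \<le> val t)}) * (1/2) ^ length t = \<mu> (E n t)" for n t
    unfolding E_def left_of_def mem_Collect_eq
    by (simp add: measure_prefix_property[of "\<lambda>r. C (n, r) \<or> val r \<le> val t"] power_one_over)
  have Q: "Q (n, t) \<longleftrightarrow> \<mu> (E n t) + err (length t) < (1/2) ^ n" for n t
    unfolding Q_def fst_conv snd_conv card ..
  have sU: "U n \<in> sets cantor_measure" for n unfolding U_def by (rule sets_ex_prefix)
  have sC: "{X. C (n, pre X s)} \<in> sets cantor_measure" for n s
    by (rule sets_prefix_property)
  have sE: "E n t \<in> sets cantor_measure" for n t
  proof -
    have "E n t = {X. C (n, pre X (length t))} \<union> left_of t" by (auto simp: E_def)
    then show ?thesis using sC by simp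
  qed
  have CU: "{X. C (n, pre X s)} \<subseteq> U n" for n s by (auto simp: U_def)

  have err_nonneg: "0 \<le> err s" for s
    using cantor.finite_measure_mono[OF CU[of 0 s] sU] approx[of 0 s] by linarith
  have cover: "\<mu> (U n \<union> left_of t) \<le> \<mu> (E n t) + err (length t)" for n t
  proof -
    let ?D = "{X. C (n, pre X (length t))}"
    have "\<mu> (U n \<union> left_of t) \<le> \<mu> (E n t \<union> (U n - ?D))"
      using sE sU sC by (intro cantor.finite_measure_mono) (auto simp: E_def)
    also have "\<dots> \<le> \<mu> (E n t) + \<mu> (U n - ?D)"
      using sE sU sC by (intro measure_Un_le) auto
    also have "\<mu> (U n - ?D) = \<mu> (U n) - \<mu> ?D"
      using sU sC CU by (intro cantor.finite_measure_Diff) auto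
    finally show ?thesis using approx[of n "length t"] by linarith
  qed
  have E_sub: "E n t \<subseteq> U n \<union> left_of t" for n t by (auto simp: E_def U_def)
  have pre_left: "X \<in> left_of (pre X m)" for X m by (simp add: left_of_def)
  have Q_down: "Q (n, pre X (length t))" if "Q (n, t)" "X \<in> left_of t" for n t X
  proof -
    have "left_of (pre X (length t)) \<subseteq> left_of t"
      using that(2) by (auto simp: left_of_def)
    then have "\<mu> (E n (pre X (length t))) \<le> \<mu> (E n t)"
      by (intro cantor.finite_measure_mono sE) (auto simp: E_def)
    then show ?thesis using that(1) unfolding Q by simp
  qed
  have U'_eq: "U' n = U n \<union> (\<Union>t\<in>{t. Q (n, t)}. left_of t)" for n
    unfolding U'_def U_def using Q_down pre_left by blast
  have sU': "U' n \<in> sets cantor_measure" for n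
    unfolding U'_def by (rule sets_ex_prefix[of "\<lambda>m s. C (n, s) \<or> Q (n, s)"])
  have upper: "\<mu> (U' n) \<le> (1/2) ^ n" for n
  proof (cases "{t. Q (n, t)} = {}")
    case True
    then have "U' n = U n" unfolding U'_eq by simp
    also have "\<mu> (U n) \<le> (1/2) ^ Suc n" by (rule small)
    also have "\<dots> \<le> (1/2 :: real) ^ n" by simp
    finally show ?thesis .
  next
    case False
    then have "U' n = (\<Union>t\<in>{t. Q (n, t)}. U n \<union> left_of t)" unfolding U'_eq by blast
    also have "\<mu> \<dots> \<le> (1/2) ^ n"
    proof (rule measure_UN_le)
      fix J assume J: "finite J" "J \<subseteq> {t. Q (n, t)}"
      show "\<mu> (\<Union>t\<in>J. U n \<union> left_of t) \<le> (1/2) ^ n"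
      proof (cases "J = {}")
        case False
        then obtain t where t: "t \<in> J" "(\<Union>s\<in>J. left_of s) = left_of t"
          using finite_chain_Union[OF J(1)] by blast
        then have "(\<Union>t\<in>J. U n \<union> left_of t) = U n \<union> left_of t" using False by blast
        then show ?thesis using cover[of n t] J(2) t(1) Q[of n t] by auto
      qed simp
    qed (use sU in auto)
    finally show ?thesis .
  qed
  have lower: "(1/2) ^ n \<le> \<mu> (U' n)" for n
  proof -
    \<comment> \<open>At each stage \<open>s\<close> the first string \<open>v\<close> that is not admitted overshoots by at most one
      cylinder and the error.\<close>
    have step: "(1/2) ^ n \<le> \<mu> (U' n) + ((1/2) ^ s + err s)" for s
    proof -
      define bad where "bad v \<longleftrightarrow> v < 2 ^ s \<and> \<not> Q (n, string_of_val s v)" for v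
      have "bad (2 ^ s - 1)"
      proof -
        have "E n (string_of_val s (2 ^ s - 1)) = UNIV"
          using val_less by (auto simp: E_def left_of_def val_string_of_val less_Suc_eq_le[symmetric]) (metis length_pre)
        moreover have "(1/2 :: real) ^ n \<le> 1" by (simp add: power_le_one)
        ultimately have "\<not> Q (n, string_of_val s (2 ^ s - 1))"
          using err_nonneg[of s] cantor.prob_space unfolding Q by simp
        then show ?thesis by (simp add: bad_def)
      qed
      define v where "v = (LEAST v. bad v)"
      have v: "bad v" unfolding v_def using \<open>bad (2 ^ s - 1)\<close> by (rule LeastI)
      let ?t = "string_of_val s v"
      have val_t: "val ?t = v" using v by (simp add: bad_def val_string_of_val)
      have good: "Q (n, r)" if "length r = s" "val r < v" for r
        using not_less_Least[OF that(2)[unfolded v_def]] that(1) val_less[of r] string_of_val_val[of r]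
        by (auto simp: bad_def)
      have "E n ?t \<subseteq> U' n \<union> cylinder ?t"
      proof
        fix X assume X: "X \<in> E n ?t"
        show "X \<in> U' n \<union> cylinder ?t"
        proof (cases "C (n, pre X s) \<or> val (pre X s) < v")
          case True
          then show ?thesis using good[of "pre X s"] by (auto simp: U'_def)
        next
          case False
          then have "val (pre X s) = v" using X by (auto simp: E_def left_of_def val_t)
          then have "pre X s = ?t" by (intro val_inj) (simp_all add: val_t)
          then show ?thesis by (simp add: cylinder_iff)
        qed
      qed
      then have "\<mu> (E n ?t) \<le> \<mu> (U' n \<union> cylinder ?t)"
        using sU' by (intro cantor.finite_measure_mono) auto
      also have "\<dots> \<le> \<mu> (U' n) + \<mu> (cylinder ?t)"
        using sU' by (intro measure_Un_le) auto
      finally have "\<mu> (E n ?t) \<le> \<mu> (U' n) + (1/2) ^ s" by (simp add: measure_cylinder)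
      moreover have "(1/2) ^ n \<le> \<mu> (E n ?t) + err s" using v Q[of n ?t] by (simp add: bad_def)
      ultimately show ?thesis by linarith
    qed
    have "(\<lambda>s. \<mu> (U' n) + ((1/2) ^ s + err s)) \<longlonglongrightarrow> \<mu> (U' n) + (0 + 0)"
      by (intro tendsto_intros lim LIMSEQ_power_zero) simp
    then have "(1/2) ^ n \<le> \<mu> (U' n) + (0 + 0)"
      by (rule LIMSEQ_le_const) (use step in blast)
    then show ?thesis by simp
  qed
  have "U' (Suc n) \<subseteq> U' n" for n
  proof
    fix X assume X: "X \<in> U' (Suc n)"
    show "X \<in> U' n"
    proof (cases "X \<in> U (Suc n)")
      case True
      then show ?thesis using decr[of n] unfolding U'_eq by blast
    next
      case False
      then obtain m where m: "Q (Suc n, pre X m)" using X by (auto simp: U'_def U_def)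
      have "\<mu> (U n \<union> left_of (pre X m)) \<le> \<mu> (U (Suc n) \<union> left_of (pre X m)) + \<mu> (U n)"
        by (rule order_trans[OF cantor.finite_measure_mono measure_Un_le])
           (use sU in auto)
      also have "\<dots> \<le> (\<mu> (E (Suc n) (pre X m)) + err m) + (1/2) ^ Suc n"
        using cover[of "Suc n" "pre X m"] small[of n] by simp
      also have "\<dots> < (1/2) ^ Suc n + (1/2) ^ Suc n"
        using m[unfolded Q] by simp
      finally have gap: "0 < (1/2) ^ n - \<mu> (U n \<union> left_of (pre X m))" by simp
      have "eventually (\<lambda>s. err s < (1/2) ^ n - \<mu> (U n \<union> left_of (pre X m))) sequentially"
        using lim gap by (rule order_tendstoD(2))
      then have "eventually (\<lambda>s. m \<le> s \<and> err s < (1/2) ^ n - \<mu> (U n \<union> left_of (pre X m))) sequentially"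
        by (intro eventually_conj eventually_ge_at_top)
      then obtain s where s: "m \<le> s" "err s < (1/2) ^ n - \<mu> (U n \<union> left_of (pre X m))"
        unfolding eventually_sequentially by blast
      have "left_of (pre X s) \<subseteq> left_of (pre X m)" by (rule left_of_prefix[OF prefix_pre[OF s(1)]])
      then have "\<mu> (E n (pre X s)) \<le> \<mu> (U n \<union> left_of (pre X m))"
        using E_sub[of n "pre X s"] sU by (intro cantor.finite_measure_mono) auto
      then have "Q (n, pre X s)" unfolding Q using s(2) by simp
      then show ?thesis by (auto simp: U'_def)
    qed
  qed
  then have "decseq U'" by (rule decseq_SucI)
  moreover have "uniformly_ce_open (oracle_of A) U'"
  proof (rule uniformly_ce_openI)
    have decQ: "decidable (oracle_of A) Q" unfolding Q_def
      by (intro computable_intros rat_computable_comp[OF err] decidable_comp[OF C])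
    show "decidable (oracle_of A) (\<lambda>x::(nat \<times> bool list) \<times> nat. C (fst x) \<or> Q (fst x))"
      by (intro computable_intros decidable_comp[OF C] decidable_comp[OF decQ])
  qed (simp add: U'_def)
  ultimately have "schnorr_test A U'"
    unfolding schnorr_test_def using upper lower by (simp add: order_antisym)
  moreover have "U n \<subseteq> U' n" for n unfolding U'_eq by blast
  ultimately show ?thesis by blast
qed

section \<open>Independent blocks\<close>

text \<open>
  The coordinates of \<open>(s, k)\<close> are the \<open>k\<close> consecutive ones from \<open>c^2\<close> on, where \<open>c = code (s, k)\<close>.
  As \<open>k \<le> c\<close>, they lie below \<open>(c + 1)^2\<close>, so different pairs have disjoint sets of coordinates.
\<close>

definition block_start :: "bool list \<times> nat \<Rightarrow> nat" where
  "block_start x = code x * code x"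

definition block :: "bool list \<times> nat \<Rightarrow> (nat \<Rightarrow> bool) set" where
  "block x = {X. \<forall>i\<in>{block_start x..<block_start x + snd x}. X i = True}"

text \<open>
  The string \<open>r\<close> has an extension in the block: coordinates beyond the end of \<open>r\<close> impose nothing.
\<close>

definition meets :: "bool list \<Rightarrow> bool list \<times> nat \<Rightarrow> bool" where
  "meets r x \<longleftrightarrow> (\<forall>i<snd x. block_start x + i < length r \<longrightarrow> bit_at r (block_start x + i))"

lemma block_disjoint:
  assumes "x \<noteq> y"
  shows "{block_start x..<block_start x + snd x} \<inter> {block_start y..<block_start y + snd y} = {}"
proof -
  have less: "block_start x + snd x \<le> block_start y" if "code x < code y" for x y :: "bool list \<times> nat"
  proof -
    have "snd x \<le> code x" unfolding code_prod_def code_nat_def by (rule le_prod_encode_2)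
    then have "block_start x + snd x \<le> code x * (code x + 1)" by (simp add: block_start_def)
    also have "\<dots> \<le> code y * code y" using that by (intro mult_le_mono) auto
    finally show ?thesis by (simp add: block_start_def)
  qed
  have "code x \<noteq> code y" using assms by simp
  then consider "code x < code y" | "code y < code x" by linarith
  then show ?thesis
  proof cases
    case 1 then show ?thesis using less[OF 1] by auto
  next
    case 2 then show ?thesis using less[OF 2] by auto
  qed
qed

lemma sets_block [measurable, simp]: "block x \<in> sets cantor_measure"
  unfolding block_def by (rule sets_coordinates) simp

lemma measure_block: "\<mu> (block x) = (1/2) ^ snd x"
  unfolding block_def by (subst measure_coordinates) auto

lemma measure_block_Int:
  assumes "x \<noteq> y" shows "\<mu> (block x \<inter> block y) = (1/2) ^ snd x * (1/2) ^ snd y"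
proof -
  let ?I = "\<lambda>x. {block_start x..<block_start x + snd x}"
  have "block x \<inter> block y = {X. \<forall>i\<in>?I x \<union> ?I y. X i = True}" by (auto simp: block_def)
  then have "\<mu> (block x \<inter> block y) = (1/2) ^ card (?I x \<union> ?I y)"
    using measure_coordinates[of "?I x \<union> ?I y" "\<lambda>_. True"] by simp
  also have "card (?I x \<union> ?I y) = snd x + snd y"
    using card_Un_disjoint[OF _ _ block_disjoint[OF assms]] by simp
  finally show ?thesis by (simp add: power_add)
qed

lemma decidable_meets [computable_intros]: 
  assumes "computable F r" "computable F x" shows "decidable F (\<lambda>z. meets (r z) (x z))"
  unfolding meets_def block_start_def
  by (intro computable_intros assms computable_comp[OF assms(1)] computable_comp[OF assms(2)])

lemma block_meets: "X \<in> block x \<Longrightarrow> meets (pre X m) x"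
  by (auto simp: block_def meets_def bit_at_def pre_def)

lemma meets_block: "meets (pre X m) x \<Longrightarrow> block_start x + snd x \<le> m \<Longrightarrow> X \<in> block x"
proof -
  assume m: "meets (pre X m) x" "block_start x + snd x \<le> m"
  have "X i" if "block_start x \<le> i" "i < block_start x + snd x" for i
    using m(1)[unfolded meets_def, rule_format, of "i - block_start x"] m(2) that
    by (simp add: bit_at_def pre_def)
  then show "X \<in> block x" by (simp add: block_def)
qed

lemma meets_prefix: "meets t x \<Longrightarrow> prefix s t \<Longrightarrow> meets s x"
  by (auto simp: meets_def bit_at_def prefix_def nth_append)

lemma meets_extend:
  "meets s x \<Longrightarrow> prefix s t \<Longrightarrow> block_start x + snd x \<le> length s \<Longrightarrow> meets t x"
  by (auto simp: meets_def bit_at_def prefix_def nth_append)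

text \<open>
  Let \<open>f X\<close> be the number of blocks of \<open>J\<close> that contain \<open>X\<close>, and \<open>m\<close> its mean. The blocks are
  pairwise independent, so the variance of \<open>f\<close> is at most \<open>m\<close>. On \<open>P\<close>, however, the integral of
  \<open>m - f\<close> is at least \<open>(\<mu> P - \<epsilon>) * m\<close>. By the inequality of Cauchy and Schwarz the square of this
  number is at most the variance, so \<open>m\<close> cannot be large.
\<close>

lemma block_second_moment:
  assumes J: "finite J" and P: "P \<in> sets cantor_measure" and eps: "\<epsilon> < \<mu> P"
    and le: "\<And>x. x \<in> J \<Longrightarrow> \<mu> (block x \<inter> P) \<le> \<epsilon> * (1/2) ^ snd x"
  shows "(\<mu> P - \<epsilon>)\<^sup>2 * (\<Sum>x\<in>J. (1/2) ^ snd x) \<le> 1"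
proof -
  define m where "m = (\<Sum>x\<in>J. (1/2 :: real) ^ snd x)"
  define d where "d = \<mu> P - \<epsilon>"
  \<comment> \<open>The Cauchy-Schwarz inequality for \<open>indicator P\<close> and \<open>m - f\<close> comes from integrating the square
    of \<open>l * indicator P - (m - f)\<close>; this factor \<open>l\<close> gives the bound.\<close>
  define l where "l = d * m"
  let ?i = "\<lambda>B. indicator B :: _ \<Rightarrow> real"
  have m0: "0 \<le> m" unfolding m_def by (rule sum_nonneg) simp
  have d0: "0 < d" using eps by (simp add: d_def)
  have expand: "(l * ?i P X - m + (\<Sum>x\<in>J. ?i (block x) X))\<^sup>2 =
      l\<^sup>2 * ?i P X + m\<^sup>2 + (\<Sum>x\<in>J. \<Sum>y\<in>J. ?i (block x \<inter> block y) X) - 2 * l * m * ?i P X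
      + 2 * l * (\<Sum>x\<in>J. ?i (block x \<inter> P) X) - 2 * m * (\<Sum>x\<in>J. ?i (block x) X)" for X
  proof -
    have sq: "(\<Sum>x\<in>J. ?i (block x) X)\<^sup>2 = (\<Sum>x\<in>J. \<Sum>y\<in>J. ?i (block x \<inter> block y) X)"
      by (simp add: power2_eq_square sum_product indicator_inter_arith)
    have "(\<Sum>x\<in>J. ?i (block x \<inter> P) X) = ?i P X * (\<Sum>x\<in>J. ?i (block x) X)"
      by (simp add: sum_distrib_left indicator_inter_arith mult.commute)
    moreover have "(?i P X)\<^sup>2 = ?i P X" by (cases "X \<in> P") simp_all
    ultimately show ?thesis unfolding sq[symmetric] by (simp add: power2_eq_square algebra_simps)
  qed
  have int: "integrable cantor_measure (?i B)" if "B \<in> sets cantor_measure" for B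
    using that by (intro integrable_real_indicator) (simp_all add: less_top[symmetric])
  have "0 \<le> (\<integral>X. (l * ?i P X - m + (\<Sum>x\<in>J. ?i (block x) X))\<^sup>2 \<partial>cantor_measure)"
    by (rule Bochner_Integration.integral_nonneg) simp
  also have "\<dots> = l\<^sup>2 * \<mu> P + m\<^sup>2 + (\<Sum>x\<in>J. \<Sum>y\<in>J. \<mu> (block x \<inter> block y)) - 2 * l * m * \<mu> P
      + 2 * l * (\<Sum>x\<in>J. \<mu> (block x \<inter> P)) - 2 * m * (\<Sum>x\<in>J. \<mu> (block x))"
    unfolding expand using P
    by (simp add: int cantor.prob_space[simplified])
  also have "\<dots> \<le> l\<^sup>2 + m\<^sup>2 + (m\<^sup>2 + m) - 2 * l * m * \<mu> P + 2 * l * (\<epsilon> * m) - 2 * m * m"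
  proof -
    have "l\<^sup>2 * \<mu> P \<le> l\<^sup>2" by (simp add: mult_left_le)
    moreover have "(\<Sum>x\<in>J. \<Sum>y\<in>J. \<mu> (block x \<inter> block y)) \<le> m\<^sup>2 + m"
    proof -
      have "(\<Sum>x\<in>J. \<Sum>y\<in>J. \<mu> (block x \<inter> block y))
          \<le> (\<Sum>x\<in>J. \<Sum>y\<in>J. (1/2) ^ snd x * (1/2) ^ snd y + (if x = y then (1/2) ^ snd x else 0))"
        by (intro sum_mono) (auto simp: measure_block_Int measure_block)
      also have "\<dots> = m\<^sup>2 + m"
        using J by (simp add: sum.distrib m_def power2_eq_square sum_product)
      finally show ?thesis .
    qed
    moreover have "(\<Sum>x\<in>J. \<mu> (block x \<inter> P)) \<le> \<epsilon> * m"
      unfolding m_def sum_distrib_left by (intro sum_mono le)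
    then have "2 * l * (\<Sum>x\<in>J. \<mu> (block x \<inter> P)) \<le> 2 * l * (\<epsilon> * m)"
      using m0 d0 by (intro mult_left_mono) (auto simp: l_def)
    moreover have "(\<Sum>x\<in>J. \<mu> (block x)) = m" by (simp add: measure_block m_def)
    ultimately show ?thesis by simp
  qed
  also have "\<dots> = m - (d * m)\<^sup>2"
    by (simp add: l_def d_def power2_eq_square algebra_simps)
  finally have "(d\<^sup>2 * m) * m \<le> 1 * m" by (simp add: power_mult_distrib power2_eq_square algebra_simps)
  then have "m = 0 \<or> d\<^sup>2 * m \<le> 1" using m0 mult_right_le_imp_le[of "d\<^sup>2 * m" m 1] by fastforce
  then show ?thesis by (auto simp: m_def[symmetric] d_def[symmetric])
qed


section \<open>From lowness to the complexity bound\<close>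

text \<open>
  Adding the error bound to an approximation makes it an upper bound.
\<close>

lemma computable_real_approximation:
  assumes "computable_real F x"
  obtains up :: "nat \<Rightarrow> real" where "rat_computable F up" "\<And>n. x \<le> up n" "up \<longlonglongrightarrow> x"
proof -
  obtain a b d where abd: "computable F a" "computable F b" "computable F d"
    and close: "\<And>n. \<bar>x - (real (a n) - real (b n)) / (real (d n) + 1)\<bar> \<le> (1/2) ^ n"
    using assms unfolding computable_real_def computable_fun_iff_computable by blast
  define q where "q n = (real (a n) - real (b n)) / (real (d n) + 1)" for n
  define up where "up n = q n + (1/2) ^ n" for n
  have close: "\<bar>x - q n\<bar> \<le> (1/2) ^ n" for n unfolding q_def by (rule close)
  have "rat_computable F q" by (rule rat_computableI[OF abd]) (simp add: q_def)
  then have "rat_computable F up" unfolding up_def by (intro computable_intros)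
  moreover have ge: "x \<le> up n" for n using close[of n] by (simp add: up_def)
  moreover have "up \<longlonglongrightarrow> x"
  proof (rule tendsto_sandwich)
    show "eventually (\<lambda>n. x \<le> up n) sequentially" using ge by simp
    have "up n \<le> x + 2 * (1/2) ^ n" for n using close[of n] unfolding up_def by linarith
    then show "eventually (\<lambda>n. up n \<le> x + 2 * (1/2) ^ n) sequentially" by simp
    have "(\<lambda>n. x + 2 * (1/2) ^ n) \<longlonglongrightarrow> x + 2 * 0"
      by (intro tendsto_intros LIMSEQ_power_zero) simp
    then show "(\<lambda>n. x + 2 * (1/2) ^ n) \<longlonglongrightarrow> x" by simp
  qed simp
  ultimately show thesis using that by blast
qed

text \<open>
  The measure \<open>\<alpha>\<close> of the domain is the sum of the weights of an enumeration of \<open>M\<close>. Upper bounds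
  for \<open>\<alpha>\<close> minus partial sums are computable bounds for the tails of this series, and therefore for
  the measure of the union of all blocks enumerated late. The \<open>n\<close>-th test set is the union of the
  blocks from a stage on at which this bound is \<open>2^-(n+1)\<close>, padded to measure \<open>2^-n\<close>.
\<close>

lemma schnorr_test_of_machine:
  assumes M: "computable_measure_machine (oracle_of A) M"
  obtains act e h U where "bij_betw e {i::nat. act i} (dom M)" "\<And>i. act i \<Longrightarrow> M (e i) = Some (h i)"
    "schnorr_test A U"
    "\<And>X. \<forall>N. \<exists>i\<ge>N. act i \<and> X \<in> block (h i, length (e i)) \<Longrightarrow> X \<in> (\<Inter>n. U n)"
proof -
  let ?F = "oracle_of A"
  have pM: "pcomputable ?F M" and pf: "prefix_free (dom M)"
    using M by (auto simp: computable_measure_machine_def prefix_free_machine_def partial_computable_iff_pcomputable)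
  define \<alpha> where "\<alpha> = (\<Sum>\<^sub>\<infinity>p\<in>dom M. (1/2 :: real) ^ length p)"
  obtain up where up: "rat_computable ?F up" "\<And>n. \<alpha> \<le> up n" "up \<longlonglongrightarrow> \<alpha>"
    using computable_real_approximation M unfolding computable_measure_machine_def \<alpha>_def by blast
  \<comment> \<open>Descriptions are enumerated so late that the block belonging to index \<open>i\<close> uses only
    coordinates below \<open>i\<close>. An initial segment longer than \<open>i\<close> then decides it.\<close>
  define bound :: "bool list \<times> bool list \<Rightarrow> nat"
    where "bound y = block_start (snd y, length (fst y)) + length (fst y)" for y
  have "computable ?F bound" unfolding bound_def block_start_def by (intro computable_intros)
  then obtain act e h where act: "decidable ?F act" and e: "computable ?F e" and h: "computable ?F h"
    and bij: "bij_betw e {i::nat. act i} (dom M)" and Me: "\<And>i. act i \<Longrightarrow> M (e i) = Some (h i)"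
    and early: "\<And>i. act i \<Longrightarrow> bound (e i, h i) \<le> i"
    using pcomputable_enumeration[OF pM] by blast
  define B where "B i = block (h i, length (e i))" for i
  define w where "w i = (if act i then (1/2) ^ length (e i) else 0 :: real)" for i
  have w0: "0 \<le> w i" for i by (simp add: w_def)
  have \<mu>B: "\<mu> (B i) = w i" if "act i" for i using that by (simp add: B_def w_def measure_block)
  have w_sum: "(w has_sum \<alpha>) UNIV"
  proof -
    have "((\<lambda>p. (1/2 :: real) ^ length p) has_sum \<alpha>) (dom M)"
      unfolding \<alpha>_def using has_sum_imp_summable[OF has_sum_cylinders[OF pf]] by (rule has_sum_infsum)
    then have "((\<lambda>i. (1/2 :: real) ^ length (e i)) has_sum \<alpha>) {i. act i}"
      by (subst has_sum_reindex_bij_betw[OF bij])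
    then show ?thesis by (rule has_sum_cong_neutral[THEN iffD1, rotated -1]) (auto simp: w_def)
  qed
  define err where "err s = up s - (\<Sum>i<s. w i)" for s
  have cw: "rat_computable ?F w" unfolding w_def by (intro computable_intros act computable_comp[OF e])
  have err: "rat_computable ?F err" unfolding err_def by (intro computable_intros up(1) rat_computable_comp[OF cw])
  have "(\<lambda>s. up s - (\<Sum>i<s. w i)) \<longlonglongrightarrow> \<alpha> - \<alpha>"
    using has_sum_imp_sums[OF w_sum] up(3) unfolding sums_def by (intro tendsto_diff)
  then have lim: "err \<longlonglongrightarrow> 0" by (simp add: err_def[abs_def])
  have tail: "\<mu> (\<Union>i\<in>{i. s \<le> i \<and> act i}. B i) \<le> err s" for s
  proof (rule measure_UN_le_infsum)
    fix J assume J: "finite J" "J \<subseteq> {i. s \<le> i \<and> act i}"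
    have "(\<Sum>i\<in>J. \<mu> (B i)) + (\<Sum>i<s. w i) = (\<Sum>i\<in>J. w i) + (\<Sum>i<s. w i)"
      using J(2) by (auto intro!: sum.cong \<mu>B)
    also have "\<dots> = (\<Sum>i\<in>J \<union> {..<s}. w i)"
      by (rule sum.union_disjoint[symmetric]) (use J in auto)
    also have "\<dots> \<le> \<alpha>" by (rule finite_sum_le_has_sum[OF w_sum]) (use J w0 in auto)
    finally show "(\<Sum>i\<in>J. \<mu> (B i)) \<le> err s" using up(2)[of s] by (simp add: err_def)
  qed (simp add: B_def)
  define start where "start n = (LEAST i. err i \<le> (1/2) ^ Suc n)" for n
  have ex_start: "\<exists>i. err i \<le> (1/2) ^ Suc n" for n
  proof -
    have "eventually (\<lambda>i. err i < (1/2) ^ Suc n) sequentially"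
      using lim by (rule order_tendstoD(2)) simp
    then show ?thesis by (meson eventually_sequentially less_imp_le order_refl)
  qed
  have start: "err (start n) \<le> (1/2) ^ Suc n" for n unfolding start_def using ex_start by (rule LeastI_ex)
  have start_mono: "start n \<le> start (Suc n)" for n
  proof -
    have "err (start (Suc n)) \<le> (1/2) ^ Suc n" using start[of "Suc n"] by (rule order_trans) simp
    then show ?thesis unfolding start_def[of n] by (rule Least_le)
  qed
  have cstart: "computable ?F start" unfolding start_def
    by (rule computable_Least[OF _ ex_start]) (intro computable_intros rat_computable_comp[OF err])
  define C where "C x \<longleftrightarrow> (\<exists>i<length (snd x). start (fst x) \<le> i \<and> act i \<and> meets (snd x) (h i, length (e i)))"
    for x :: "nat \<times> bool list"
  define U where "U n = {X. \<exists>m. C (n, pre X m)}" for n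
  have C: "decidable ?F C" unfolding C_def
    by (intro computable_intros computable_comp[OF cstart] decidable_comp[OF act] computable_comp[OF h] computable_comp[OF e])
  have fits: "block_start (h i, length (e i)) + length (e i) \<le> i" if "act i" for i
    using early[OF that] by (simp add: bound_def)
  have C_iff: "C (n, pre X m) \<longleftrightarrow> (\<exists>i<m. start n \<le> i \<and> act i \<and> X \<in> B i)" for n X m
    unfolding C_def B_def using fits meets_block[of X m] block_meets[of X _ m] by fastforce
  have U: "U n = (\<Union>i\<in>{i. start n \<le> i \<and> act i}. B i)" for n
    unfolding U_def C_iff by (auto intro: lessI)
  have mono: "C (n, t)" if C: "C (n, s)" and pre: "prefix s t" for n s t
  proof -
    obtain i where i: "i < length s" "start n \<le> i" "act i" "meets s (h i, length (e i))"
      using C by (auto simp: C_def)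
    have "meets t (h i, length (e i))"
      by (rule meets_extend[OF i(4) pre]) (use fits[OF i(3)] i(1) in simp)
    moreover have "i < length t" using i(1) prefix_length_le[OF pre] by simp
    ultimately show ?thesis using i by (auto simp: C_def)
  qed
  have approx: "\<mu> (U n) \<le> \<mu> {X. C (n, pre X s)} + err s" for n s
  proof -
    let ?T = "\<Union>i\<in>{i. s \<le> i \<and> act i}. B i"
    have sT: "?T \<in> sets cantor_measure" by (rule sets.countable_UN') (auto simp: B_def)
    have sC: "{X. C (n, pre X s)} \<in> sets cantor_measure" by (rule sets_prefix_property)
    have "U n \<subseteq> {X. C (n, pre X s)} \<union> ?T" unfolding U C_iff by force
    then have "\<mu> (U n) \<le> \<mu> ({X. C (n, pre X s)} \<union> ?T)"
      using sT sC by (intro cantor.finite_measure_mono) auto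
    also have "\<dots> \<le> \<mu> {X. C (n, pre X s)} + \<mu> ?T" by (rule measure_Un_le[OF sC sT])
    finally show ?thesis using tail[of s] by linarith
  qed
  have decr: "U (Suc n) \<subseteq> U n" for n unfolding U using start_mono[of n] by (intro UN_mono) auto
  have small: "\<mu> (U n) \<le> (1/2) ^ Suc n" for n
    unfolding U by (rule order_trans[OF tail start])
  have "\<exists>U'. schnorr_test A U' \<and> (\<forall>n. {X. \<exists>m. C (n, pre X m)} \<subseteq> U' n)"
    by (rule schnorr_test_padding[where err = err])
       (fact C mono err lim approx[unfolded U_def] decr[unfolded U_def] small[unfolded U_def])+
  then obtain U' where U': "schnorr_test A U'" "\<And>n. U n \<subseteq> U' n"
    unfolding U_def by blast
  have "X \<in> (\<Inter>n. U' n)" if "\<forall>N. \<exists>i\<ge>N. act i \<and> X \<in> block (h i, length (e i))" for X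
  proof -
    have "X \<in> U n" for n unfolding U B_def using that by blast
    then show ?thesis using U'(2) by blast
  qed
  with U'(1) show thesis using that bij Me by blast
qed

text \<open>
  Finite extension: a string \<open>t\<close> with \<open>cylinder t - W\<close> of positive measure is extended into a further
  block so that the measure stays positive. In the limit \<open>X\<close> lies in all the blocks chosen, and \<open>X\<close>
  is outside the open set \<open>W\<close>, since otherwise one of the cylinders would be contained in \<open>W\<close>.
\<close>

lemma generic_extension:
  fixes B :: "nat \<Rightarrow> bool list \<times> nat" and act :: "nat \<Rightarrow> bool"
  assumes W: "W = {X. \<exists>m. C (pre X m)}" and mono: "\<forall>s t. C s \<longrightarrow> prefix s t \<longrightarrow> C t"
    and pos: "\<mu> W < 1"
    and dense: "\<forall>t N. 0 < \<mu> (cylinder t - W) \<longrightarrow> (\<exists>i\<ge>N. act i \<and> 0 < \<mu> (block (B i) \<inter> (cylinder t - W)))"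
  shows "\<exists>X. X \<notin> W \<and> (\<forall>N. \<exists>i\<ge>N. act i \<and> X \<in> block (B i))"
proof -
  have sW: "W \<in> sets cantor_measure" unfolding W by (rule sets_ex_prefix)
  define good where "good t \<longleftrightarrow> 0 < \<mu> (cylinder t - W)" for t
  have step: "\<exists>u. good u \<and> prefix t u \<and> N < length u \<and> (\<exists>i\<ge>N. act i \<and> cylinder u \<subseteq> block (B i))"
    if good: "good t" for t N
  proof -
    obtain i where i: "N \<le> i" "act i" and p: "0 < \<mu> (block (B i) \<inter> (cylinder t - W))"
      using dense good unfolding good_def by blast
    define L where "L = Suc N + length t + (block_start (B i) + snd (B i))"
    define R where "R = {u :: bool list. length u = L}"
    have finR: "finite R" using finite_strings[of L "\<lambda>_. True"] by (simp add: R_def)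
    let ?P = "block (B i) \<inter> (cylinder t - W)"
    have sP: "?P \<in> sets cantor_measure" using sW by auto
    have "?P = (\<Union>u\<in>R. ?P \<inter> cylinder u)" by (auto simp: R_def cylinder_iff)
    then have "\<mu> ?P = \<mu> (\<Union>u\<in>R. ?P \<inter> cylinder u)" by (rule arg_cong)
    also have "\<dots> \<le> (\<Sum>u\<in>R. \<mu> (?P \<inter> cylinder u))"
      by (rule cantor.finite_measure_subadditive_finite[OF finR])
         (intro image_subsetI sets.Int[OF sP] sets_cylinder)
    finally have le: "\<mu> ?P \<le> (\<Sum>u\<in>R. \<mu> (?P \<inter> cylinder u))" .
    have "\<exists>u\<in>R. 0 < \<mu> (?P \<inter> cylinder u)"
    proof (rule ccontr)
      assume "\<not> (\<exists>u\<in>R. 0 < \<mu> (?P \<inter> cylinder u))"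
      then have "(\<Sum>u\<in>R. \<mu> (?P \<inter> cylinder u)) \<le> 0" by (intro sum_nonpos) (simp add: not_less)
      with le p show False by linarith
    qed
    then obtain u where u: "u \<in> R" "0 < \<mu> (?P \<inter> cylinder u)" by blast
    then have "?P \<inter> cylinder u \<noteq> {}" by (metis measure_empty less_irrefl)
    then obtain X where X: "X \<in> block (B i)" "X \<in> cylinder t" "X \<in> cylinder u" by blast
    have u_pre: "pre X L = u" using X(3) u(1) by (simp add: cylinder_iff R_def)
    have t_pre: "pre X (length t) = t" using X(2) by (simp add: cylinder_iff)
    have tu: "prefix t u" using prefix_pre[of "length t" L X] u_pre t_pre by (simp add: L_def)
    have "cylinder u \<subseteq> block (B i)"
    proof
      fix Y assume "Y \<in> cylinder u"
      then have "pre Y L = u" using u(1) by (simp add: cylinder_iff R_def)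
      moreover have "meets u (B i)" using block_meets[OF X(1), of L] u_pre by simp
      ultimately show "Y \<in> block (B i)" by (intro meets_block[of Y L]) (simp_all add: L_def)
    qed
    moreover have "good u"
    proof -
      have "\<mu> (?P \<inter> cylinder u) \<le> \<mu> (cylinder u - W)"
        using sW by (intro cantor.finite_measure_mono) auto
      with u(2) show ?thesis unfolding good_def by linarith
    qed
    ultimately show ?thesis using i tu u(1) by (auto simp: R_def L_def)
  qed
  have "good []"
  proof -
    have "cylinder [] = UNIV" by (auto simp: cylinder_def)
    then have "\<mu> (cylinder [] - W) = 1 - \<mu> W"
      using cantor.prob_compl[OF sW] by simp
    then show ?thesis using pos by (simp add: good_def)
  qed
  then obtain t where t: "\<And>n. good (t n)"
    "\<And>n. prefix (t n) (t (Suc n)) \<and> n < length (t (Suc n)) \<and> (\<exists>i\<ge>n. act i \<and> cylinder (t (Suc n)) \<subseteq> block (B i))"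
    using dependent_nat_choice[of "\<lambda>_. good" "\<lambda>n t u. prefix t u \<and> n < length u \<and> (\<exists>i\<ge>n. act i \<and> cylinder u \<subseteq> block (B i))"]
      step by metis
  have chain: "prefix (t m) (t n)" if "m \<le> n" for m n
    using that by (induction rule: dec_induct) (use t(2) prefix_order.trans in blast)+
  define X where "X i = t (Suc i) ! i" for i
  have "X \<in> cylinder (t n)" for n
  proof -
    have "X i = t n ! i" if i: "i < length (t n)" for i
    proof (cases "Suc i \<le> n")
      case True
      then show ?thesis using chain[OF True] t(2)[of i] unfolding X_def by (auto simp: prefix_def nth_append)
    next
      case False
      then have "prefix (t n) (t (Suc i))" by (intro chain) simp
      then show ?thesis using i unfolding X_def by (auto simp: prefix_def nth_append)
    qed
    then show ?thesis by (simp add: cylinder_def)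
  qed
  note inX = this
  have "\<exists>i\<ge>N. act i \<and> X \<in> block (B i)" for N
    using t(2)[of N] inX[of "Suc N"] by blast
  moreover have "X \<notin> W"
  proof
    assume "X \<in> W"
    then obtain m where m: "C (pre X m)" by (auto simp: W)
    have "cylinder (t (Suc m)) \<subseteq> W"
    proof
      fix Y assume "Y \<in> cylinder (t (Suc m))"
      then have "pre Y (length (t (Suc m))) = pre X (length (t (Suc m)))"
        using inX[of "Suc m"] by (simp add: cylinder_iff)
      then have "prefix (pre X m) (pre Y (length (t (Suc m))))"
        using t(2)[of m] by (simp add: prefix_pre)
      then show "Y \<in> W" unfolding W using mono m by blast
    qed
    then have empty: "cylinder (t (Suc m)) - W = {}" by blast
    show False using t(1)[of "Suc m"] unfolding good_def empty by simp
  qed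
  ultimately show ?thesis by blast
qed

text \<open>
  Compare with the machine that describes only \<open>s\<close>, by the empty string.
\<close>

lemma K_finite:
  assumes "optimal_prefix_free_machine Mopt" shows "\<exists>c. K Mopt s \<le> enat c"
proof -
  define M where "M p = (if p = [] then Some s else None)" for p :: "bool list"
  have "pcomputable {} (\<lambda>p. if \<exists>n::nat. p = [] then Some ((\<lambda>_ _. s) p (LEAST n::nat. p = [])) else None)"
    by (rule pcomputable_search) (intro computable_intros)+
  then have "pcomputable {} M" by (simp add: M_def[abs_def])
  then have "prefix_free_machine {} M"
    unfolding prefix_free_machine_def partial_computable_iff_pcomputable prefix_free_def by (auto simp: M_def split: if_splits)
  then obtain c :: nat where c: "K Mopt s \<le> K M s + enat c"
    using assms unfolding optimal_prefix_free_machine_def by blast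
  have "K M s \<le> enat 0" unfolding K_le_iff by (simp add: M_def)
  then have "K Mopt s \<le> enat c" using c by (metis add_left_mono add_0 zero_enat_def order_trans add_right_mono)
  then show ?thesis by blast
qed

text \<open>
  The pairs whose block meets \<open>P = cylinder t - W\<close> in measure less than \<open>2^-n * 2^-k\<close>, where \<open>2^-n\<close>
  is below the measure of \<open>P\<close>, form a c.e. set: \<open>P\<close> is the intersection of a decreasing computable
  sequence of clopen sets, so the inequality holds if and only if it holds at some stage. By
  \<open>block_second_moment\<close> their weights are summable, hence they can serve as requests for descriptions
  of length \<open>k + c\<close>. Pairs whose block meets \<open>P\<close> in a null set are among them.
\<close>

lemma complexity_bound_small_blocks:
  assumes opt: "optimal_prefix_free_machine Mopt"
    and W: "W = {X. \<exists>m. C (pre X m)}" and mono: "\<forall>s t. C s \<longrightarrow> prefix s t \<longrightarrow> C t"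
    and C: "decidable {} C" and pos: "0 < \<mu> (cylinder t - W)"
  obtains c where "\<And>s k. \<mu> (block (s, k) \<inter> (cylinder t - W)) = 0 \<Longrightarrow> K Mopt s \<le> enat (k + c)"
proof -
  let ?P = "cylinder t - W"
  have sW: "W \<in> sets cantor_measure" unfolding W by (rule sets_ex_prefix)
  obtain n where n: "(1/2) ^ n < \<mu> ?P" using real_arch_pow_inv[OF pos, of "1/2"] by auto
  define d where "d = \<mu> ?P - (1/2) ^ n"
  have d: "0 < d" using n by (simp add: d_def)
  have "0 < d\<^sup>2 / 2" using d by simp
  then obtain c where c: "(1/2) ^ c < d\<^sup>2 / 2" using real_arch_pow_inv[of "d\<^sup>2 / 2" "1/2"] by auto
  \<comment> \<open>The stage approximations of the block of \<open>x\<close> intersected with \<open>cylinder t - W\<close>; the equation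
    between prefixes says that \<open>r\<close> and \<open>t\<close> are comparable.\<close>
  define \<phi> where "\<phi> x r \<longleftrightarrow> meets r x \<and> take (length t) r = take (length r) t \<and> \<not> C r" for x r
  define R where "R x s \<longleftrightarrow> real (card {r. length r = s \<and> \<phi> x r}) * (1/2) ^ s < (1/2) ^ n * (1/2) ^ snd x" for x s
  define f where "f x = (if \<exists>s. R x s then Some (fst x) else None)" for x
  have card: "real (card {r. length r = s \<and> \<phi> x r}) * (1/2) ^ s = \<mu> {X. \<phi> x (pre X s)}" for x s
    by (simp add: measure_prefix_property power_one_over)
  have \<phi>_mono: "\<phi> x r" if u: "\<phi> x u" and pre: "prefix r u" for x r u
  proof -
    have "meets r x" "\<not> C r"
      using u meets_prefix[OF _ pre] mono pre unfolding \<phi>_def by blast+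
    moreover have "take (length t) r = take (length r) t"
    proof -
      obtain v where v: "u = r @ v" using pre by (auto simp: prefix_def)
      have "take (length t) r = take (length r) (take (length t) u)"
        by (cases "length t \<le> length r") (simp_all add: v)
      also have "\<dots> = take (length r) (take (length u) t)" using u by (simp add: \<phi>_def)
      also have "\<dots> = take (length r) t" by (simp add: v)
      finally show ?thesis .
    qed
    ultimately show ?thesis by (simp add: \<phi>_def)
  qed
  have inter: "(\<Inter>s. {X. \<phi> x (pre X s)}) = block x \<inter> ?P" for x
  proof (intro set_eqI iffI)
    fix X assume "X \<in> (\<Inter>s. {X. \<phi> x (pre X s)})"
    then have all: "\<phi> x (pre X s)" for s by blast
    have "X \<in> block x" using all[of "block_start x + snd x"] by (auto simp: \<phi>_def intro: meets_block)
    moreover have "X \<in> cylinder t" using all[of "length t"] by (simp add: \<phi>_def cylinder_iff)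
    moreover have "X \<notin> W" using all by (auto simp: \<phi>_def W)
    ultimately show "X \<in> block x \<inter> ?P" by blast
  next
    fix X assume X: "X \<in> block x \<inter> ?P"
    have "\<phi> x (pre X s)" for s
    proof -
      have t: "pre X (length t) = t" using X by (simp add: cylinder_iff)
      have "take (length t) (pre X s) = take s (pre X (length t))"
        by (cases "length t \<le> s") (simp_all add: take_pre)
      then have "take (length t) (pre X s) = take s t" by (simp add: t)
      then show ?thesis using X block_meets[of X x s] by (auto simp: \<phi>_def W)
    qed
    then show "X \<in> (\<Inter>s. {X. \<phi> x (pre X s)})" by blast
  qed
  have s\<phi>: "{X. \<phi> x (pre X s)} \<in> sets cantor_measure" for x s by (rule sets_prefix_property)
  have R_iff: "(\<exists>s. R x s) \<longleftrightarrow> \<mu> (block x \<inter> ?P) < (1/2) ^ n * (1/2) ^ snd x" for x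
  proof
    assume "\<exists>s. R x s"
    then obtain s where "\<mu> {X. \<phi> x (pre X s)} < (1/2) ^ n * (1/2) ^ snd x" unfolding R_def card by blast
    moreover have "\<mu> (block x \<inter> ?P) \<le> \<mu> {X. \<phi> x (pre X s)}"
      unfolding inter[symmetric] by (rule cantor.finite_measure_mono[OF _ s\<phi>]) blast
    ultimately show "\<mu> (block x \<inter> ?P) < (1/2) ^ n * (1/2) ^ snd x" by linarith
  next
    assume lt: "\<mu> (block x \<inter> ?P) < (1/2) ^ n * (1/2) ^ snd x"
    have "(\<lambda>s. \<mu> {X. \<phi> x (pre X s)}) \<longlonglongrightarrow> \<mu> (block x \<inter> ?P)"
      unfolding inter[symmetric]
    proof (rule cantor.finite_Lim_measure_decseq)
      show "decseq (\<lambda>s. {X. \<phi> x (pre X s)})"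
        by (rule decseq_SucI) (use \<phi>_mono prefix_pre[OF le_SucI[OF order_refl]] in blast)
    qed (use s\<phi> in blast)
    then have "eventually (\<lambda>s. \<mu> {X. \<phi> x (pre X s)} < (1/2) ^ n * (1/2) ^ snd x) sequentially"
      using lt by (rule order_tendstoD(2))
    then show "\<exists>s. R x s" unfolding R_def card eventually_sequentially by blast
  qed
  have "pcomputable {} f"
  proof -
    have "pcomputable {} (\<lambda>x. if \<exists>s. R x s then Some ((\<lambda>x s. fst x) x (LEAST s. R x s)) else None)"
    proof (rule pcomputable_search)
      have "decidable {} (\<lambda>p::(bool list \<times> nat) \<times> bool list. \<phi> (fst p) (snd p))"
        unfolding \<phi>_def by (intro computable_intros decidable_comp[OF C])
      note decidable\<phi> = decidable_comp[OF this, where f = "\<lambda>q. (fst (fst q), snd q)", simplified]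
      show "decidable {} (\<lambda>p. R (fst p) (snd p))"
        unfolding R_def by (intro computable_intros decidable\<phi>)
    qed (intro computable_intros)
    then show ?thesis by (simp add: f_def[abs_def])
  qed
  moreover have "computable {} (\<lambda>x::bool list \<times> nat. snd x + c)" by (intro computable_intros)
  moreover have "(\<Sum>x\<in>J. 2 * (1/2) ^ (snd x + c)) \<le> (1::real)" if J: "finite J" "J \<subseteq> dom f" for J
  proof -
    have "\<mu> (block x \<inter> ?P) \<le> (1/2) ^ n * (1/2) ^ snd x" if "x \<in> J" for x
      using J(2) that R_iff[of x] by (auto simp: f_def split: if_splits)
    then have "d\<^sup>2 * (\<Sum>x\<in>J. (1/2) ^ snd x) \<le> 1"
      unfolding d_def using sW n by (intro block_second_moment[OF J(1)]) auto
    moreover have "2 * (1/2) ^ c * (\<Sum>x\<in>J. (1/2 :: real) ^ snd x) \<le> d\<^sup>2 * (\<Sum>x\<in>J. (1/2) ^ snd x)"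
      using c by (intro mult_right_mono sum_nonneg) auto
    moreover have "(\<Sum>x\<in>J. 2 * (1/2) ^ (snd x + c)) = 2 * (1/2) ^ c * (\<Sum>x\<in>J. (1/2 :: real) ^ snd x)"
      by (simp add: sum_distrib_left power_add mult_ac)
    ultimately show ?thesis by linarith
  qed
  ultimately obtain M g where M: "prefix_free_machine {} M"
    and g: "\<And>x. x \<in> dom f \<Longrightarrow> length (g x) = snd x + c \<and> M (g x) = f x"
    using kraft_chaitin[of "{}" f "\<lambda>x. snd x + c"] by blast
  obtain c' :: nat where c': "\<And>s. K Mopt s \<le> K M s + enat c'"
    using opt M unfolding optimal_prefix_free_machine_def by blast
  have "K Mopt s \<le> enat (k + (c + c'))" if null: "\<mu> (block (s, k) \<inter> ?P) = 0" for s k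
  proof -
    have "\<exists>u. R (s, k) u" unfolding R_iff null by simp
    then have f: "f (s, k) = Some s" by (simp add: f_def)
    then have "(s, k) \<in> dom f" by blast
    from g[OF this] have "M (g (s, k)) = Some s \<and> length (g (s, k)) \<le> k + c" by (simp add: f)
    then have "K M s \<le> enat (k + c)" unfolding K_le_iff by blast
    then have "K M s + enat c' \<le> enat (k + c) + enat c'" by (rule add_right_mono)
    with c'[of s] show ?thesis by (simp add: add.assoc)
  qed
  then show thesis by (rule that)
qed

text \<open>
  Lowness excludes the conclusion of \<open>generic_extension\<close>, so its density hypothesis fails for some
  \<open>t\<close> and \<open>N\<close>. Descriptions enumerated from \<open>N\<close> on are then covered by
  \<open>complexity_bound_small_blocks\<close>, and the finitely many earlier ones only affect the constant.
\<close>

lemma complexity_bound_if_Low_MLR_SR: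
  assumes opt: "optimal_prefix_free_machine Mopt" and low: "A \<in> Low_MLR_SR"
    and M: "computable_measure_machine (oracle_of A) M"
  shows "\<exists>c::nat. \<forall>s. K Mopt s \<le> K M s + enat c"
proof -
  obtain act e h U where bij: "bij_betw e {i::nat. act i} (dom M)"
    and Me: "\<And>i. act i \<Longrightarrow> M (e i) = Some (h i)" and U: "schnorr_test A U"
    and cover: "\<And>X. \<forall>N. \<exists>i\<ge>N. act i \<and> X \<in> block (h i, length (e i)) \<Longrightarrow> X \<in> (\<Inter>n. U n)"
    by (rule schnorr_test_of_machine[OF M]) blast
  define W where "W = deficiency_set Mopt 1"
  have pf: "prefix_free_machine {} Mopt" using opt by (simp add: optimal_prefix_free_machine_def)
  have ce: "uniformly_ce_open {} (deficiency_set Mopt)"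
    using martin_lof_test_deficiency[OF pf] by (simp add: martin_lof_test_def)
  obtain D where D: "decidable {} D" "\<And>n s t. D (n, s) \<Longrightarrow> prefix s t \<Longrightarrow> D (n, t)"
    "\<And>n. deficiency_set Mopt n = {X. \<exists>m. D (n, pre X m)}"
    using uniformly_ce_openE[OF ce] by blast
  define C where "C s \<longleftrightarrow> D (1, s)" for s
  have C: "decidable {} C" unfolding C_def by (intro decidable_comp[OF D(1)] computable_intros)
  have mono: "\<forall>s t. C s \<longrightarrow> prefix s t \<longrightarrow> C t" using D(2) unfolding C_def by blast
  have W: "W = {X. \<exists>m. C (pre X m)}" unfolding W_def D(3) C_def ..
  have "\<mu> W \<le> (1/2) ^ 1"
    unfolding W_def using pf by (intro measure_deficiency_set) (simp add: prefix_free_machine_def)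
  then have W1: "\<mu> W < 1" by simp
  have "\<not> (\<exists>X. X \<notin> W \<and> (\<forall>N. \<exists>i\<ge>N. act i \<and> X \<in> block (h i, length (e i))))"
  proof
    assume "\<exists>X. X \<notin> W \<and> (\<forall>N. \<exists>i\<ge>N. act i \<and> X \<in> block (h i, length (e i)))"
    then obtain X where X: "X \<notin> W" "\<forall>N. \<exists>i\<ge>N. act i \<and> X \<in> block (h i, length (e i))" by blast
    have "X \<in> MLR" using incompressible_MLR[OF opt] X(1) unfolding W_def by blast
    then have "X \<in> SR A" using low by (auto simp: Low_MLR_SR_def)
    then show False using cover[OF X(2)] U unfolding SR_def by blast
  qed
  then obtain t N where pos: "0 < \<mu> (cylinder t - W)"
    and null: "\<And>i. N \<le> i \<Longrightarrow> act i \<Longrightarrow> \<not> 0 < \<mu> (block (h i, length (e i)) \<inter> (cylinder t - W))"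
    using generic_extension[OF W mono W1, where act = act and B = "\<lambda>i. (h i, length (e i))"] by blast
  obtain c where c: "\<And>s k. \<mu> (block (s, k) \<inter> (cylinder t - W)) = 0 \<Longrightarrow> K Mopt s \<le> enat (k + c)"
    using complexity_bound_small_blocks[OF opt W mono C pos] by blast
  have "\<forall>i. \<exists>b. K Mopt (h i) \<le> enat b" using K_finite[OF opt] by blast
  then obtain b where b: "\<And>i. K Mopt (h i) \<le> enat (b i)" by metis
  have "K Mopt s \<le> K M s + enat (c + sum b {..<N})" for s
  proof (cases "K M s")
    case (enat k)
    then obtain p where p: "M p = Some s" "length p \<le> k" using K_le_iff[of M s k] by auto
    then obtain i where i: "act i" "e i = p" using bij by (auto simp: bij_betw_def image_iff) (metis domI image_iff mem_Collect_eq)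
    have hi: "h i = s" using Me[OF i(1)] i(2) p(1) by simp
    show ?thesis
    proof (cases "i < N")
      case True
      then have "b i \<le> sum b {..<N}" by (intro member_le_sum) auto
      then have "enat (b i) \<le> K M s + enat (c + sum b {..<N})" by (simp add: enat)
      then show ?thesis using b[of i] unfolding hi by (rule order_trans[rotated])
    next
      case False
      then have "\<mu> (block (s, length p) \<inter> (cylinder t - W)) = 0"
        using null[of i] i hi measure_nonneg[of cantor_measure] by (metis leI order_antisym not_less)
      then have "K Mopt s \<le> enat (length p + c)" by (rule c)
      also have "\<dots> \<le> K M s + enat (c + sum b {..<N})" using p(2) by (simp add: enat)
      finally show ?thesis .
    qed
  qed simp
  then show ?thesis by blast
qed

theorem proposition5p4:
  fixes A :: "nat \<Rightarrow> bool"
    and Mopt :: "bool list \<Rightarrow> bool list option"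
  assumes "optimal_prefix_free_machine Mopt"
  shows "A \<in> Low_MLR_SR \<longleftrightarrow>
    (\<forall>M. computable_measure_machine (oracle_of A) M \<longrightarrow>
       (\<exists>c::nat. \<forall>\<sigma>. K Mopt \<sigma> \<le> K M \<sigma> + enat c))"
  using complexity_bound_if_Low_MLR_SR[OF assms] Low_MLR_SR_if_complexity_bound[OF assms] by blast

end
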